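(* Let $I\ne\{0\}$ be an ideal of $B(H)$. (i) If $\omega\notin\Sigma(I)$, then $(F+[I,B(H)])^+=({}_{a_\infty}I)^+$. (ii) If $\omega\in\Sigma(I)$, then $(F+[I,B(H)])^+=({}_aI)^+$. (iii) $(F+[I,B(H)])^+$ is hereditary (i.e., solid): if $0\le Y\le X$ and $X\in(F+[I,B(H)])^+$, then $Y\in(F+[I,B(H)])^+$.
   Context: $H$ is a complex separable infinite-dimensional Hilbert space. "Ideal" means a proper two-sided ideal of $B(H)$; every such ideal is contained in the compact operators. $F$ is the ideal of finite rank operators. $[I,B(H)]$ is the linear span of the commutators $XY-YX$ with $X\in I$, $Y\in B(H)$. For a set $V$ of operators, $V^+$ is the set of positive (semidefinite) operators in $V$. $\mathrm{c}_{\mathrm o}^*$ is the set of nonincreasing sequences of nonnegative reals (indexed by $n\ge1$) converging to $0$, and $(\ell^1)^*:=\ell^1\cap \mathrm{c}_{\mathrm o}^*$. $\Sigma(I)=\{s(X)\mid X\in I\}$, with $s(X)$ the sequence of $s$-numbers (singular values in decreasing order, completed by zeros). Ideals correspond bijectively (Calkin) to characteristic sets (hereditary positive cones in $\mathrm{c}_{\mathrm o}^*$ invariant under the ampliations $D_m$ which repeat each entry $m$ times), so an ideal may be defined by giving its characteristic set. $\omega=\langle1/n\rangle$. With $\xi_a:=\langle\frac1n\sum_{j=1}^n\xi_j\rangle_n$ and, for $\xi\in(\ell^1)^*$, $\xi_{a_\infty}:=\langle\frac1n\sum_{j=n+1}^\infty\xi_j\rangle_n$, the ideals ${}_aI$ and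 ${}_{a_\infty}I$ are defined by $\Sigma({}_aI)=\{\xi\in \mathrm{c}_{\mathrm o}^*\mid\xi_a\in\Sigma(I)\}$ and (for $I\ne\{0\}$) $\Sigma({}_{a_\infty}I)=\{\xi\in(\ell^1)^*\mid\xi_{a_\infty}\in\Sigma(I)\}$. *)

theory Defs
  imports "HOL-Analysis.Analysis"
begin

section \<open>Complex Hilbert spaces\<close>

class complex_vector = real_vector +
  fixes scaleC :: "complex \<Rightarrow> 'a \<Rightarrow> 'a"  (infixr \<open>*\<^sub>C\<close> 75)
  assumes scaleC_add_right: "c *\<^sub>C (x + y) = c *\<^sub>C x + c *\<^sub>C y"
    and scaleC_add_left: "(c + d) *\<^sub>C x = c *\<^sub>C x + d *\<^sub>C x"
    and scaleC_scaleC: "c *\<^sub>C d *\<^sub>C x = (c * d) *\<^sub>C x"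
    and scaleC_of_real: "complex_of_real r *\<^sub>C x = r *\<^sub>R x"

lemma scaleC_one: "1 *\<^sub>C x = (x :: 'a::complex_vector)"
  using scaleC_of_real[of 1 x] by simp

global_interpretation complex_vector:
  vector_space "scaleC :: complex \<Rightarrow> 'a \<Rightarrow> 'a::complex_vector"
  by unfold_locales
    (simp_all add: scaleC_add_right scaleC_add_left scaleC_scaleC scaleC_one)

text \<open>The inner product is linear in its first argument.\<close>

class chilbert_space = complex_vector + banach +
  fixes cinner :: "'a \<Rightarrow> 'a \<Rightarrow> complex"
  assumes cinner_commute: "cinner x y = cnj (cinner y x)"
    and cinner_add_left: "cinner (x + y) z = cinner x z + cinner y z"
    and cinner_scaleC_left: "cinner (c *\<^sub>C x) y = c * cinner x y"
    and cinner_self: "cinner x x = complex_of_real ((norm x)\<^sup>2)"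

lemma norm_scaleC: "norm (c *\<^sub>C x) = cmod c * norm (x :: 'a::chilbert_space)"
proof -
  have "complex_of_real ((norm (c *\<^sub>C x))\<^sup>2) = c * cnj (cinner (c *\<^sub>C x) x)"
    by (metis cinner_commute cinner_scaleC_left cinner_self)
  also have "\<dots> = (c * cnj c) * complex_of_real ((norm x)\<^sup>2)"
    by (simp add: cinner_scaleC_left cinner_self)
  also have "\<dots> = complex_of_real ((cmod c * norm x)\<^sup>2)"
    by (simp only: power_mult_distrib of_real_mult complex_norm_square)
  finally have "(norm (c *\<^sub>C x))\<^sup>2 = (cmod c * norm x)\<^sup>2"
    using of_real_eq_iff by blast
  then show ?thesis
    by (simp add: power2_eq_iff_nonneg)
qed

text \<open>\<open>has_cdim E k\<close>: the subspace \<open>E\<close> has finite complex dimension \<open>k\<close>.\<close>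

definition has_cdim :: "'a::complex_vector set \<Rightarrow> nat \<Rightarrow> bool"
  where "has_cdim E k \<longleftrightarrow>
    (\<exists>B. finite B \<and> card B = k \<and> complex_vector.independent B \<and> complex_vector.span B = E)"

section \<open>Bounded operators\<close>

text \<open>The type \<open>'a \<Rightarrow>\<^sub>L 'a\<close> consists of the bounded real-linear maps; \<open>B(H)\<close> is its subset of
  complex-linear maps. Scalar multiplication of operators is pointwise.\<close>

instantiation blinfun :: (real_normed_vector, chilbert_space) complex_vector
begin

lift_definition scaleC_blinfun :: "complex \<Rightarrow> ('a, 'b) blinfun \<Rightarrow> ('a, 'b) blinfun"
  is "\<lambda>c T x. c *\<^sub>C T x"
proof -
  fix c :: complex and T :: "'a \<Rightarrow> 'b"
  assume T: "bounded_linear T"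
  then obtain K where K: "\<And>x. norm (T x) \<le> norm x * K"
    using bounded_linear.bounded by blast
  show "bounded_linear (\<lambda>x. c *\<^sub>C T x)"
  proof (rule bounded_linear_intro[where K = "cmod c * K"])
    show "c *\<^sub>C T (x + y) = c *\<^sub>C T x + c *\<^sub>C T y" for x y
      by (simp add: linear_add[OF bounded_linear.linear[OF T]] scaleC_add_right)
    show "c *\<^sub>C T (r *\<^sub>R x) = r *\<^sub>R (c *\<^sub>C T x)" for r x
      by (simp add: linear_scale[OF bounded_linear.linear[OF T]] scaleC_scaleC mult.commute
          flip: scaleC_of_real)
    show "norm (c *\<^sub>C T x) \<le> norm x * (cmod c * K)" for x
      using mult_left_mono[OF K norm_ge_zero[of c]] by (simp add: norm_scaleC mult_ac)
  qed
qed

instance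
  by standard
    (transfer; simp add: scaleC_add_right scaleC_add_left scaleC_scaleC scaleC_of_real)+

end

definition BH :: "('a::chilbert_space \<Rightarrow>\<^sub>L 'a) set"
  where "BH = {T. \<forall>c x. blinfun_apply T (c *\<^sub>C x) = c *\<^sub>C blinfun_apply T x}"

definition finite_rank :: "('a::chilbert_space \<Rightarrow>\<^sub>L 'a) set"
  where "finite_rank = {T \<in> BH. \<exists>k. has_cdim (range (blinfun_apply T)) k}"

definition positive_op :: "('a::chilbert_space \<Rightarrow>\<^sub>L 'a) \<Rightarrow> bool"
  where "positive_op T \<longleftrightarrow> T \<in> BH \<and> (\<forall>x. cinner (blinfun_apply T x) x \<in> \<real>\<^sub>\<ge>\<^sub>0)"

definition pos_part_set :: "('a::chilbert_space \<Rightarrow>\<^sub>L 'a) set \<Rightarrow> ('a \<Rightarrow>\<^sub>L 'a) set"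
  where "pos_part_set V = {T \<in> V. positive_op T}"

definition adj :: "('a::chilbert_space \<Rightarrow>\<^sub>L 'a) \<Rightarrow> 'a \<Rightarrow>\<^sub>L 'a"
  where "adj T =
    (THE S. \<forall>x y. cinner (blinfun_apply T x) y = cinner x (blinfun_apply S y))"

text \<open>Proper two-sided ideals. Closure under scalars follows from closure under
  composition with scalar multiples of the identity.\<close>

definition op_ideal :: "('a::chilbert_space \<Rightarrow>\<^sub>L 'a) set \<Rightarrow> bool"
  where "op_ideal I \<longleftrightarrow> I \<subset> BH \<and> 0 \<in> I \<and> (\<forall>X\<in>I. \<forall>Y\<in>I. X + Y \<in> I) \<and>
    (\<forall>X\<in>I. \<forall>T\<in>BH. T o\<^sub>L X \<in> I \<and> X o\<^sub>L T \<in> I)"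

definition commutator_space :: "('a::chilbert_space \<Rightarrow>\<^sub>L 'a) set \<Rightarrow> ('a \<Rightarrow>\<^sub>L 'a) set"
  where "commutator_space I =
    complex_vector.span {(X o\<^sub>L Y) - (Y o\<^sub>L X) | X Y. X \<in> I \<and> Y \<in> BH}"

definition F_plus_comm :: "('a::chilbert_space \<Rightarrow>\<^sub>L 'a) set \<Rightarrow> ('a \<Rightarrow>\<^sub>L 'a) set"
  where "F_plus_comm I = {A + C | A C. A \<in> finite_rank \<and> C \<in> commutator_space I}"

section \<open>Sequences, singular numbers and characteristic sets\<close>

text \<open>Sequences are indexed from \<open>0\<close>: the entry at \<open>n\<close> is the usual entry number \<open>n + 1\<close>.\<close>

definition c0_star :: "(nat \<Rightarrow> real) set"
  where "c0_star = {\<xi>. decseq \<xi> \<and> (\<forall>n. 0 \<le> \<xi> n) \<and> \<xi> \<longlonglongrightarrow> 0}"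

definition l1_star :: "(nat \<Rightarrow> real) set"
  where "l1_star = {\<xi> \<in> c0_star. summable \<xi>}"

definition omega :: "nat \<Rightarrow> real"
  where "omega n = 1 / real (Suc n)"

definition arith_mean :: "(nat \<Rightarrow> real) \<Rightarrow> nat \<Rightarrow> real"
  where "arith_mean \<xi> n = (\<Sum>j\<le>n. \<xi> j) / real (Suc n)"

definition arith_mean_inf :: "(nat \<Rightarrow> real) \<Rightarrow> nat \<Rightarrow> real"
  where "arith_mean_inf \<xi> n = (\<Sum>j. \<xi> (j + Suc n)) / real (Suc n)"

text \<open>The singular values of \<open>X\<close> are the square roots of the eigenvalues of \<open>X\<^sup>* X\<close>, counted
  with multiplicity. A sequence in \<^term>\<open>c0_star\<close> is determined by how often it takes each
  positive value, so \<open>s_numbers X\<close> is well defined for every compact \<open>X\<close>, and the completion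
  by zeros is automatic. It is only meaningful for compact operators; all proper ideals
  of \<open>B(H)\<close> consist of those.\<close>

definition s_numbers :: "('a::chilbert_space \<Rightarrow>\<^sub>L 'a) \<Rightarrow> nat \<Rightarrow> real"
  where "s_numbers X = (THE \<xi>. \<xi> \<in> c0_star \<and>
    (\<forall>t>0. has_cdim {x. blinfun_apply (adj X o\<^sub>L X) x = t\<^sup>2 *\<^sub>R x} (card {n. \<xi> n = t})))"

definition char_set :: "('a::chilbert_space \<Rightarrow>\<^sub>L 'a) set \<Rightarrow> (nat \<Rightarrow> real) set"
  where "char_set I = s_numbers ` I"

text \<open>By Calkin's theorem the ideal with a given characteristic set exists and is unique.\<close>

definition ideal_of_char_set :: "(nat \<Rightarrow> real) set \<Rightarrow> ('a::chilbert_space \<Rightarrow>\<^sub>L 'a) set"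
  where "ideal_of_char_set S = (THE J. op_ideal J \<and> char_set J = S)"

definition pre_am_ideal :: "('a::chilbert_space \<Rightarrow>\<^sub>L 'a) set \<Rightarrow> ('a \<Rightarrow>\<^sub>L 'a) set"
  where "pre_am_ideal I = ideal_of_char_set {\<xi> \<in> c0_star. arith_mean \<xi> \<in> char_set I}"

definition pre_am_inf_ideal :: "('a::chilbert_space \<Rightarrow>\<^sub>L 'a) set \<Rightarrow> ('a \<Rightarrow>\<^sub>L 'a) set"
  where "pre_am_inf_ideal I = ideal_of_char_set {\<xi> \<in> l1_star. arith_mean_inf \<xi> \<in> char_set I}"

end

theory Submission
  imports Defs
begin

text \<open>
  A positive operator \<open>X\<close> in \<open>F + [I,B(H)]\<close> lies in \<open>I\<close>, hence is compact and diagonal in an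
  orthonormal system, with decreasing eigenvalues \<open>\<sigma>\<close>. Membership turns out to depend on \<open>\<sigma>\<close> alone:
  if \<open>\<omega> \<in> \<Sigma>(I)\<close>, it means that the arithmetic mean of \<open>\<sigma>\<close> is in \<open>\<Sigma>(I)\<close>
  (\<open>positive_F_plus_comm_omega\<close>); if \<open>\<omega> \<notin> \<Sigma>(I)\<close>, it means that \<open>\<sigma>\<close> is summable and its
  arithmetic mean at infinity is in \<open>\<Sigma>(I)\<close> (\<open>positive_F_plus_comm_not_omega\<close>). Both conditions
  define characteristic sets, so Calkin's correspondence (\<open>ideal_of_char_set_eq\<close>) turns them into
  membership of \<open>X\<close> in an ideal. An ideal contains with \<open>X\<close> every \<open>Y\<close> with \<open>0 \<le> Y \<le> X\<close>, because
  the eigenvalues of \<open>Y\<close> are dominated by those of \<open>X\<close> (\<open>singular_values_mono\<close>); this gives the hereditary property.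

  Necessity comes from traces over finite-dimensional subspaces. Let \<open>Z \<in> I\<close>, \<open>Y \<in> B(H)\<close>, and take
  a subspace of dimension \<open>r\<close> that contains the first \<open>n\<close> left and right singular vectors of \<open>Z\<close>.
  In the trace of \<open>ZY - YZ\<close> over it the corresponding rank one parts of \<open>Z\<close> cancel exactly, and
  what remains of \<open>Z\<close> has norm at most the next singular value, so that the trace is
  \<open>O(r s\<^sub>n(Z))\<close> (\<open>commutator_trace\<close>). A finite rank operator has one and the same trace over all
  subspaces containing its range. Hence the traces of \<open>X \<in> F + [I,B(H)]\<close> over suitable subspaces of
  dimension \<open>O(n)\<close> differ from a constant \<open>\<tau>\<close> by at most \<open>n \<eta>\<^sub>n\<close> with \<open>\<eta> \<in> \<Sigma>(I)\<close>. If \<open>X\<close> is positive,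
  these traces lie between the sums of its first \<open>n\<close> and its first \<open>M n\<close> eigenvalues
  (\<open>trace_sandwich\<close>). Division by \<open>n\<close> bounds the arithmetic mean of \<open>\<sigma>\<close> by \<open>\<bar>\<tau>\<bar>\<omega> + \<eta>\<close>. When
  \<open>\<omega> \<notin> \<Sigma>(I)\<close>, the products \<open>n \<eta>\<^sub>n\<close> come arbitrarily close to \<open>0\<close>; this forces the sum of \<open>\<sigma>\<close> to
  be at most \<open>\<tau>\<close>, and then the tail of \<open>\<sigma>\<close> beyond \<open>M n\<close> is at most \<open>n \<eta>\<^sub>n\<close>.

  For sufficiency the eigenvectors are placed on the nodes of the infinite binary tree in which
  node \<open>n\<close> has the children \<open>2n+1\<close> and \<open>2n+2\<close>. The commutator of a weighted shift along the edges to
  the left (or to the right) children with the adjoint of the unweighted shift is diagonal and moves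
  the weight of each edge from one of its ends to the other. Two such commutators therefore produce
  every diagonal operator whose entries are the net outflows of a flow on the edges
  (\<open>tree_commutators\<close>). A flow away from the root, divided equally at each node, produces \<open>\<sigma>\<close> with
  edge weights bounded by a multiple of the arithmetic mean of \<open>\<sigma>\<close>. A flow towards the root
  produces \<open>\<sigma>\<close> with edge weights bounded by a multiple of the arithmetic mean at infinity, except
  that all the mass arrives at the root, which is corrected by an operator of rank one.

  Singular values enter through the inequality \<open>\<parallel>X x\<parallel> \<le> c \<parallel>x\<parallel>\<close> on the orthogonal complement of
  \<open>n\<close> vectors (\<open>gelfand_bound\<close>): it characterises them, it behaves well under sums and products, and
  its validity for arbitrarily small \<open>c\<close> is used as the definition of compactness.
\<close>

section \<open>Inner products and orthogonal families\<close>

lemma cinner_add_right: "cinner x (y + z) = cinner x y + cinner x (z :: 'a::chilbert_space)"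
  by (metis cinner_add_left cinner_commute complex_cnj_add)

lemma cinner_scaleC_right: "cinner x (c *\<^sub>C y) = cnj c * cinner x (y :: 'a::chilbert_space)"
  by (metis cinner_commute cinner_scaleC_left complex_cnj_mult)

lemma cinner_zero_left [simp]: "cinner 0 (y :: 'a::chilbert_space) = 0"
  by (metis add_cancel_right_left add_0 cinner_add_left)

lemma cinner_zero_right [simp]: "cinner (y :: 'a::chilbert_space) 0 = 0"
  by (metis cinner_commute cinner_zero_left complex_cnj_zero)

lemma cinner_minus_left [simp]: "cinner (- x) y = - cinner x (y :: 'a::chilbert_space)"
  by (metis add.right_inverse cinner_add_left cinner_zero_left eq_neg_iff_add_eq_0 add.commute)

lemma cinner_minus_right [simp]: "cinner x (- y) = - cinner x (y :: 'a::chilbert_space)"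
  by (metis cinner_commute cinner_minus_left complex_cnj_minus)

lemma cinner_diff_left: "cinner (x - y) z = cinner x z - cinner y (z :: 'a::chilbert_space)"
  using cinner_add_left[of x "- y" z] by simp

lemma cinner_diff_right: "cinner z (x - y) = cinner z x - cinner z (y :: 'a::chilbert_space)"
  using cinner_add_right[of z x "- y"] by simp

lemma cinner_scaleR_left: "cinner (r *\<^sub>R x) y = of_real r * cinner x (y :: 'a::chilbert_space)"
  by (simp add: cinner_scaleC_left flip: scaleC_of_real)

lemma cinner_scaleR_right: "cinner x (r *\<^sub>R y) = of_real r * cinner x (y :: 'a::chilbert_space)"
  by (simp add: cinner_scaleC_right flip: scaleC_of_real)

lemma cinner_sum_left: "cinner (sum f A) y = (\<Sum>i\<in>A. cinner (f i) (y :: 'a::chilbert_space))"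
  by (induction A rule: infinite_finite_induct) (auto simp: cinner_add_left)

lemma cinner_sum_right: "cinner y (sum f A) = (\<Sum>i\<in>A. cinner (y :: 'a::chilbert_space) (f i))"
  by (induction A rule: infinite_finite_induct) (auto simp: cinner_add_right)

lemmas cinner_lin = cinner_add_left cinner_add_right cinner_diff_left cinner_diff_right
  cinner_scaleC_left cinner_scaleC_right cinner_scaleR_left cinner_scaleR_right

lemma norm_sq_cinner: "(norm x)\<^sup>2 = Re (cinner x (x :: 'a::chilbert_space))"
  by (simp add: cinner_self)

lemma cinner_self_eq_0: "cinner x x = 0 \<longleftrightarrow> x = (0 :: 'a::chilbert_space)"
  by (simp add: cinner_self)

lemma cinner_eq_0_commute: "cinner x y = 0 \<longleftrightarrow> cinner y (x :: 'a::chilbert_space) = 0"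
  by (metis cinner_commute complex_cnj_zero)

lemma norm_add_sq:
  "(norm (x + y))\<^sup>2 = (norm x)\<^sup>2 + 2 * Re (cinner x y) + (norm (y :: 'a::chilbert_space))\<^sup>2"
proof -
  have "Re (cinner y x) = Re (cinner x y)" by (subst cinner_commute) simp
  then show ?thesis by (simp add: norm_sq_cinner cinner_lin)
qed

lemma norm_diff_sq:
  "(norm (x - y))\<^sup>2 = (norm x)\<^sup>2 - 2 * Re (cinner x y) + (norm (y :: 'a::chilbert_space))\<^sup>2"
  using norm_add_sq[of x "- y"] by simp

lemma cauchy_schwarz: "cmod (cinner x y) \<le> norm x * norm (y :: 'a::chilbert_space)"
proof (cases "y = 0")
  case False
  define c where "c = cinner x y / of_real ((norm y)\<^sup>2)"
  have n: "(norm y)\<^sup>2 > 0" using False by simp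
  have "0 \<le> (norm (x - c *\<^sub>C y))\<^sup>2" by simp
  also have "\<dots> = (norm x)\<^sup>2 - 2 * Re (cnj c * cinner x y) + (cmod c * norm y)\<^sup>2"
    by (simp add: norm_diff_sq cinner_scaleC_right norm_scaleC)
  also have "cnj c * cinner x y = of_real ((cmod (cinner x y))\<^sup>2 / (norm y)\<^sup>2)"
    by (simp add: c_def mult.commute flip: complex_norm_square)
  also have "(cmod c * norm y)\<^sup>2 = (cmod (cinner x y))\<^sup>2 / (norm y)\<^sup>2"
    using n unfolding c_def norm_divide norm_of_real power_mult_distrib power_divide
    by (simp add: power2_eq_square)
  finally have "(cmod (cinner x y))\<^sup>2 \<le> (norm x * norm y)\<^sup>2"
    using n by (simp add: power_mult_distrib field_simps)
  then show ?thesis by (meson mult_nonneg_nonneg norm_ge_zero power2_le_imp_le)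
qed simp

lemma bounded_linear_cinner_left: "bounded_linear (\<lambda>x. cinner x (y :: 'a::chilbert_space))"
  by (rule bounded_linear_intro[where K = "norm y"])
    (auto simp: cinner_lin cauchy_schwarz scaleR_conv_of_real)

lemma bounded_linear_cinner_right: "bounded_linear (\<lambda>x. cinner (y :: 'a::chilbert_space) x)"
  by (rule bounded_linear_intro[where K = "norm y"])
    (auto simp: cinner_lin scaleR_conv_of_real cauchy_schwarz mult.commute[of _ "norm y"])

lemma bounded_linear_scaleC_left: "bounded_linear (\<lambda>c. c *\<^sub>C (y :: 'a::chilbert_space))"
  by (rule bounded_linear_intro[where K = "norm y"])
    (auto simp: scaleC_add_left norm_scaleC scaleC_scaleC scaleR_conv_of_real simp flip: scaleC_of_real)

lemma bounded_linear_scaleC_right: "bounded_linear (\<lambda>y :: 'a::chilbert_space. c *\<^sub>C y)"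
  by (rule bounded_linear_intro[where K = "cmod c"])
    (auto simp: scaleC_add_right norm_scaleC scaleC_scaleC mult.commute simp flip: scaleC_of_real)

definition suborthonormal :: "'i set \<Rightarrow> ('i \<Rightarrow> 'a::chilbert_space) \<Rightarrow> bool"
  where "suborthonormal A e \<longleftrightarrow>
    (\<forall>i\<in>A. \<forall>j\<in>A. i \<noteq> j \<longrightarrow> cinner (e i) (e j) = 0) \<and> (\<forall>i\<in>A. norm (e i) \<le> 1)"

definition orthonormal :: "'i set \<Rightarrow> ('i \<Rightarrow> 'a::chilbert_space) \<Rightarrow> bool"
  where "orthonormal A e \<longleftrightarrow> (\<forall>i\<in>A. \<forall>j\<in>A. cinner (e i) (e j) = (if i = j then 1 else 0))"

lemma orthonormal_norm: "orthonormal A e \<Longrightarrow> i \<in> A \<Longrightarrow> norm (e i) = 1"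
  using norm_sq_cinner[of "e i"] norm_ge_zero[of "e i"]
  by (auto simp: orthonormal_def power2_eq_1_iff simp del: norm_ge_zero)

lemma orthonormal_imp_suborthonormal: "orthonormal A e \<Longrightarrow> suborthonormal A e"
  by (auto simp: suborthonormal_def orthonormal_norm) (auto simp: orthonormal_def)

lemma orthonormalD: "orthonormal A e \<Longrightarrow> i \<in> A \<Longrightarrow> j \<in> A \<Longrightarrow> cinner (e i) (e j) = (if i = j then 1 else 0)"
  by (simp add: orthonormal_def)

lemma orthonormalI_less:
  fixes e :: "'i::linorder \<Rightarrow> 'a::chilbert_space"
  assumes "\<And>i. i \<in> A \<Longrightarrow> norm (e i) = 1"
    and "\<And>i j. i \<in> A \<Longrightarrow> j \<in> A \<Longrightarrow> j < i \<Longrightarrow> cinner (e i) (e j) = 0"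
  shows "orthonormal A e"
  unfolding orthonormal_def
proof (intro ballI)
  fix i j assume ij: "i \<in> A" "j \<in> A"
  consider "i = j" | "i < j" | "j < i" by (rule linorder_cases)
  then show "cinner (e i) (e j) = (if i = j then 1 else 0)"
    using assms ij cinner_eq_0_commute[of "e i" "e j"] by cases (auto simp: cinner_self)
qed

lemma suborthonormal_subset: "suborthonormal A e \<Longrightarrow> B \<subseteq> A \<Longrightarrow> suborthonormal B e"
  by (auto simp: suborthonormal_def)

lemma orthonormal_subset: "orthonormal A e \<Longrightarrow> B \<subseteq> A \<Longrightarrow> orthonormal B e"
  unfolding orthonormal_def by (meson subset_iff)

lemma suborthonormal_reindex:
  "suborthonormal A e \<Longrightarrow> inj_on p B \<Longrightarrow> p ` B \<subseteq> A \<Longrightarrow> suborthonormal B (\<lambda>i. e (p i))"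
  unfolding suborthonormal_def inj_on_def image_subset_iff by (metis (full_types))

lemma orthonormal_reindex:
  "orthonormal A e \<Longrightarrow> inj_on p B \<Longrightarrow> p ` B \<subseteq> A \<Longrightarrow> orthonormal B (\<lambda>i. e (p i))"
  unfolding orthonormal_def inj_on_def image_subset_iff by (metis (full_types))

lemma orthonormal_inj: "orthonormal A e \<Longrightarrow> inj_on e A"
  unfolding orthonormal_def inj_on_def by (metis zero_neq_one)

lemma orthogonal_norm_sum:
  assumes "\<And>i j. i \<in> A \<Longrightarrow> j \<in> A \<Longrightarrow> i \<noteq> j \<Longrightarrow> cinner (e i) (e j) = 0" "finite A"
  shows "(norm (\<Sum>i\<in>A. c i *\<^sub>C e i))\<^sup>2 = (\<Sum>i\<in>A. (cmod (c i))\<^sup>2 * (norm (e i))\<^sup>2)"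
  using assms(2,1)
proof (induction A rule: finite_induct)
  case (insert a A)
  have "cinner (c a *\<^sub>C e a) (\<Sum>i\<in>A. c i *\<^sub>C e i) = 0"
    using insert.prems insert.hyps
    by (auto simp: cinner_sum_right cinner_lin intro!: sum.neutral) metis
  then show ?case
    using insert by (simp add: norm_add_sq norm_scaleC power_mult_distrib)
qed simp

lemma suborthonormal_norm_sum_le:
  assumes "suborthonormal A e" "finite A"
  shows "(norm (\<Sum>i\<in>A. c i *\<^sub>C e i))\<^sup>2 \<le> (\<Sum>i\<in>A. (cmod (c i))\<^sup>2)"
  using assms by (subst orthogonal_norm_sum)
    (auto simp: suborthonormal_def power_le_one intro!: sum_mono mult_left_le)

lemma orthonormal_norm_sum:
  assumes "orthonormal A e" "finite A"
  shows "(norm (\<Sum>i\<in>A. c i *\<^sub>C e i))\<^sup>2 = (\<Sum>i\<in>A. (cmod (c i))\<^sup>2)"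
  using assms by (subst orthogonal_norm_sum)
    (auto simp: orthonormal_norm orthonormalD)

lemma bessel:
  assumes "suborthonormal A e" "finite A"
  shows "(\<Sum>i\<in>A. (cmod (cinner x (e i)))\<^sup>2) \<le> (norm x)\<^sup>2"
proof -
  define y where "y = (\<Sum>i\<in>A. cinner x (e i) *\<^sub>C e i)"
  have "Re (cinner x y) = (\<Sum>i\<in>A. (cmod (cinner x (e i)))\<^sup>2)"
    by (simp add: y_def cinner_sum_right cinner_lin mult.commute flip: complex_norm_square)
  moreover have "0 \<le> (norm x)\<^sup>2 - 2 * Re (cinner x y) + (norm y)\<^sup>2"
    by (metis norm_diff_sq zero_le_power2)
  moreover have "(norm y)\<^sup>2 \<le> (\<Sum>i\<in>A. (cmod (cinner x (e i)))\<^sup>2)"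
    unfolding y_def by (rule suborthonormal_norm_sum_le[OF assms])
  ultimately show ?thesis by simp
qed

lemma residual_orthogonal:
  assumes "orthonormal A e" "finite A" "j \<in> A"
  shows "cinner (x - (\<Sum>i\<in>A. cinner x (e i) *\<^sub>C e i)) (e j) = 0"
proof -
  have "(\<Sum>i\<in>A. cinner x (e i) * cinner (e i) (e j)) = (\<Sum>i\<in>A. if i = j then cinner x (e j) else 0)"
    using assms by (intro sum.cong) (auto simp: orthonormal_def)
  then show ?thesis using assms by (simp add: cinner_lin cinner_sum_left)
qed

lemma residual_norm_sq:
  assumes "orthonormal A e" "finite A"
  shows "(norm (x - (\<Sum>i\<in>A. cinner x (e i) *\<^sub>C e i)))\<^sup>2
    = (norm x)\<^sup>2 - (\<Sum>i\<in>A. (cmod (cinner x (e i)))\<^sup>2)"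
proof -
  define y where "y = (\<Sum>i\<in>A. cinner x (e i) *\<^sub>C e i)"
  have "Re (cinner x y) = (\<Sum>i\<in>A. (cmod (cinner x (e i)))\<^sup>2)"
    by (simp add: y_def cinner_sum_right cinner_lin mult.commute flip: complex_norm_square)
  moreover have "(norm y)\<^sup>2 = (\<Sum>i\<in>A. (cmod (cinner x (e i)))\<^sup>2)"
    unfolding y_def by (rule orthonormal_norm_sum[OF assms])
  ultimately show ?thesis by (simp add: norm_diff_sq flip: y_def)
qed

lemma orthonormal_comb_cinner:
  assumes "orthonormal A e" "finite A" "j \<in> A"
  shows "cinner (\<Sum>i\<in>A. c i *\<^sub>C e i) (e j) = c j"
proof -
  have "(\<Sum>i\<in>A. c i * cinner (e i) (e j)) = (\<Sum>i\<in>A. if i = j then c j else 0)"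
    using assms by (intro sum.cong) (auto simp: orthonormal_def)
  then show ?thesis using assms by (simp add: cinner_lin cinner_sum_left)
qed

lemma parseval_finite:
  assumes "orthonormal A e" "finite A" "x = (\<Sum>i\<in>A. cinner x (e i) *\<^sub>C e i)"
  shows "(\<Sum>i\<in>A. (cmod (cinner x (e i)))\<^sup>2) = (norm x)\<^sup>2"
  using residual_norm_sq[OF assms(1,2), of x] assms(3) by simp

lemma orthonormal_insert:
  assumes "orthonormal Q (\<lambda>q. q)" "u \<notin> Q" "norm u = 1" "\<And>q. q \<in> Q \<Longrightarrow> cinner u q = 0"
  shows "orthonormal (insert u Q) (\<lambda>q :: 'a::chilbert_space. q)"
  using assms cinner_eq_0_commute[of u] by (auto simp: orthonormal_def cinner_self)

lemma gram_schmidt: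
  fixes S :: "'a::chilbert_space set"
  assumes "finite S"
  shows "\<exists>Q. finite Q \<and> card Q \<le> card S \<and> orthonormal Q (\<lambda>q. q) \<and> Q \<subseteq> complex_vector.span S \<and>
    (\<forall>s\<in>S. s = (\<Sum>q\<in>Q. cinner s q *\<^sub>C q))"
  using assms
proof (induction S rule: finite_induct)
  case empty
  show ?case by (rule exI[of _ "{}"]) (simp add: orthonormal_def)
next
  case (insert a S)
  then obtain Q where Q: "finite Q" "card Q \<le> card S" "orthonormal Q (\<lambda>q. q)"
    "Q \<subseteq> complex_vector.span S" "\<And>s. s \<in> S \<Longrightarrow> s = (\<Sum>q\<in>Q. cinner s q *\<^sub>C q)" by blast
  have Qspan: "Q \<subseteq> complex_vector.span (insert a S)"
    using Q(4) complex_vector.span_mono[of S "insert a S"] by blast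
  define v where "v = a - (\<Sum>q\<in>Q. cinner a q *\<^sub>C q)"
  have vo: "cinner v q = 0" if "q \<in> Q" for q
    using residual_orthogonal[OF Q(3,1) that, of a] by (simp add: v_def)
  show ?case
  proof (cases "v = 0")
    case True
    then show ?thesis using Q insert Qspan by (intro exI[of _ Q]) (auto simp: v_def)
  next
    case False
    define u where "u = inverse (norm v) *\<^sub>R v"
    have u1: "norm u = 1" using False by (simp add: u_def)
    have uo: "cinner u q = 0" if "q \<in> Q" for q using vo[OF that] by (simp add: u_def cinner_lin)
    have unQ: "u \<notin> Q" using uo[of u] u1 by (auto simp: cinner_self)
    have "cinner a u *\<^sub>C u = v"
    proof -
      have "cinner a u = cinner v u"
        using uo cinner_eq_0_commute[of u]
        by (auto simp: v_def cinner_lin cinner_sum_left intro!: sum.neutral)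
      also have "\<dots> = of_real (norm v)" using False
        by (simp add: u_def cinner_lin cinner_self power2_eq_square)
      finally show ?thesis using False by (simp add: u_def scaleC_of_real)
    qed
    then have a: "a = (\<Sum>q\<in>insert u Q. cinner a q *\<^sub>C q)"
      using unQ Q(1) by (simp add: v_def)
    have s: "s = (\<Sum>q\<in>insert u Q. cinner s q *\<^sub>C q)" if "s \<in> S" for s
    proof -
      have "cinner s u = 0"
      proof -
        have "cinner (\<Sum>q\<in>Q. cinner s q *\<^sub>C q) u = 0"
          using uo cinner_eq_0_commute[of u] by (auto simp: cinner_sum_left cinner_lin intro!: sum.neutral)
        then show ?thesis using Q(5)[OF that] by simp
      qed
      then show ?thesis using unQ Q(1) Q(5)[OF that] by simp
    qed
    have "u \<in> complex_vector.span (insert a S)"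
    proof -
      have "v \<in> complex_vector.span (insert a S)"
        unfolding v_def using Qspan
        by (intro complex_vector.span_diff complex_vector.span_sum complex_vector.span_scale)
          (auto simp: complex_vector.span_base)
      then show ?thesis unfolding u_def scaleC_of_real[symmetric] by (rule complex_vector.span_scale)
    qed
    then show ?thesis
      using a s Q insert.hyps unQ u1 uo Qspan orthonormal_insert[OF Q(3) unQ u1 uo]
      by (intro exI[of _ "insert u Q"]) auto
  qed
qed

text \<open>
  Induction on the equations: an equation with a nonzero coefficient eliminates one unknown.
\<close>

lemma underdetermined_system:
  fixes a :: "'i \<Rightarrow> 's \<Rightarrow> complex"
  assumes "finite S" "finite A" "card S < card A"
  shows "\<exists>c. (\<exists>i\<in>A. c i \<noteq> 0) \<and> (\<forall>s\<in>S. (\<Sum>i\<in>A. c i * a i s) = 0)"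
  using assms
proof (induction S arbitrary: A a rule: finite_induct)
  case empty
  then obtain i where "i \<in> A" by fastforce
  then show ?case by (intro exI[of _ "\<lambda>_. 1"]) auto
next
  case (insert s S)
  show ?case
  proof (cases "\<forall>i\<in>A. a i s = 0")
    case True
    then show ?thesis using insert.IH[of A a] insert.prems insert.hyps by auto
  next
    case False
    then obtain i0 where i0: "i0 \<in> A" "a i0 s \<noteq> 0" by blast
    define B where "B = A - {i0}"
    have B: "finite B" "card S < card B" "A = insert i0 B" "i0 \<notin> B"
      using insert.prems insert.hyps i0 by (auto simp: B_def)
    obtain c where c: "\<exists>i\<in>B. c i \<noteq> 0"
      "\<And>t. t \<in> S \<Longrightarrow> (\<Sum>i\<in>B. c i * (a i t - a i s / a i0 s * a i0 t)) = 0"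
      using insert.IH[OF B(1,2), of "\<lambda>i t. a i t - a i s / a i0 s * a i0 t"] by blast
    define d where "d = (\<lambda>i. if i = i0 then - (\<Sum>i\<in>B. c i * a i s) / a i0 s else c i)"
    have sumd: "(\<Sum>i\<in>A. d i * a i t) = (\<Sum>i\<in>B. c i * (a i t - a i s / a i0 s * a i0 t))" for t
    proof -
      have "(\<Sum>i\<in>B. d i * a i t) = (\<Sum>i\<in>B. c i * a i t)"
        using B(4) by (intro sum.cong) (auto simp: d_def)
      then have "(\<Sum>i\<in>A. d i * a i t) = d i0 * a i0 t + (\<Sum>i\<in>B. c i * a i t)"
        using B by simp
      also have "\<dots> = (\<Sum>i\<in>B. c i * (a i t - a i s / a i0 s * a i0 t))"
        by (simp add: d_def right_diff_distrib sum_subtractf sum_distrib_left sum_divide_distrib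
            mult_ac)
      finally show ?thesis .
    qed
    have "(\<Sum>i\<in>A. d i * a i t) = 0" if "t \<in> insert s S" for t
      using that c(2) i0(2) unfolding sumd by auto
    moreover have "\<exists>i\<in>A. d i \<noteq> 0" using c(1) B by (auto simp: d_def)
    ultimately show ?thesis by blast
  qed
qed

text \<open>
  This replaces dimension counts in the min-max arguments below: among the combinations of more than
  \<open>card S\<close> orthonormal vectors there is a unit vector orthogonal to \<open>S\<close>.
\<close>

lemma orthogonal_combination:
  assumes "orthonormal A e" "finite A" "finite S" "card S < card A"
  obtains c where "(\<Sum>i\<in>A. (cmod (c i))\<^sup>2) = 1"
    "\<And>s. s \<in> S \<Longrightarrow> cinner (\<Sum>i\<in>A. c i *\<^sub>C e i) s = 0"
proof -
  obtain c where c: "\<exists>i\<in>A. c i \<noteq> 0" "\<forall>s\<in>S. (\<Sum>i\<in>A. c i * cinner (e i) s) = 0"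
    using underdetermined_system[OF assms(3,2,4), of "\<lambda>i s. cinner (e i) s"] by blast
  define r where "r = (\<Sum>i\<in>A. (cmod (c i))\<^sup>2)"
  have r: "r > 0" unfolding r_def using c(1) assms(2)
    by (metis (no_types, lifting) less_eq_real_def norm_eq_zero power2_less_eq_zero_iff
        sum_nonneg sum_nonneg_eq_0_iff zero_le_power2)
  define d where "d = (\<lambda>i. c i / of_real (sqrt r))"
  have "(\<Sum>i\<in>A. (cmod (d i))\<^sup>2) = r / r"
    using r unfolding d_def norm_divide power_divide sum_divide_distrib[symmetric] norm_of_real
    by (simp add: r_def)
  moreover have "cinner (\<Sum>i\<in>A. d i *\<^sub>C e i) s = 0" if "s \<in> S" for s
  proof -
    have "cinner (\<Sum>i\<in>A. d i *\<^sub>C e i) s = (\<Sum>i\<in>A. c i * cinner (e i) s) / of_real (sqrt r)"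
      by (simp add: cinner_sum_left cinner_lin d_def sum_divide_distrib)
    then show ?thesis using c(2) that by simp
  qed
  ultimately show ?thesis using that r by simp
qed

section \<open>Orthogonal series, orthonormal bases and adjoints\<close>

lemma orthogonal_series:
  fixes g :: "nat \<Rightarrow> 'a::chilbert_space"
  assumes g: "suborthonormal UNIV g" and c: "summable (\<lambda>k. (cmod (c k))\<^sup>2)"
  shows "summable (\<lambda>k. c k *\<^sub>C g k)"
    and "(norm (\<Sum>k. c k *\<^sub>C g k))\<^sup>2 \<le> (\<Sum>k. (cmod (c k))\<^sup>2)"
proof -
  have part: "(norm (\<Sum>k\<in>A. c k *\<^sub>C g k))\<^sup>2 \<le> (\<Sum>k\<in>A. (cmod (c k))\<^sup>2)" if "finite A" for A
    using suborthonormal_norm_sum_le[OF suborthonormal_subset[OF g] that] by simp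
  show s: "summable (\<lambda>k. c k *\<^sub>C g k)"
    unfolding summable_Cauchy
  proof (intro allI impI)
    fix e :: real assume "0 < e"
    then have "e\<^sup>2 > 0" by simp
    then obtain N where N: "\<And>m n. m \<ge> N \<Longrightarrow> norm (\<Sum>k = m..<n. (cmod (c k))\<^sup>2) < e\<^sup>2"
      using c unfolding summable_Cauchy by blast
    have "norm (\<Sum>k = m..<n. c k *\<^sub>C g k) < e" if "m \<ge> N" for m n
    proof -
      have "(norm (\<Sum>k = m..<n. c k *\<^sub>C g k))\<^sup>2 < e\<^sup>2"
        using N[OF that, of n] part[of "{m..<n}"] by simp
      then show ?thesis using \<open>0 < e\<close> by (simp add: power_less_imp_less_base)
    qed
    then show "\<exists>N. \<forall>m\<ge>N. \<forall>n. norm (\<Sum>k = m..<n. c k *\<^sub>C g k) < e" by blast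
  qed
  have "(\<lambda>n. (norm (\<Sum>k<n. c k *\<^sub>C g k))\<^sup>2) \<longlonglongrightarrow> (norm (\<Sum>k. c k *\<^sub>C g k))\<^sup>2"
    by (intro tendsto_intros summable_LIMSEQ s)
  then show "(norm (\<Sum>k. c k *\<^sub>C g k))\<^sup>2 \<le> (\<Sum>k. (cmod (c k))\<^sup>2)"
    by (rule LIMSEQ_le_const2)
      (use part sum_le_suminf[OF c] in \<open>auto intro!: exI[of _ 0] intro: order.trans\<close>)
qed

lemma bessel_series:
  fixes f :: "nat \<Rightarrow> 'a::chilbert_space"
  assumes "suborthonormal UNIV f"
  shows "summable (\<lambda>k. (cmod (cinner x (f k)))\<^sup>2)"
    and "(\<Sum>k. (cmod (cinner x (f k)))\<^sup>2) \<le> (norm x)\<^sup>2"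
proof -
  have b: "(\<Sum>k<n. (cmod (cinner x (f k)))\<^sup>2) \<le> (norm x)\<^sup>2" for n
    using bessel[OF suborthonormal_subset[OF assms], of "{..<n}"] by simp
  show "summable (\<lambda>k. (cmod (cinner x (f k)))\<^sup>2)"
    by (rule summableI_nonneg_bounded[OF _ b]) simp
  then show "(\<Sum>k. (cmod (cinner x (f k)))\<^sup>2) \<le> (norm x)\<^sup>2"
    using b by (intro suminf_le_const) auto
qed

lemma BH_scaleC: "T \<in> BH \<Longrightarrow> T (c *\<^sub>C x) = c *\<^sub>C T x"
  by (simp add: BH_def)

lemma BH_zero: "0 \<in> BH" by (simp add: BH_def)
lemma BH_id: "id_blinfun \<in> BH" by (simp add: BH_def)
lemma BH_add: "S \<in> BH \<Longrightarrow> T \<in> BH \<Longrightarrow> S + T \<in> BH"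
  by (simp add: BH_def blinfun.add_left scaleC_add_right)
lemma BH_diff: "S \<in> BH \<Longrightarrow> T \<in> BH \<Longrightarrow> S - T \<in> BH"
  by (simp add: BH_def blinfun.diff_left complex_vector.scale_right_diff_distrib)
lemma BH_compose: "S \<in> BH \<Longrightarrow> T \<in> BH \<Longrightarrow> S o\<^sub>L T \<in> BH"
  by (simp add: BH_def)
lemma blinfun_apply_scaleC: "blinfun_apply (c *\<^sub>C T) x = c *\<^sub>C T x"
  by (simp add: scaleC_blinfun.rep_eq)
lemma BH_scaleC_op: "T \<in> BH \<Longrightarrow> c *\<^sub>C T \<in> BH"
  by (simp add: BH_def blinfun_apply_scaleC scaleC_scaleC mult.commute)

lemma expansion:
  fixes e :: "nat \<Rightarrow> 'a::chilbert_space"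
  assumes e: "orthonormal UNIV e"
  shows "summable (\<lambda>k. cinner x (e k) *\<^sub>C e k)"
    and "cinner (x - (\<Sum>k. cinner x (e k) *\<^sub>C e k)) (e j) = 0"
proof -
  note se = orthonormal_imp_suborthonormal[OF e]
  show s: "summable (\<lambda>k. cinner x (e k) *\<^sub>C e k)"
    by (rule orthogonal_series(1)[OF se bessel_series(1)[OF se]])
  have "cinner (\<Sum>k. cinner x (e k) *\<^sub>C e k) (e j) = (\<Sum>k. cinner (cinner x (e k) *\<^sub>C e k) (e j))"
    by (rule bounded_linear.suminf[OF bounded_linear_cinner_left s])
  also have "\<dots> = (\<Sum>k\<in>{j}. cinner (cinner x (e k) *\<^sub>C e k) (e j))"
    by (rule suminf_finite) (use e in \<open>auto simp: cinner_lin orthonormal_def\<close>)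
  also have "\<dots> = cinner x (e j)"
    using e by (simp add: cinner_lin orthonormal_def)
  finally show "cinner (x - (\<Sum>k. cinner x (e k) *\<^sub>C e k)) (e j) = 0"
    by (simp add: cinner_lin)
qed

text \<open>
  The orthonormal systems below need not be complete, so two operators are compared on the system and
  on its orthogonal complement separately.
\<close>

lemma op_eqI:
  fixes e :: "nat \<Rightarrow> 'a::chilbert_space"
  assumes e: "orthonormal UNIV e" and S: "S \<in> BH" and T: "T \<in> BH"
    and eq: "\<And>n. blinfun_apply S (e n) = blinfun_apply T (e n)"
    and perp: "\<And>x. (\<And>n. cinner x (e n) = 0) \<Longrightarrow> blinfun_apply S x = blinfun_apply T x"
  shows "S = T"
proof (rule blinfun_eqI)
  fix x
  define p where "p = (\<Sum>k. cinner x (e k) *\<^sub>C e k)"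
  have "R p = (\<Sum>k. cinner x (e k) *\<^sub>C R (e k))" if "R \<in> BH" for R :: "'a \<Rightarrow>\<^sub>L 'a"
    using bounded_linear.suminf[OF blinfun.bounded_linear_right expansion(1)[OF e], of R x] that
    by (simp add: p_def BH_scaleC)
  then have "S p = T p" using eq S T by simp
  moreover have "S (x - p) = T (x - p)"
    unfolding p_def by (rule perp) (rule expansion(2)[OF e])
  ultimately show "S x = T x" by (simp add: blinfun.diff_right)
qed

text \<open>
  Diagonal operators, partial isometries and weighted shifts are all of this form. The systems \<open>f\<close> and
  \<open>g\<close> will be suborthonormal: singular vectors belonging to the singular value \<open>0\<close> are replaced by \<open>0\<close>.
\<close>

definition series_op :: "(nat \<Rightarrow> real) \<Rightarrow> (nat \<Rightarrow> 'a) \<Rightarrow> (nat \<Rightarrow> 'a) \<Rightarrow> 'a::chilbert_space \<Rightarrow>\<^sub>L 'a"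
  where "series_op a g f = Blinfun (\<lambda>x. \<Sum>k. (of_real (a k) * cinner x (f k)) *\<^sub>C g k)"

context
  fixes a :: "nat \<Rightarrow> real" and f g :: "nat \<Rightarrow> 'a::chilbert_space"
  assumes f: "suborthonormal UNIV f" and g: "suborthonormal UNIV g" and a: "Bseq a"
begin

lemma series_op_summable: "summable (\<lambda>k. (of_real (a k) * cinner x (f k)) *\<^sub>C g k)"
  and series_op_bounded: "\<exists>K. \<forall>x. norm (\<Sum>k. (of_real (a k) * cinner x (f k)) *\<^sub>C g k) \<le> norm x * K"
proof -
  obtain K where K: "K > 0" "\<And>k. \<bar>a k\<bar> \<le> K" using a unfolding Bseq_def by auto
  have le: "(cmod (of_real (a k) * cinner x (f k)))\<^sup>2 \<le> K\<^sup>2 * (cmod (cinner x (f k)))\<^sup>2" for k x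
    using K by (simp add: norm_mult power_mult_distrib mult_right_mono abs_le_square_iff[symmetric])
  have s: "summable (\<lambda>k. (cmod (of_real (a k) * cinner x (f k)))\<^sup>2)" for x
    by (rule summable_comparison_test'[where N = 0,
          OF summable_mult[where c = "K\<^sup>2", OF bessel_series(1)[OF f, of x]]])
      (use le in auto)
  show "summable (\<lambda>k. (of_real (a k) * cinner x (f k)) *\<^sub>C g k)" for x
    by (rule orthogonal_series(1)[OF g s])
  have "norm (\<Sum>k. (of_real (a k) * cinner x (f k)) *\<^sub>C g k) \<le> norm x * K" for x
  proof -
    have "(norm (\<Sum>k. (of_real (a k) * cinner x (f k)) *\<^sub>C g k))\<^sup>2
        \<le> (\<Sum>k. (cmod (of_real (a k) * cinner x (f k)))\<^sup>2)"
      by (rule orthogonal_series(2)[OF g s])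
    also have "\<dots> \<le> (\<Sum>k. K\<^sup>2 * (cmod (cinner x (f k)))\<^sup>2)"
      by (rule suminf_le[OF le s summable_mult[OF bessel_series(1)[OF f]]])
    also have "\<dots> = K\<^sup>2 * (\<Sum>k. (cmod (cinner x (f k)))\<^sup>2)"
      by (rule suminf_mult[OF bessel_series(1)[OF f]])
    also have "\<dots> \<le> K\<^sup>2 * (norm x)\<^sup>2"
      by (rule mult_left_mono[OF bessel_series(2)[OF f]]) simp
    finally show ?thesis
      using K(1) by (metis mult.commute mult_nonneg_nonneg norm_ge_zero order_less_imp_le
          power2_le_imp_le power_mult_distrib)
  qed
  then show "\<exists>K. \<forall>x. norm (\<Sum>k. (of_real (a k) * cinner x (f k)) *\<^sub>C g k) \<le> norm x * K" by blast
qed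

lemma series_op_apply: "blinfun_apply (series_op a g f) x = (\<Sum>k. (of_real (a k) * cinner x (f k)) *\<^sub>C g k)"
proof -
  obtain K where K: "\<And>x. norm (\<Sum>k. (of_real (a k) * cinner x (f k)) *\<^sub>C g k) \<le> norm x * K"
    using series_op_bounded by blast
  have "bounded_linear (\<lambda>x. \<Sum>k. (of_real (a k) * cinner x (f k)) *\<^sub>C g k)"
  proof (rule bounded_linear_intro[OF _ _ K])
    show "(\<Sum>k. (of_real (a k) * cinner (x + y) (f k)) *\<^sub>C g k)
      = (\<Sum>k. (of_real (a k) * cinner x (f k)) *\<^sub>C g k) + (\<Sum>k. (of_real (a k) * cinner y (f k)) *\<^sub>C g k)" for x y
      by (simp add: suminf_add[OF series_op_summable series_op_summable] cinner_lin distrib_left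
          scaleC_add_left)
    show "(\<Sum>k. (of_real (a k) * cinner (r *\<^sub>R x) (f k)) *\<^sub>C g k)
      = r *\<^sub>R (\<Sum>k. (of_real (a k) * cinner x (f k)) *\<^sub>C g k)" for r x
      using bounded_linear.suminf[OF bounded_linear_scaleR_right series_op_summable, of r x]
      by (simp add: cinner_lin scaleC_scaleC mult_ac flip: scaleC_of_real)
  qed
  then show ?thesis unfolding series_op_def by (simp add: bounded_linear_Blinfun_apply)
qed

lemma series_op_BH: "series_op a g f \<in> BH"
  unfolding BH_def
proof safe
  fix c x
  have "(\<Sum>k. c *\<^sub>C ((of_real (a k) * cinner x (f k)) *\<^sub>C g k))
      = c *\<^sub>C (\<Sum>k. (of_real (a k) * cinner x (f k)) *\<^sub>C g k)"
    by (rule bounded_linear.suminf[OF bounded_linear_scaleC_right series_op_summable, symmetric])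
  then show "series_op a g f (c *\<^sub>C x) = c *\<^sub>C series_op a g f x"
    by (simp add: series_op_apply cinner_lin scaleC_scaleC mult_ac)
qed

lemma series_op_single:
  assumes "\<And>k. k \<noteq> j \<Longrightarrow> cinner x (f k) = 0"
  shows "blinfun_apply (series_op a g f) x = (of_real (a j) * cinner x (f j)) *\<^sub>C g j"
proof -
  have "(\<Sum>k. (of_real (a k) * cinner x (f k)) *\<^sub>C g k)
      = (\<Sum>k\<in>{j}. (of_real (a k) * cinner x (f k)) *\<^sub>C g k)"
    by (rule suminf_finite) (use assms in auto)
  then show ?thesis by (simp add: series_op_apply)
qed

lemma series_op_perp:
  assumes "\<And>k. cinner x (f k) = 0"
  shows "blinfun_apply (series_op a g f) x = 0"
  using series_op_single[of 0 x] assms by simp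

end

lemma series_op_orthonormal:
  assumes "orthonormal UNIV f" "suborthonormal UNIV g" "Bseq a"
  shows "blinfun_apply (series_op a g f) (f j) = of_real (a j) *\<^sub>C g j"
  using assms series_op_single[OF orthonormal_imp_suborthonormal[OF assms(1)] assms(2,3), of j "f j"]
  by (simp add: orthonormal_def)

subsection \<open>Existence of an orthonormal basis\<close>

locale hilbert_basis =
  fixes h :: "nat \<Rightarrow> 'a::chilbert_space"
  assumes orthonormal_basis: "orthonormal UNIV h"
    and complete_basis: "(\<And>n. cinner x (h n) = 0) \<Longrightarrow> x = 0"

lemma orthogonal_residual:
  fixes x :: "'a::chilbert_space"
  assumes "finite A"
  obtains v where "\<And>a. a \<in> A \<Longrightarrow> cinner v a = 0" "x - v \<in> complex_vector.span A"
proof -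
  obtain Q where Q: "finite Q" "orthonormal Q (\<lambda>q. q)" "Q \<subseteq> complex_vector.span A"
    "\<And>a. a \<in> A \<Longrightarrow> a = (\<Sum>q\<in>Q. cinner a q *\<^sub>C q)"
    using gram_schmidt[OF assms] by blast
  define v where "v = x - (\<Sum>q\<in>Q. cinner x q *\<^sub>C q)"
  have vq: "cinner v q = 0" if "q \<in> Q" for q
    using residual_orthogonal[OF Q(2,1) that, of x] by (simp add: v_def)
  show ?thesis
  proof (rule that)
    show "cinner v a = 0" if "a \<in> A" for a
      by (subst Q(4)[OF that]) (simp add: cinner_sum_right cinner_lin vq)
    have "(\<Sum>q\<in>Q. cinner x q *\<^sub>C q) \<in> complex_vector.span A"
      using Q(3) by (intro complex_vector.span_sum complex_vector.span_scale) blast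
    then show "x - v \<in> complex_vector.span A" by (simp add: v_def)
  qed
qed

lemma orthogonal_span:
  assumes "\<And>a. a \<in> A \<Longrightarrow> cinner x a = 0" "y \<in> complex_vector.span A"
  shows "cinner x (y :: 'a::chilbert_space) = 0"
proof -
  have "complex_vector.subspace {y. cinner x y = 0}"
    by (auto simp: complex_vector.subspace_def cinner_lin)
  then have "complex_vector.span A \<subseteq> {y. cinner x y = 0}"
    using assms(1) by (intro complex_vector.span_minimal) auto
  then show ?thesis using assms(2) by blast
qed

text \<open>
  If no such vector existed, the finite set would span the whole space.
\<close>

lemma unit_orthogonal_exists:
  fixes A :: "'a::chilbert_space set"
  assumes inf: "\<nexists>k. has_cdim (UNIV :: 'a set) k" and A: "finite A"
  shows "\<exists>u. norm u = 1 \<and> (\<forall>a\<in>A. cinner u a = 0)"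
proof -
  have "complex_vector.span A \<noteq> UNIV"
  proof
    assume sA: "complex_vector.span A = UNIV"
    obtain B where B: "B \<subseteq> A" "complex_vector.independent B" "A \<subseteq> complex_vector.span B"
      using complex_vector.maximal_independent_subset[of A] by metis
    have "complex_vector.span B = UNIV"
      using complex_vector.span_minimal[OF B(3) complex_vector.subspace_span] sA by blast
    then have "has_cdim (UNIV :: 'a set) (card B)"
      unfolding has_cdim_def using B finite_subset[OF B(1) A] by blast
    then show False using inf by blast
  qed
  then obtain x where x: "x \<notin> complex_vector.span A" by blast
  obtain v where v: "\<And>a. a \<in> A \<Longrightarrow> cinner v a = 0" "x - v \<in> complex_vector.span A"
    using orthogonal_residual[OF A] by metis
  then have "v \<noteq> 0" using x by auto
  then show ?thesis
    using v(1) by (intro exI[of _ "inverse (norm v) *\<^sub>R v"]) (auto simp: cinner_lin)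
qed

lemma greedy_sequence:
  assumes "\<And>f n. (\<And>m. m < n \<Longrightarrow> P (f ` {..<m}) m (f m)) \<Longrightarrow> \<exists>u. P (f ` {..<n}) n u"
  shows "\<exists>f :: nat \<Rightarrow> 'a. \<forall>n. P (f ` {..<n}) n (f n)"
proof (rule dependent_wf_choice[of "{(m, n). m < n}"])
  show "wf {(m :: nat, n). m < n}" by (rule wf)
  show "P (f ` {..<n}) n r = P (g ` {..<n}) n r"
    if "\<And>m. (m, n) \<in> {(m, n). m < n} \<Longrightarrow> f m = g m" for f g n r
  proof -
    have "f ` {..<n} = g ` {..<n}" using that by (intro image_cong) auto
    then show ?thesis by simp
  qed
qed (use assms in auto)

text \<open>
  Along a dense sequence \<open>d\<close>, a unit vector \<open>h n\<close> orthogonal to its predecessors is chosen so that \<open>d n\<close>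
  lies in the span of \<open>h 0, \<dots>, h n\<close>. What is orthogonal to every \<open>h n\<close> is then orthogonal to a dense set.
\<close>

lemma hilbert_basis_exists:
  assumes sep: "separable_space (euclidean :: 'a::chilbert_space topology)"
    and inf: "\<nexists>k. has_cdim (UNIV :: 'a set) k"
  shows "\<exists>h :: nat \<Rightarrow> 'a. hilbert_basis h"
proof -
  obtain C :: "'a set" where C: "countable C" "closure C = UNIV"
    using sep unfolding separable_space_def by auto
  have Cne: "C \<noteq> {}" using C(2) by auto
  define d where "d = from_nat_into C"
  have rd: "range d = C" unfolding d_def by (rule range_from_nat_into[OF Cne C(1)])
  define P where "P = (\<lambda>A n u. norm u = 1 \<and> (\<forall>a\<in>A. cinner u a = 0) \<and>
    d n \<in> complex_vector.span (insert u A))"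
  have "\<exists>h. \<forall>n. P (h ` {..<n}) n (h n)"
  proof (rule greedy_sequence)
    fix f :: "nat \<Rightarrow> 'a" and n
    define A where "A = f ` {..<n}"
    have A: "finite A" by (simp add: A_def)
    obtain v where v: "\<And>a. a \<in> A \<Longrightarrow> cinner v a = 0" "d n - v \<in> complex_vector.span A"
      using orthogonal_residual[OF A] by metis
    have "\<exists>u. P A n u"
    proof (cases "v = 0")
      case True
      obtain u where "norm u = 1" "\<forall>a\<in>A. cinner u a = 0"
        using unit_orthogonal_exists[OF inf A] by blast
      moreover have "d n \<in> complex_vector.span (insert u A)"
        using v(2) True complex_vector.span_mono[of A "insert u A"] by auto
      ultimately show ?thesis unfolding P_def by blast
    next
      case False
      define u where "u = inverse (norm v) *\<^sub>R v"
      have "v = of_real (norm v) *\<^sub>C u" using False by (simp add: u_def scaleC_of_real)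
      then have "v \<in> complex_vector.span (insert u A)"
        by (metis complex_vector.span_base complex_vector.span_scale insertI1)
      moreover have "d n - v \<in> complex_vector.span (insert u A)"
        using v(2) complex_vector.span_mono[of A "insert u A"] by auto
      ultimately have "d n \<in> complex_vector.span (insert u A)"
        using complex_vector.span_add by fastforce
      then have "P A n u" using v(1) False by (simp add: P_def u_def cinner_lin)
      then show ?thesis by blast
    qed
    then show "\<exists>u. P (f ` {..<n}) n u" by (simp add: A_def)
  qed
  then obtain h where h: "\<And>n. P (h ` {..<n}) n (h n)" by blast
  have "hilbert_basis h"
  proof
    show "orthonormal UNIV h"
      using h by (intro orthonormalI_less) (auto simp: P_def)
    fix x assume x: "\<And>n. cinner x (h n) = 0"
    have "cinner x (d n) = 0" for n
      by (rule orthogonal_span[of "insert (h n) (h ` {..<n})"]) (use x h[of n] in \<open>auto simp: P_def\<close>)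
    then have "C \<subseteq> {y. cinner x y = 0}" using rd by blast
    moreover have "closed {y. cinner x y = 0}"
      by (intro closed_Collect_eq continuous_intros linear_continuous_on bounded_linear_cinner_right)
    ultimately have "closure C \<subseteq> {y. cinner x y = 0}" by (rule closure_minimal)
    then show "x = 0" using C(2) cinner_self_eq_0[of x] by blast
  qed
  then show ?thesis by blast
qed

subsection \<open>Adjoints\<close>

context hilbert_basis
begin

lemma unit_orthogonal: "finite S \<Longrightarrow> \<exists>u :: 'a. norm u = 1 \<and> (\<forall>s\<in>S. cinner u s = 0)"
proof -
  assume S: "finite S"
  have o: "orthonormal {..card S} h" using orthonormal_subset[OF orthonormal_basis] by blast
  obtain c where c: "(\<Sum>i\<in>{..card S}. (cmod (c i))\<^sup>2) = 1"
    "\<And>s. s \<in> S \<Longrightarrow> cinner (\<Sum>i\<in>{..card S}. c i *\<^sub>C h i) s = 0"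
    using orthogonal_combination[OF o _ S] by auto
  have "norm (\<Sum>i\<in>{..card S}. c i *\<^sub>C h i) = 1"
    using orthonormal_norm_sum[OF o, of c] c(1) norm_ge_zero[of "\<Sum>i\<in>{..card S}. c i *\<^sub>C h i"]
    by (simp add: power2_eq_1_iff)
  then show ?thesis using c(2) by blast
qed

lemma basis_expansion: "x = (\<Sum>k. cinner x (h k) *\<^sub>C h k)"
  using complete_basis expansion(2)[OF orthonormal_basis, of x] by fastforce

text \<open>
  The coordinates of \<open>S y\<close> in the basis must be \<open>\<langle>y, T (h n)\<rangle>\<close>. They are square summable: pairing \<open>y\<close>
  with \<open>T z\<close>, where \<open>z\<close> has finitely many of them as coordinates, yields the sum of their squares.
\<close>

lemma adjoint_exists:
  assumes T: "T \<in> BH"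
  shows "\<exists>S\<in>BH. \<forall>x y. cinner (blinfun_apply T x) y = cinner x (blinfun_apply S (y :: 'a))"
proof -
  note sh = orthonormal_imp_suborthonormal[OF orthonormal_basis]
  have fin: "(\<Sum>n<N. (cmod (cinner y (T (h n))))\<^sup>2) \<le> (norm y * norm T)\<^sup>2" for N y
  proof -
    define z where "z = (\<Sum>n<N. cinner y (T (h n)) *\<^sub>C h n)"
    define s where "s = (\<Sum>n<N. (cmod (cinner y (T (h n))))\<^sup>2)"
    have s0: "s \<ge> 0" unfolding s_def by (intro sum_nonneg) auto
    have nz: "(norm z)\<^sup>2 = s" unfolding z_def s_def
      by (rule orthonormal_norm_sum[OF orthonormal_subset[OF orthonormal_basis]]) auto
    have "cinner y (T z) = of_real s"
      by (simp add: z_def s_def blinfun.sum_right BH_scaleC[OF T] cinner_sum_right cinner_lin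
          mult.commute flip: complex_norm_square)
    then have "s \<le> norm y * norm (T z)" using cauchy_schwarz[of y "T z"] s0 by simp
    also have "\<dots> \<le> norm y * (norm T * norm z)" by (intro mult_left_mono norm_blinfun) auto
    finally have "norm z * norm z \<le> (norm y * norm T) * norm z"
      by (simp add: nz[symmetric] power2_eq_square mult.assoc)
    then have "norm z \<le> norm y * norm T"
      by (cases "z = 0") auto
    then show ?thesis unfolding nz[symmetric] s_def[symmetric] by (intro power_mono) auto
  qed
  define c where "c = (\<lambda>y n. cinner y (T (h n)))"
  have sc: "summable (\<lambda>n. (cmod (c y n))\<^sup>2)" for y
    using fin[of y] unfolding c_def by (intro summableI_nonneg_bounded) auto
  note s = orthogonal_series(1)[OF sh sc]
  define S where "S = (\<lambda>y. \<Sum>n. c y n *\<^sub>C h n)"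
  have bl: "bounded_linear S"
  proof (rule bounded_linear_intro[where K = "norm T"])
    show "S (x + y) = S x + S y" for x y
      using suminf_add[OF s[of x] s[of y]]
      by (simp add: S_def c_def cinner_lin scaleC_add_left)
    show "S (r *\<^sub>R x) = r *\<^sub>R S x" for r x
      using bounded_linear.suminf[OF bounded_linear_scaleR_right s, of r x]
      by (simp add: S_def c_def cinner_lin scaleC_scaleC flip: scaleC_of_real)
    show "norm (S y) \<le> norm y * norm T" for y
    proof -
      have "(norm (S y))\<^sup>2 \<le> (\<Sum>n. (cmod (c y n))\<^sup>2)"
        unfolding S_def by (rule orthogonal_series(2)[OF sh sc])
      also have "\<dots> \<le> (norm y * norm T)\<^sup>2"
        using fin[of y] by (intro suminf_le_const sc) (auto simp: c_def)
      finally show ?thesis by (meson mult_nonneg_nonneg norm_ge_zero power2_le_imp_le)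
    qed
  qed
  have eq: "cinner (T x) y = cinner x (S y)" for x y
  proof -
    have "cinner x (S y) = (\<Sum>n. cinner x (c y n *\<^sub>C h n))"
      unfolding S_def by (rule bounded_linear.suminf[OF bounded_linear_cinner_right s])
    also have "\<dots> = (\<Sum>n. cinner x (h n) * cinner (T (h n)) y)"
      by (subst (2) cinner_commute) (simp add: c_def cinner_lin mult.commute)
    also have "\<dots> = (\<Sum>n. cinner (T (cinner x (h n) *\<^sub>C h n)) y)"
      by (simp add: BH_scaleC[OF T] cinner_lin)
    also have "\<dots> = cinner (T (\<Sum>n. cinner x (h n) *\<^sub>C h n)) y"
      by (rule bounded_linear.suminf[symmetric, OF _ expansion(1)[OF orthonormal_basis]])
        (rule bounded_linear_compose[OF bounded_linear_cinner_left blinfun.bounded_linear_right])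
    finally show ?thesis using basis_expansion[of x] by simp
  qed
  have "S (k *\<^sub>C y) = k *\<^sub>C S y" for k y
    using bounded_linear.suminf[OF bounded_linear_scaleC_right s, of k y]
    by (simp add: S_def c_def cinner_lin scaleC_scaleC)
  then have "Blinfun S \<in> BH" by (simp add: BH_def bounded_linear_Blinfun_apply[OF bl])
  moreover have "\<forall>x y. cinner (T x) y = cinner x (Blinfun S y)"
    by (simp add: bounded_linear_Blinfun_apply[OF bl] eq)
  ultimately show ?thesis by blast
qed

end

lemma adj_eqI:
  assumes "\<And>x y. cinner (blinfun_apply T x) y = cinner x (blinfun_apply S (y :: 'a::chilbert_space))"
  shows "adj T = S"
  unfolding adj_def
proof (rule the_equality)
  show "\<forall>x y. cinner (T x) y = cinner x (S y)" using assms by simp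
  fix R assume R: "\<forall>x y. cinner (T x) y = cinner x (blinfun_apply R y)"
  show "R = S"
  proof (rule blinfun_eqI)
    fix y
    have "cinner x (R y - S y) = 0" for x using R assms[of x y] by (simp add: cinner_lin)
    from this[of "R y - S y"] show "R y = S y" by (simp add: cinner_self)
  qed
qed

context hilbert_basis
begin

lemma
  assumes T: "T \<in> BH"
  shows adj_BH: "adj T \<in> BH"
    and cinner_adj_right: "cinner x (blinfun_apply (adj T) y) = cinner (T x) (y :: 'a)"
    and cinner_adj_left: "cinner (blinfun_apply (adj T) x) y = cinner x (T (y :: 'a))"
proof -
  obtain S where S: "S \<in> BH" "\<And>x y. cinner (T x) y = cinner x (blinfun_apply S y)"
    using adjoint_exists[OF T] by blast
  have [simp]: "adj T = S" by (rule adj_eqI[OF S(2)])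
  show "adj T \<in> BH" "cinner x (blinfun_apply (adj T) y) = cinner (T x) y"
    using S by simp_all
  have "cinner (adj T x) y = cnj (cinner y (S x))" by (simp add: cinner_commute[of "S x"])
  also have "\<dots> = cnj (cinner (T y) x)" by (simp only: S(2))
  also have "\<dots> = cinner x (T y)" by (rule cinner_commute[symmetric])
  finally show "cinner (adj T x) y = cinner x (T y)" .
qed

end

section \<open>Compact operators and singular values\<close>

text \<open>
  The least \<open>c\<close> with this property is the \<open>n\<close>th Gelfand number of \<open>T\<close>; for compact \<open>T\<close> it is the
  singular value with index \<open>n\<close>, counted from \<open>0\<close>.
\<close>

definition gelfand_bound :: "('a::chilbert_space \<Rightarrow>\<^sub>L 'a) \<Rightarrow> nat \<Rightarrow> real \<Rightarrow> bool"
  where "gelfand_bound T n c \<longleftrightarrow> (\<exists>S. finite S \<and> card S \<le> n \<and>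
    (\<forall>x. (\<forall>s\<in>S. cinner x s = 0) \<longrightarrow> norm (blinfun_apply T x) \<le> c * norm x))"

text \<open>
  On a Hilbert space this is equivalent to relative compactness of the image of the unit ball.
\<close>

definition compact_op :: "('a::chilbert_space \<Rightarrow>\<^sub>L 'a) \<Rightarrow> bool"
  where "compact_op T \<longleftrightarrow> T \<in> BH \<and> (\<forall>\<epsilon>>0. \<exists>n. gelfand_bound T n \<epsilon>)"

lemma gelfand_bound_mono:
  assumes "gelfand_bound T n c" "c \<le> d"
  shows "gelfand_bound T n d"
proof -
  obtain S where S: "finite S" "card S \<le> n"
    "\<And>x. (\<forall>s\<in>S. cinner x s = 0) \<Longrightarrow> norm (T x) \<le> c * norm x"
    using assms(1) unfolding gelfand_bound_def by blast
  have "norm (T x) \<le> d * norm x" if "\<forall>s\<in>S. cinner x s = 0" for x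
    by (rule order.trans[OF S(3)[OF that] mult_right_mono[OF assms(2) norm_ge_zero]])
  then show ?thesis unfolding gelfand_bound_def using S(1,2) by blast
qed

text \<open>
  Polarization: the quadratic form is real at \<open>x + y\<close> and at \<open>x + \<i> y\<close>.
\<close>

lemma positive_selfadjoint:
  assumes "positive_op T"
  shows "cinner (blinfun_apply T x) y = cinner x (blinfun_apply T y)"
proof -
  have T: "T \<in> BH" using assms by (simp add: positive_op_def)
  have im: "Im (cinner (T z) z) = 0" for z
    using assms unfolding positive_op_def by (metis complex_nonneg_Reals_iff)
  have "Im (cinner (T x) y) + Im (cinner (T y) x) = 0"
    using im[of "x + y"] im[of x] im[of y] by (simp add: blinfun.add_right cinner_lin)
  moreover have "Re (cinner (T y) x) = Re (cinner (T x) y)"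
    using im[of "x + \<i> *\<^sub>C y"] im[of x] im[of y]
    by (simp add: blinfun.add_right cinner_lin BH_scaleC[OF T])
  ultimately have "cinner (T x) y = cnj (cinner (T y) x)"
    by (simp add: complex_eq_iff)
  then show ?thesis by (simp add: cinner_commute[of x])
qed

lemma positive_opD:
  assumes "positive_op T"
  shows "T \<in> BH" "0 \<le> Re (cinner (blinfun_apply T x) x)"
    "cinner (blinfun_apply T x) x = of_real (Re (cinner (blinfun_apply T x) x))"
  using assms unfolding positive_op_def by (auto simp: complex_nonneg_Reals_iff complex_eq_iff)

text \<open>
  A substitute for the Cauchy--Schwarz inequality of the form \<open>\<langle>T x, y\<rangle>\<close>: it is evaluated at
  \<open>x - t T x\<close> with the optimal value \<open>t = 1 / m\<close>.
\<close>

lemma positive_form_bound: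
  assumes T: "positive_op T" and m: "m > 0"
    and le: "Re (cinner (blinfun_apply T (T x)) (T x)) \<le> m * (norm (T x))\<^sup>2"
  shows "(norm (blinfun_apply T x))\<^sup>2 \<le> m * Re (cinner (T x) x)"
proof -
  define t where "t = 1 / m"
  have "0 \<le> Re (cinner (T (x - t *\<^sub>R T x)) (x - t *\<^sub>R T x))"
    by (rule positive_opD(2)[OF T])
  also have "\<dots> = Re (cinner (T x) x) - 2 * t * (norm (T x))\<^sup>2 + t\<^sup>2 * Re (cinner (T (T x)) (T x))"
    using norm_sq_cinner[of "T x"]
    by (simp add: blinfun.diff_right blinfun.scaleR_right cinner_lin positive_selfadjoint[OF T, of "T x" x]
        power2_eq_square algebra_simps)
  also have "\<dots> \<le> Re (cinner (T x) x) - 2 * t * (norm (T x))\<^sup>2 + t\<^sup>2 * (m * (norm (T x))\<^sup>2)"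
    using mult_left_mono[OF le, of "t\<^sup>2"] by simp
  also have "\<dots> = Re (cinner (T x) x) - (norm (T x))\<^sup>2 / m"
    using m by (simp add: t_def power2_eq_square field_simps)
  finally show ?thesis using m by (simp add: field_simps)
qed

subsection \<open>Compactness of the image of the unit ball\<close>

lemma compact_combinations:
  fixes v :: "'i \<Rightarrow> 'a::chilbert_space"
  assumes "finite A"
  shows "compact {(\<Sum>i\<in>A. c i *\<^sub>C v i) | c. \<forall>i\<in>A. cmod (c i) \<le> 1}"
  using assms
proof (induction A rule: finite_induct)
  case (insert a A)
  let ?K = "\<lambda>A. {(\<Sum>i\<in>A. c i *\<^sub>C v i) | c. \<forall>i\<in>A. cmod (c i) \<le> 1}"
  have "?K (insert a A) = {x + y | x y. x \<in> (\<lambda>z. z *\<^sub>C v a) ` cball 0 1 \<and> y \<in> ?K A}"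
  proof (intro equalityI subsetI)
    fix w assume "w \<in> ?K (insert a A)"
    then show "w \<in> {x + y | x y. x \<in> (\<lambda>z. z *\<^sub>C v a) ` cball 0 1 \<and> y \<in> ?K A}"
      using insert.hyps by (fastforce simp: image_iff)
  next
    fix w assume "w \<in> {x + y | x y. x \<in> (\<lambda>z. z *\<^sub>C v a) ` cball 0 1 \<and> y \<in> ?K A}"
    then obtain z c where zc: "cmod z \<le> 1" "\<forall>i\<in>A. cmod (c i) \<le> 1" "w = z *\<^sub>C v a + (\<Sum>i\<in>A. c i *\<^sub>C v i)"
      by auto
    have "(\<Sum>i\<in>A. (c(a := z)) i *\<^sub>C v i) = (\<Sum>i\<in>A. c i *\<^sub>C v i)"
      using insert.hyps by (intro sum.cong) auto
    then have "w = (\<Sum>i\<in>insert a A. (c(a := z)) i *\<^sub>C v i)"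
      using insert.hyps zc by simp
    moreover have "\<forall>i\<in>insert a A. cmod ((c(a := z)) i) \<le> 1" using zc by auto
    ultimately show "w \<in> ?K (insert a A)" by blast
  qed
  moreover have "compact ((\<lambda>z. z *\<^sub>C v a) ` cball 0 1)"
    by (intro compact_continuous_image linear_continuous_on bounded_linear_scaleC_left compact_cball)
  ultimately show ?case using compact_sums[OF _ insert.IH] by auto
qed simp

text \<open>
  Total boundedness: up to a small error only the projection of the unit ball to a finite-dimensional
  subspace matters, and its image lies in a compact set of linear combinations.
\<close>

lemma compact_op_closure_image:
  assumes "compact_op T"
  shows "compact (closure (blinfun_apply T ` cball 0 1))"
  unfolding compact_eq_totally_bounded
proof (intro conjI allI impI)
  show "complete (closure (T ` cball 0 1))" by (simp add: complete_eq_closed)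
  fix e :: real assume e: "e > 0"
  have T: "T \<in> BH" using assms by (simp add: compact_op_def)
  obtain S where S: "finite S"
    "\<And>x. (\<forall>s\<in>S. cinner x s = 0) \<Longrightarrow> norm (T x) \<le> e / 4 * norm x"
    using assms e unfolding compact_op_def gelfand_bound_def
    by (metis zero_less_divide_iff zero_less_numeral)
  obtain Q where Q: "finite Q" "orthonormal Q (\<lambda>q. q)"
    "\<And>s. s \<in> S \<Longrightarrow> s = (\<Sum>q\<in>Q. cinner s q *\<^sub>C q)"
    using gram_schmidt[OF S(1)] by blast
  define K where "K = {(\<Sum>q\<in>Q. c q *\<^sub>C T q) | c. \<forall>q\<in>Q. cmod (c q) \<le> 1}"
  have "compact K" unfolding K_def by (rule compact_combinations[OF Q(1)])
  then obtain k where k: "finite k" "K \<subseteq> (\<Union>x\<in>k. ball x (e / 4))"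
    using e unfolding compact_eq_totally_bounded by (metis zero_less_divide_iff zero_less_numeral)
  have "T x \<in> (\<Union>x\<in>k. cball x (e / 2))" if "norm x \<le> 1" for x
  proof -
    define y where "y = x - (\<Sum>q\<in>Q. cinner x q *\<^sub>C q)"
    have yq: "cinner y q = 0" if "q \<in> Q" for q
      using residual_orthogonal[OF Q(2,1) that, of x] by (simp add: y_def)
    have "cinner y s = 0" if "s \<in> S" for s
      by (subst Q(3)[OF that]) (auto simp: cinner_sum_right cinner_lin yq intro!: sum.neutral)
    then have "norm (T y) \<le> e / 4 * norm y" using S(2) by blast
    moreover have "norm y \<le> 1"
    proof -
      have "(norm y)\<^sup>2 \<le> (norm x)\<^sup>2"
        unfolding y_def residual_norm_sq[OF Q(2,1)] by (simp add: sum_nonneg)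
      then show ?thesis using that by (meson norm_ge_zero order_trans power2_le_imp_le)
    qed
    ultimately have Ty: "norm (T y) \<le> e / 4" using e
      by (smt (verit) divide_pos_pos mult_left_le)
    have "(\<Sum>q\<in>Q. cinner x q *\<^sub>C T q) \<in> K"
    proof -
      have "cmod (cinner x q) \<le> 1" if "q \<in> Q" for q
        using cauchy_schwarz[of x q] orthonormal_norm[OF Q(2) that] \<open>norm x \<le> 1\<close> by simp
      then show ?thesis unfolding K_def by blast
    qed
    then obtain z where z: "z \<in> k" "dist z (\<Sum>q\<in>Q. cinner x q *\<^sub>C T q) < e / 4"
      using k by auto
    have "T x = T y + (\<Sum>q\<in>Q. cinner x q *\<^sub>C T q)"
      by (simp add: y_def blinfun.diff_right blinfun.sum_right BH_scaleC[OF T])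
    then have "dist z (T x) \<le> dist z (\<Sum>q\<in>Q. cinner x q *\<^sub>C T q) + norm (T y)"
      using norm_triangle_ineq4[of "z - (\<Sum>q\<in>Q. cinner x q *\<^sub>C T q)" "T y"]
      by (simp add: dist_norm algebra_simps)
    then have "dist z (T x) \<le> e / 2" using z Ty by linarith
    then show ?thesis using z(1) by auto
  qed
  then have "T ` cball 0 1 \<subseteq> (\<Union>x\<in>k. cball x (e / 2))" by auto
  then have "closure (T ` cball 0 1) \<subseteq> (\<Union>x\<in>k. cball x (e / 2))"
    by (rule closure_minimal) (use k in auto)
  also have "\<dots> \<subseteq> (\<Union>x\<in>k. ball x e)" using e by (intro UN_mono) auto
  finally show "\<exists>k. finite k \<and> closure (T ` cball 0 1) \<subseteq> (\<Union>x\<in>k. ball x e)" using k(1) by blast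
qed

subsection \<open>The spectral theorem for compact positive operators\<close>

context hilbert_basis
begin

text \<open>
  The complement \<open>K\<close> of the given eigenvectors is invariant. Let \<open>m\<close> be the supremum of the form on
  the unit sphere of \<open>K\<close>. For unit vectors in \<open>K\<close>, \<open>\<parallel>T x - m x\<parallel>\<^sup>2 \<le> m (m - \<langle>T x, x\<rangle>)\<close>, so that a maximising
  sequence consists of approximate eigenvectors, and compactness provides a limit.
\<close>

lemma maximal_eigenvector:
  fixes T :: "'a \<Rightarrow>\<^sub>L 'a"
  assumes pos: "positive_op T" and comp: "compact_op T" and S: "finite S"
    and inv: "\<And>s. s \<in> S \<Longrightarrow> \<exists>r::real. T s = r *\<^sub>R s"
  shows "\<exists>u \<mu>. norm u = 1 \<and> (\<forall>s\<in>S. cinner u s = 0) \<and> 0 \<le> \<mu> \<and> T u = \<mu> *\<^sub>R u \<and>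
    (\<forall>x. (\<forall>s\<in>S. cinner x s = 0) \<longrightarrow> norm (T x) \<le> \<mu> * norm x)"
proof -
  define K where "K = {x. \<forall>s\<in>S. cinner x s = 0}"
  have TK: "T x \<in> K" if "x \<in> K" for x
  proof -
    have "cinner (T x) s = 0" if "s \<in> S" for s
    proof -
      obtain r :: real where "T s = r *\<^sub>R s" using inv[OF \<open>s \<in> S\<close>] by blast
      then show ?thesis using \<open>x \<in> K\<close> \<open>s \<in> S\<close> positive_selfadjoint[OF pos, of x s]
        by (simp add: K_def cinner_lin)
    qed
    then show ?thesis by (simp add: K_def)
  qed
  obtain u0 where u0: "norm u0 = 1" "u0 \<in> K" using unit_orthogonal[OF S] by (auto simp: K_def)
  define R where "R = (\<lambda>x. Re (cinner (T x) x)) ` {x \<in> K. norm x = 1}"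
  define m where "m = Sup R"
  have Rle: "r \<le> norm T" if "r \<in> R" for r
  proof -
    obtain x where x: "norm x = 1" "r = Re (cinner (T x) x)" using \<open>r \<in> R\<close> by (auto simp: R_def)
    have "r \<le> cmod (cinner (T x) x)" unfolding x by (rule complex_Re_le_cmod)
    also have "\<dots> \<le> norm (T x) * norm x" by (rule cauchy_schwarz)
    also have "\<dots> \<le> norm T" using norm_blinfun[of T x] x by simp
    finally show ?thesis .
  qed
  have bR: "bdd_above R" using Rle by (auto simp: bdd_above_def)
  have neR: "R \<noteq> {}" using u0 by (auto simp: R_def)
  have mge: "Re (cinner (T x) x) \<le> m" if "x \<in> K" "norm x = 1" for x
    unfolding m_def using that by (intro cSup_upper bR) (auto simp: R_def)
  have m0: "m \<ge> 0" using mge[OF u0(2,1)] positive_opD(2)[OF pos, of u0] by linarith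
  have form: "Re (cinner (T x) x) \<le> m * (norm x)\<^sup>2" if "x \<in> K" for x
  proof (cases "x = 0")
    case False
    define y where "y = inverse (norm x) *\<^sub>R x"
    have "y \<in> K" using \<open>x \<in> K\<close> by (auto simp: y_def K_def cinner_lin)
    then have "Re (cinner (T y) y) \<le> m" using False by (intro mge) (simp_all add: y_def)
    then show ?thesis using False
      by (simp add: y_def blinfun.scaleR_right cinner_lin field_simps power2_eq_square)
  qed simp
  have bound: "(norm (T x))\<^sup>2 \<le> M * Re (cinner (T x) x)" if "x \<in> K" "M > 0" "M \<ge> m" for x M
  proof (rule positive_form_bound[OF pos that(2)])
    show "Re (cinner (T (T x)) (T x)) \<le> M * (norm (T x))\<^sup>2"
      using form[OF TK[OF that(1)]] mult_right_mono[OF that(3), of "(norm (T x))\<^sup>2"] by simp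
  qed
  show ?thesis
  proof (cases "m = 0")
    \<comment> \<open>Then \<open>T\<close> vanishes on \<open>K\<close>, and every unit vector in \<open>K\<close> will do.\<close>
    case True
    have "T x = 0" if "x \<in> K" for x
    proof -
      have "(norm (T x))\<^sup>2 \<le> 1 * Re (cinner (T x) x)" using that True by (intro bound) auto
      also have "\<dots> \<le> 0" using form[OF that] True by simp
      finally show ?thesis by simp
    qed
    then show ?thesis using u0 by (intro exI[of _ u0] exI[of _ 0]) (auto simp: K_def)
  next
    case False
    then have mpos: "m > 0" using m0 by simp
    have "\<exists>x. x \<in> K \<and> norm x = 1 \<and> m - 1 / real (Suc k) < Re (cinner (T x) x)" for k
    proof -
      have "m - 1 / real (Suc k) < Sup R" by (simp add: m_def)
      then obtain r where "r \<in> R" "m - 1 / real (Suc k) < r" using less_cSupE[OF _ neR] by metis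
      then show ?thesis by (auto simp: R_def)
    qed
    then obtain x where x: "\<And>k. x k \<in> K" "\<And>k. norm (x k) = 1"
      "\<And>k. m - 1 / real (Suc k) < Re (cinner (T (x k)) (x k))" by metis
    have "T (x k) \<in> closure (T ` cball 0 1)" for k
      using x(2)[of k] closure_subset by fastforce
    then obtain y r where r: "strict_mono (r :: nat \<Rightarrow> nat)" "((\<lambda>k. T (x k)) \<circ> r) \<longlonglongrightarrow> y"
      using compact_op_closure_image[OF comp] unfolding compact_def by metis
    have sq: "(norm (T (x k) - m *\<^sub>R x k))\<^sup>2 \<le> m * (1 / real (Suc k))" for k
    proof -
      have "(norm (T (x k) - m *\<^sub>R x k))\<^sup>2
          = (norm (T (x k)))\<^sup>2 - 2 * m * Re (cinner (T (x k)) (x k)) + m\<^sup>2"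
        using x(2)[of k] by (simp add: norm_diff_sq cinner_lin)
      also have "\<dots> \<le> m * (m - Re (cinner (T (x k)) (x k)))"
        using bound[OF x(1) mpos order.refl, of k] by (simp add: algebra_simps power2_eq_square)
      also have "\<dots> \<le> m * (1 / real (Suc k))"
        using x(3)[of k] mpos by (intro mult_left_mono) auto
      finally show ?thesis .
    qed
    have "(\<lambda>k. (norm (T (x k) - m *\<^sub>R x k))\<^sup>2) \<longlonglongrightarrow> 0"
    proof (rule tendsto_sandwich[OF _ _ tendsto_const])
      show "(\<lambda>k. m * (1 / real (Suc k))) \<longlonglongrightarrow> 0"
        using LIMSEQ_Suc[OF lim_1_over_n] by (intro tendsto_mult_right_zero) simp
    qed (use sq in auto)
    then have "(\<lambda>k. norm (T (x k) - m *\<^sub>R x k)) \<longlonglongrightarrow> 0"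
      using tendsto_real_sqrt by fastforce
    then have "(\<lambda>k. T (x k) - m *\<^sub>R x k) \<longlonglongrightarrow> 0" by (rule tendsto_norm_zero_cancel)
    then have "((\<lambda>k. T (x k) - m *\<^sub>R x k) \<circ> r) \<longlonglongrightarrow> 0"
      using r(1) by (rule LIMSEQ_subseq_LIMSEQ)
    then have "(\<lambda>k. ((\<lambda>k. T (x k)) \<circ> r) k - ((\<lambda>k. T (x k) - m *\<^sub>R x k) \<circ> r) k) \<longlonglongrightarrow> y - 0"
      by (intro tendsto_diff r(2))
    then have "(\<lambda>k. inverse m *\<^sub>R (m *\<^sub>R x (r k))) \<longlonglongrightarrow> inverse m *\<^sub>R y"
      by (intro tendsto_scaleR tendsto_const) (simp add: o_def)
    then have lim: "(\<lambda>k. x (r k)) \<longlonglongrightarrow> inverse m *\<^sub>R y" using mpos by simp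
    define u where "u = inverse m *\<^sub>R y"
    note lim = lim[folded u_def]
    have "(\<lambda>k. T (x (r k))) \<longlonglongrightarrow> T u"
      by (intro tendsto_intros lim)
    then have "T u = y" using r(2) LIMSEQ_unique by (fastforce simp: o_def)
    then have Tu: "T u = m *\<^sub>R u" using mpos by (simp add: u_def)
    have nu: "norm u = 1"
      using tendsto_norm[OF lim] x(2) LIMSEQ_unique[OF tendsto_const] by fastforce
    have uK: "cinner u s = 0" if "s \<in> S" for s
    proof -
      have "(\<lambda>k. cinner (x (r k)) s) \<longlonglongrightarrow> cinner u s"
        by (rule bounded_linear.tendsto[OF bounded_linear_cinner_left lim])
      then have "(\<lambda>k::nat. 0) \<longlonglongrightarrow> cinner u s" using x(1) that by (simp add: K_def)
      then show ?thesis using LIMSEQ_unique[OF tendsto_const] by metis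
    qed
    have "norm (T z) \<le> m * norm z" if "z \<in> K" for z
    proof -
      have "(norm (T z))\<^sup>2 \<le> m * (m * (norm z)\<^sup>2)"
        using bound[OF that mpos order.refl] mult_left_mono[OF form[OF that] m0] by linarith
      also have "\<dots> = (m * norm z)\<^sup>2" by (simp add: power2_eq_square)
      finally show ?thesis by (meson m0 mult_nonneg_nonneg norm_ge_zero power2_le_imp_le)
    qed
    then show ?thesis using nu uK Tu m0 by (intro exI[of _ u] exI[of _ m]) (auto simp: K_def)
  qed
qed

text \<open>
  If \<open>T\<close> maps \<open>n + 1\<close> orthonormal vectors to orthogonal vectors of norm at least \<open>s\<close>, it expands the
  norm by at least \<open>s\<close> on their span, which meets the complement of any \<open>n\<close> vectors.
\<close>

lemma gelfand_lower_bound: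
  fixes T :: "'a \<Rightarrow>\<^sub>L 'a"
  assumes T: "T \<in> BH" and e: "orthonormal {..n} e"
    and o: "\<And>i j. i \<le> n \<Longrightarrow> j \<le> n \<Longrightarrow> i \<noteq> j \<Longrightarrow> cinner (T (e i)) (T (e j)) = 0"
    and ge: "\<And>i. i \<le> n \<Longrightarrow> s \<le> norm (T (e i))" and s: "0 \<le> s"
    and g: "gelfand_bound T n c"
  shows "s \<le> c"
proof -
  obtain S where S: "finite S" "card S \<le> n"
    "\<And>x. (\<forall>s\<in>S. cinner x s = 0) \<Longrightarrow> norm (T x) \<le> c * norm x"
    using g unfolding gelfand_bound_def by blast
  obtain d where d: "(\<Sum>i\<le>n. (cmod (d i))\<^sup>2) = 1"
    "\<And>s. s \<in> S \<Longrightarrow> cinner (\<Sum>i\<le>n. d i *\<^sub>C e i) s = 0"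
    using orthogonal_combination[OF e _ S(1)] S(2) by auto
  define z where "z = (\<Sum>i\<le>n. d i *\<^sub>C e i)"
  have "(norm z)\<^sup>2 = 1" unfolding z_def using orthonormal_norm_sum[OF e] d(1) by simp
  then have nz: "norm z = 1" by (metis abs_norm_cancel abs_square_eq_1)
  have "s\<^sup>2 = (\<Sum>i\<le>n. (cmod (d i))\<^sup>2 * s\<^sup>2)" unfolding sum_distrib_right[symmetric] d(1) by simp
  also have "\<dots> \<le> (\<Sum>i\<le>n. (cmod (d i))\<^sup>2 * (norm (T (e i)))\<^sup>2)"
    by (intro sum_mono mult_left_mono power_mono ge s) simp_all
  also have "\<dots> = (norm (\<Sum>i\<le>n. d i *\<^sub>C T (e i)))\<^sup>2"
    using o by (subst orthogonal_norm_sum) auto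
  also have "(\<Sum>i\<le>n. d i *\<^sub>C T (e i)) = T z"
    by (simp add: z_def blinfun.sum_right BH_scaleC[OF T])
  finally have "s \<le> norm (T z)" by (rule power2_le_imp_le) simp
  also have "\<dots> \<le> c" using S(3)[of z] d(2) nz by (simp add: z_def)
  finally show ?thesis .
qed

text \<open>
  Eigenvectors are chosen greedily, each with the largest eigenvalue on the complement of its
  predecessors. By \<open>gelfand_lower_bound\<close> the eigenvalues tend to \<open>0\<close>.
\<close>

lemma spectral_theorem:
  fixes T :: "'a \<Rightarrow>\<^sub>L 'a"
  assumes pos: "positive_op T" and comp: "compact_op T"
  obtains e \<mu> where "orthonormal UNIV e" "\<mu> \<in> c0_star" "\<And>n. T (e n) = \<mu> n *\<^sub>R e n"
    "\<And>n x. (\<And>j. j < n \<Longrightarrow> cinner x (e j) = 0) \<Longrightarrow> norm (T x) \<le> \<mu> n * norm x"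
proof -
  define P where "P = (\<lambda>A (n :: nat) u. norm u = 1 \<and> (\<forall>s\<in>A. cinner u s = 0) \<and>
    (\<exists>\<mu>\<ge>0. T u = \<mu> *\<^sub>R u \<and> (\<forall>x. (\<forall>s\<in>A. cinner x s = 0) \<longrightarrow> norm (T x) \<le> \<mu> * norm x)))"
  have "\<exists>e. \<forall>n. P (e ` {..<n}) n (e n)"
  proof (rule greedy_sequence)
    fix f :: "nat \<Rightarrow> 'a" and n assume IH: "\<And>m. m < n \<Longrightarrow> P (f ` {..<m}) m (f m)"
    have "\<exists>r::real. T s = r *\<^sub>R s" if "s \<in> f ` {..<n}" for s
      using that IH unfolding P_def by blast
    then show "\<exists>u. P (f ` {..<n}) n u"
      using maximal_eigenvector[OF pos comp, of "f ` {..<n}"] unfolding P_def by blast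
  qed
  then obtain e where e: "\<And>n. P (e ` {..<n}) n (e n)" by blast
  have o: "orthonormal UNIV e"
    using e by (intro orthonormalI_less) (auto simp: P_def)
  have "\<forall>n. \<exists>\<mu>\<ge>0. T (e n) = \<mu> *\<^sub>R e n \<and> (\<forall>x. (\<forall>j<n. cinner x (e j) = 0) \<longrightarrow> norm (T x) \<le> \<mu> * norm x)"
  proof
    fix n
    obtain r where "r \<ge> 0" "T (e n) = r *\<^sub>R e n"
      "\<And>x. (\<forall>s\<in>e ` {..<n}. cinner x s = 0) \<Longrightarrow> norm (T x) \<le> r * norm x"
      using e[of n] unfolding P_def by blast
    then show "\<exists>\<mu>\<ge>0. T (e n) = \<mu> *\<^sub>R e n \<and> (\<forall>x. (\<forall>j<n. cinner x (e j) = 0) \<longrightarrow> norm (T x) \<le> \<mu> * norm x)"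
      by (intro exI[of _ r]) auto
  qed
  then obtain \<mu> where \<mu>: "\<And>n. \<mu> n \<ge> 0" "\<And>n. T (e n) = \<mu> n *\<^sub>R e n"
    "\<And>n x. (\<forall>j<n. cinner x (e j) = 0) \<Longrightarrow> norm (T x) \<le> \<mu> n * norm x"
    by metis
  have n1: "norm (e n) = 1" for n using orthonormal_norm[OF o] by simp
  have dec: "decseq \<mu>"
  proof (rule decseq_SucI)
    fix n
    have "norm (T (e (Suc n))) \<le> \<mu> n * norm (e (Suc n))"
      using o by (intro \<mu>(3)) (auto simp: orthonormal_def)
    then show "\<mu> (Suc n) \<le> \<mu> n" using \<mu>(1,2) n1 by simp
  qed
  have small: "\<exists>N. \<mu> N \<le> \<epsilon>" if "\<epsilon> > 0" for \<epsilon>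
  proof -
    obtain N where N: "gelfand_bound T N \<epsilon>" using comp \<open>\<epsilon> > 0\<close> unfolding compact_op_def by blast
    have "\<mu> N \<le> \<epsilon>"
    proof (rule gelfand_lower_bound[OF positive_opD(1)[OF pos] orthonormal_subset[OF o] _ _ \<mu>(1) N])
      show "cinner (T (e i)) (T (e j)) = 0" if "i \<noteq> j" for i j
        using that o by (simp add: \<mu>(2) cinner_lin orthonormal_def)
      show "\<mu> N \<le> norm (T (e i))" if "i \<le> N" for i
        using decseqD[OF dec that] \<mu>(1) n1 by (simp add: \<mu>(2))
    qed auto
    then show ?thesis by blast
  qed
  have "\<mu> \<longlonglongrightarrow> 0"
  proof (rule LIMSEQ_I)
    fix r :: real assume "r > 0"
    then obtain N where N: "\<mu> N \<le> r / 2" using small[of "r / 2"] by auto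
    have "norm (\<mu> n - 0) < r" if "n \<ge> N" for n
      using decseqD[OF dec that] N \<mu>(1)[of n] \<open>r > 0\<close> by simp
    then show "\<exists>N. \<forall>n\<ge>N. norm (\<mu> n - 0) < r" by blast
  qed
  then have "\<mu> \<in> c0_star" using dec \<mu>(1) by (simp add: c0_star_def)
  then show ?thesis using that o \<mu>(2,3) by blast
qed

end

subsection \<open>Singular value decompositions\<close>

text \<open>
  The orthonormal system \<open>e\<close> need not be complete, but the last clause forces \<open>X\<close> to vanish on its
  orthogonal complement, since \<open>\<sigma>\<close> tends to \<open>0\<close>. Right singular vectors for the value \<open>0\<close> make \<open>e\<close>
  infinite even if \<open>X\<close> has finite rank.
\<close>

definition svd :: "('a::chilbert_space \<Rightarrow>\<^sub>L 'a) \<Rightarrow> (nat \<Rightarrow> real) \<Rightarrow> (nat \<Rightarrow> 'a) \<Rightarrow> bool"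
  where "svd X \<sigma> e \<longleftrightarrow> X \<in> BH \<and> orthonormal UNIV e \<and> \<sigma> \<in> c0_star \<and>
    (\<forall>n. blinfun_apply (adj X o\<^sub>L X) (e n) = (\<sigma> n)\<^sup>2 *\<^sub>R e n) \<and>
    (\<forall>n x. (\<forall>j<n. cinner x (e j) = 0) \<longrightarrow> norm (blinfun_apply X x) \<le> \<sigma> n * norm x)"

lemma svdD:
  assumes "svd X \<sigma> e"
  shows "X \<in> BH" "orthonormal UNIV e" "\<sigma> \<in> c0_star" "decseq \<sigma>" "\<And>n. 0 \<le> \<sigma> n" "\<sigma> \<longlonglongrightarrow> 0"
    "\<And>n. blinfun_apply (adj X) (X (e n)) = (\<sigma> n)\<^sup>2 *\<^sub>R e n"
    "\<And>n x. (\<And>j. j < n \<Longrightarrow> cinner x (e j) = 0) \<Longrightarrow> norm (blinfun_apply X x) \<le> \<sigma> n * norm x"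
  using assms by (auto simp: svd_def c0_star_def)

lemma svd_perp:
  assumes X: "svd X \<sigma> e" and x: "\<And>n. cinner x (e n) = 0"
  shows "blinfun_apply X x = 0"
proof -
  have "norm (X x) \<le> \<sigma> n * norm x" for n using svdD(8)[OF X] x by blast
  moreover have "(\<lambda>n. \<sigma> n * norm x) \<longlonglongrightarrow> 0"
    using svdD(6)[OF X] by (rule tendsto_mult_left_zero)
  ultimately have "norm (X x) \<le> 0" by (intro LIMSEQ_le_const) auto
  then show ?thesis by simp
qed

lemma svd_gelfand_bound: 
  assumes X: "svd X \<sigma> e"
  shows "gelfand_bound X n (\<sigma> n)"
  unfolding gelfand_bound_def
  using svdD(8)[OF X, of n] by (intro exI[of _ "e ` {..<n}"]) (auto intro: order.trans[OF card_image_le])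

lemma svd_compact:
  assumes X: "svd X \<sigma> e"
  shows "compact_op X"
  unfolding compact_op_def
proof (intro conjI allI impI)
  show "X \<in> BH" by (rule svdD(1)[OF X])
  fix \<epsilon> :: real assume "\<epsilon> > 0"
  then obtain n where n: "\<sigma> n < \<epsilon>"
    using order_tendstoD(2)[OF svdD(6)[OF X], of \<epsilon>] by (meson eventually_sequentially order.refl)
  then have "gelfand_bound X n \<epsilon>"
    using gelfand_bound_mono[OF svd_gelfand_bound[OF X]] by simp
  then show "\<exists>n. gelfand_bound X n \<epsilon>" by blast
qed

lemma has_cdim_unique:
  assumes "has_cdim E k" "has_cdim E l"
  shows "k = l"
proof -
  have "complex_vector.dim E = k" if "has_cdim E k" for k
  proof -
    obtain B where B: "card B = k" "complex_vector.independent B" "complex_vector.span B = E"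
      using \<open>has_cdim E k\<close> unfolding has_cdim_def by blast
    have "complex_vector.span E = E"
      using complex_vector.span_span[of B] unfolding B(3) .
    then show ?thesis
      using complex_vector.dim_eq_card[of B E] B by metis
  qed
  then show ?thesis using assms by blast
qed

lemma c0_star_level_finite: "\<xi> \<in> c0_star \<Longrightarrow> t > 0 \<Longrightarrow> finite {n. \<xi> n = t}"
proof -
  assume "\<xi> \<in> c0_star" "t > 0"
  then obtain N where "\<And>n. n \<ge> N \<Longrightarrow> \<xi> n < t"
    using order_tendstoD(2)[of \<xi> 0 sequentially t] unfolding c0_star_def eventually_sequentially by auto
  then have "{n. \<xi> n = t} \<subseteq> {..<N}" by (force simp: not_less[symmetric])
  then show ?thesis by (rule finite_subset) simp
qed

text \<open>
  Suppose \<open>\<zeta> n < \<xi> n = t\<close>. As \<open>\<zeta>\<close> decreases, it takes the value \<open>t\<close> only before \<open>n\<close>, where it agrees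
  with \<open>\<xi>\<close>; so \<open>\<xi>\<close> takes this value more often.
\<close>

lemma c0_star_le_by_levels:
  assumes \<xi>: "\<xi> \<in> c0_star" and \<zeta>: "\<zeta> \<in> c0_star"
    and eq: "\<And>t. t > 0 \<Longrightarrow> card {n. \<xi> n = t} = card {n. \<zeta> n = t}"
    and n: "\<And>m. m < n \<Longrightarrow> \<xi> m = \<zeta> m"
  shows "\<xi> n \<le> \<zeta> n"
proof (rule ccontr)
  assume "\<not> ?thesis"
  then have less: "\<zeta> n < \<xi> n" by simp
  define t where "t = \<xi> n"
  have t: "t > 0" using less \<zeta> by (auto simp: t_def c0_star_def intro: le_less_trans)
  have "m < n" if "\<zeta> m = t" for m
  proof (rule ccontr)
    assume "\<not> m < n"
    then have "\<zeta> m \<le> \<zeta> n" using \<zeta> by (auto simp: c0_star_def decseq_def)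
    then show False using that less by (simp add: t_def)
  qed
  then have "{m. \<zeta> m = t} \<subset> {m. \<xi> m = t}" using n less by (auto simp: t_def)
  then have "card {m. \<zeta> m = t} < card {m. \<xi> m = t}"
    by (rule psubset_card_mono[OF c0_star_level_finite[OF \<xi> t]])
  then show False using eq[OF t] by simp
qed

lemma c0_star_eq_by_levels:
  assumes "\<xi> \<in> c0_star" "\<zeta> \<in> c0_star"
    and "\<And>t. t > 0 \<Longrightarrow> card {n. \<xi> n = t} = card {n. \<zeta> n = t}"
  shows "\<xi> = \<zeta>"
proof
  fix n
  show "\<xi> n = \<zeta> n"
  proof (induction n rule: less_induct)
    case (less n)
    show ?case
      using c0_star_le_by_levels[OF assms, of n] c0_star_le_by_levels[OF assms(2,1), of n] assms(3) less
      by fastforce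
  qed
qed

lemma orthonormal_independent:
  assumes "orthonormal B (\<lambda>q. q)" "finite B"
  shows "complex_vector.independent B"
proof -
  have "u v = 0" if "(\<Sum>v\<in>B. u v *\<^sub>C v) = 0" "v \<in> B" for u v
    using orthonormal_comb_cinner[OF assms that(2), of u] that(1) by simp
  then show ?thesis using complex_vector.dependent_finite[OF assms(2)] by blast
qed

context hilbert_basis
begin

lemma svd_cinner:
  assumes X: "svd X \<sigma> (e :: nat \<Rightarrow> 'a)"
  shows "cinner (X (e m)) (X (e n)) = (if m = n then of_real ((\<sigma> n)\<^sup>2) else 0)"
proof -
  have "cinner (X (e m)) (X (e n)) = cinner (adj X (X (e m))) (e n)"
    by (rule cinner_adj_left[OF svdD(1)[OF X], symmetric])
  then show ?thesis using svdD(2)[OF X] by (simp add: svdD(7)[OF X] cinner_lin orthonormal_def)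
qed

lemma svd_norm:
  assumes X: "svd X \<sigma> (e :: nat \<Rightarrow> 'a)"
  shows "norm (X (e n)) = \<sigma> n"
proof -
  have "(norm (X (e n)))\<^sup>2 = (\<sigma> n)\<^sup>2" using svd_cinner[OF X, of n n] by (simp add: norm_sq_cinner)
  then show ?thesis using svdD(5)[OF X, of n] by simp
qed

text \<open>
  The spectral theorem for \<open>X\<^sup>* X\<close>, whose eigenvalues are the squares of the singular values.
\<close>

lemma svd_exists:
  fixes X :: "'a \<Rightarrow>\<^sub>L 'a"
  assumes "compact_op X"
  shows "\<exists>\<sigma> e. svd X \<sigma> e"
proof -
  have X: "X \<in> BH" using assms by (simp add: compact_op_def)
  define T where "T = adj X o\<^sub>L X"
  have T: "T \<in> BH" unfolding T_def by (intro BH_compose adj_BH X)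
  have Tx: "cinner (T x) x = of_real ((norm (X x))\<^sup>2)" for x
    by (simp add: T_def cinner_adj_left[OF X] cinner_self)
  have pos: "positive_op T" unfolding positive_op_def using T Tx by (simp add: complex_nonneg_Reals_iff)
  have comp: "compact_op T"
    unfolding compact_op_def
  proof (intro conjI T allI impI)
    fix \<epsilon> :: real assume \<epsilon>: "\<epsilon> > 0"
    define K where "K = norm (adj X) + 1"
    have K: "K > 0" "norm (adj X) \<le> K" by (auto simp: K_def add_nonneg_pos)
    obtain n where "gelfand_bound X n (\<epsilon> / K)"
      using assms \<epsilon> K(1) unfolding compact_op_def by (meson divide_pos_pos)
    then obtain S where S: "finite S" "card S \<le> n"
      "\<And>x. (\<forall>s\<in>S. cinner x s = 0) \<Longrightarrow> norm (X x) \<le> \<epsilon> / K * norm x"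
      unfolding gelfand_bound_def by blast
    have "norm (T x) \<le> \<epsilon> * norm x" if "\<forall>s\<in>S. cinner x s = 0" for x
    proof -
      have "norm (T x) \<le> norm (adj X) * norm (X x)" unfolding T_def by (simp add: norm_blinfun)
      also have "\<dots> \<le> K * (\<epsilon> / K * norm x)"
        using S(3)[OF that] K by (intro mult_mono) auto
      finally show ?thesis using K by simp
    qed
    then show "\<exists>n. gelfand_bound T n \<epsilon>" unfolding gelfand_bound_def using S(1,2) by blast
  qed
  obtain e \<mu> where e: "orthonormal UNIV e" "\<mu> \<in> c0_star" "\<And>n. T (e n) = \<mu> n *\<^sub>R e n"
    "\<And>n x. (\<And>j. j < n \<Longrightarrow> cinner x (e j) = 0) \<Longrightarrow> norm (T x) \<le> \<mu> n * norm x"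
    using spectral_theorem[OF pos comp] by blast
  have \<mu>0: "\<mu> n \<ge> 0" for n using e(2) by (simp add: c0_star_def)
  have "svd X (\<lambda>n. sqrt (\<mu> n)) e"
    unfolding svd_def
  proof (intro conjI allI impI X e(1))
    have "(\<lambda>n. sqrt (\<mu> n)) \<longlonglongrightarrow> 0" using e(2) tendsto_real_sqrt[of \<mu> 0] by (simp add: c0_star_def)
    then show "(\<lambda>n. sqrt (\<mu> n)) \<in> c0_star" using e(2) by (auto simp: c0_star_def decseq_def)
    show "(adj X o\<^sub>L X) (e n) = (sqrt (\<mu> n))\<^sup>2 *\<^sub>R e n" for n
      using e(3) \<mu>0 by (simp add: T_def[symmetric])
    fix n x assume x: "\<forall>j<n. cinner x (e j) = 0"
    have "(norm (X x))\<^sup>2 \<le> norm (T x) * norm x"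
      using cauchy_schwarz[of "T x" x] unfolding Tx norm_of_real by simp
    also have "\<dots> \<le> (\<mu> n * norm x) * norm x"
      using x by (intro mult_right_mono e(4)) auto
    also have "\<dots> = (sqrt (\<mu> n) * norm x)\<^sup>2" using \<mu>0[of n] by (simp add: power_mult_distrib power2_eq_square)
    finally show "norm (X x) \<le> sqrt (\<mu> n) * norm x"
      by (rule power2_le_imp_le) (simp add: \<mu>0)
  qed
  then show ?thesis by blast
qed

lemma svd_exists_positive:
  fixes X :: "'a \<Rightarrow>\<^sub>L 'a"
  assumes "compact_op X" and pos: "positive_op X"
  shows "\<exists>\<sigma> e. svd X \<sigma> e \<and> (\<forall>n. X (e n) = \<sigma> n *\<^sub>R e n)"
proof -
  obtain e \<mu> where e: "orthonormal UNIV e" "\<mu> \<in> c0_star" "\<And>n. X (e n) = \<mu> n *\<^sub>R e n"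
    "\<And>n x. (\<And>j. j < n \<Longrightarrow> cinner x (e j) = 0) \<Longrightarrow> norm (X x) \<le> \<mu> n * norm x"
    using spectral_theorem[OF pos assms(1)] by blast
  have "adj X = X" by (rule adj_eqI) (rule positive_selfadjoint[OF pos])
  then have "svd X \<mu> e"
    unfolding svd_def using e positive_opD(1)[OF pos]
    by (auto simp: blinfun.scaleR_right power2_eq_square)
  then show ?thesis using e(3) by blast
qed

lemma svd_le_gelfand:
  assumes X: "svd X \<sigma> (e :: nat \<Rightarrow> 'a)" and g: "gelfand_bound X n c"
  shows "\<sigma> n \<le> c"
proof (rule gelfand_lower_bound[OF svdD(1)[OF X] orthonormal_subset[OF svdD(2)[OF X]] _ _ svdD(5)[OF X] g])
  show "cinner (X (e i)) (X (e j)) = 0" if "i \<noteq> j" for i j using svd_cinner[OF X] that by simp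
  show "\<sigma> n \<le> norm (X (e i))" if "i \<le> n" for i
    using svdD(4)[OF X] that by (simp add: svd_norm[OF X] decseq_def)
qed auto

text \<open>
  An eigenvector is orthogonal to all \<open>e n\<close> with \<open>\<sigma> n \<noteq> t\<close>. Subtracting its components along the others
  leaves a vector orthogonal to the whole system, on which \<open>X\<close> vanishes.
\<close>

lemma svd_eigenspace:
  assumes X: "svd X \<sigma> (e :: nat \<Rightarrow> 'a)" and t: "t > 0"
  shows "has_cdim {x. blinfun_apply (adj X o\<^sub>L X) x = t\<^sup>2 *\<^sub>R x} (card {n. \<sigma> n = t})"
proof -
  define N where "N = {n. \<sigma> n = t}"
  define B where "B = e ` N"
  define E where "E = {x. blinfun_apply (adj X o\<^sub>L X) x = t\<^sup>2 *\<^sub>R x}"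
  note o = svdD(2)[OF X]
  have finN: "finite N" unfolding N_def by (rule c0_star_level_finite[OF svdD(3)[OF X] t])
  have inj: "inj_on e N" by (rule orthonormal_inj[OF orthonormal_subset[OF o]]) simp
  have oB: "orthonormal B (\<lambda>q. q)"
    using o unfolding B_def orthonormal_def by (auto split: if_splits) (metis zero_neq_one)
  have T: "adj X o\<^sub>L X \<in> BH" by (intro BH_compose adj_BH svdD(1)[OF X])
  have subE: "complex_vector.subspace E"
    unfolding E_def complex_vector.subspace_def using BH_scaleC[OF T]
    by (auto simp: blinfun.add_right scaleC_add_right scaleC_scaleC mult.commute simp flip: scaleC_of_real)
  have "complex_vector.span B = E"
  proof
    have "B \<subseteq> E" by (auto simp: B_def N_def E_def svdD(7)[OF X])
    then show "complex_vector.span B \<subseteq> E" using subE by (rule complex_vector.span_minimal)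
    show "E \<subseteq> complex_vector.span B"
    proof
      fix x assume x: "x \<in> E"
      have co: "cinner x (e n) = 0" if "n \<notin> N" for n
      proof -
        have "of_real (t\<^sup>2) * cinner x (e n) = cinner (adj X (X x)) (e n)"
          using x by (simp add: E_def cinner_lin)
        also have "\<dots> = cinner x (adj X (X (e n)))"
          by (simp only: cinner_adj_left[OF svdD(1)[OF X]] cinner_adj_right[OF svdD(1)[OF X]])
        also have "\<dots> = of_real ((\<sigma> n)\<^sup>2) * cinner x (e n)"
          by (simp add: svdD(7)[OF X] cinner_lin)
        finally have "cinner x (e n) = 0 \<or> t\<^sup>2 = (\<sigma> n)\<^sup>2"
          by (metis mult_right_cancel of_real_eq_iff)
        then show ?thesis using that t svdD(5)[OF X, of n] by (auto simp: N_def)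
      qed
      define y where "y = x - (\<Sum>n\<in>N. cinner x (e n) *\<^sub>C e n)"
      have sumE: "(\<Sum>n\<in>N. cinner x (e n) *\<^sub>C e n) \<in> complex_vector.span B"
        unfolding B_def by (intro complex_vector.span_sum complex_vector.span_scale complex_vector.span_base) auto
      have "cinner y (e n) = 0" for n
      proof (cases "n \<in> N")
        case True
        show ?thesis unfolding y_def
          by (rule residual_orthogonal[OF orthonormal_subset[OF o] finN True]) simp
      next
        case False
        have "(\<Sum>k\<in>N. cinner x (e k) * cinner (e k) (e n)) = 0"
          using False o by (intro sum.neutral) (auto simp: orthonormal_def)
        then show ?thesis using co[OF False] by (simp add: y_def cinner_lin cinner_sum_left)
      qed
      then have "X y = 0" by (rule svd_perp[OF X])
      moreover have "y \<in> E"
        unfolding y_def using x sumE \<open>complex_vector.span B \<subseteq> E\<close>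
        by (intro complex_vector.subspace_diff[OF subE]) auto
      ultimately have "t\<^sup>2 *\<^sub>R y = 0" by (simp add: E_def blinfun.zero_right)
      then have "y = 0" using t by simp
      then show "x \<in> complex_vector.span B" using sumE by (simp add: y_def)
    qed
  qed
  then show ?thesis
    unfolding has_cdim_def E_def[symmetric] N_def[symmetric]
    using orthonormal_independent[OF oB] finN card_image[OF inj] by (intro exI[of _ B]) (auto simp: B_def)
qed

lemma s_numbers_svd:
  assumes X: "svd X \<sigma> (e :: nat \<Rightarrow> 'a)"
  shows "s_numbers X = \<sigma>"
  unfolding s_numbers_def
proof (rule the_equality)
  show "\<sigma> \<in> c0_star \<and> (\<forall>t>0. has_cdim {x. (adj X o\<^sub>L X) x = t\<^sup>2 *\<^sub>R x} (card {n. \<sigma> n = t}))"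
    using svdD(3)[OF X] svd_eigenspace[OF X] by blast
  fix \<xi> assume \<xi>: "\<xi> \<in> c0_star \<and> (\<forall>t>0. has_cdim {x. (adj X o\<^sub>L X) x = t\<^sup>2 *\<^sub>R x} (card {n. \<xi> n = t}))"
  show "\<xi> = \<sigma>"
    by (rule c0_star_eq_by_levels) (use \<xi> svdD(3)[OF X] svd_eigenspace[OF X] has_cdim_unique in blast)+
qed

end

section \<open>Ideals and characteristic sets\<close>

lemma series_op_cinner:
  assumes f: "suborthonormal UNIV f" and g: "suborthonormal UNIV g" and a: "Bseq a"
  shows "cinner (blinfun_apply (series_op a g f) x) y = (\<Sum>k. of_real (a k) * cinner x (f k) * cinner (g k) y)"
    and "summable (\<lambda>k. of_real (a k) * cinner x (f k) * cinner (g k) y)"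
proof -
  show "cinner (series_op a g f x) y = (\<Sum>k. of_real (a k) * cinner x (f k) * cinner (g k) y)"
    unfolding series_op_apply[OF assms]
    by (subst bounded_linear.suminf[OF bounded_linear_cinner_left series_op_summable[OF assms]])
      (simp add: cinner_lin)
  show "summable (\<lambda>k. of_real (a k) * cinner x (f k) * cinner (g k) y)"
    using bounded_linear.summable[OF bounded_linear_cinner_left series_op_summable[OF assms], of x y]
    by (simp add: cinner_lin)
qed

lemma c0_star_Bseq: "\<xi> \<in> c0_star \<Longrightarrow> Bseq \<xi>"
  by (intro convergent_imp_Bseq convergentI) (auto simp: c0_star_def)

lemma c0_star_ge: "\<xi> \<in> c0_star \<Longrightarrow> m \<le> n \<Longrightarrow> \<xi> n \<le> \<xi> m"
  by (auto simp: c0_star_def decseq_def)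

lemma c0_star_nonneg: "\<xi> \<in> c0_star \<Longrightarrow> 0 \<le> \<xi> n"
  by (auto simp: c0_star_def)

lemma svd_diagonal:
  assumes e: "orthonormal UNIV e" and \<xi>: "\<xi> \<in> c0_star"
  shows "svd (series_op \<xi> e e) \<xi> e"
proof -
  note se = orthonormal_imp_suborthonormal[OF e]
  note bs = c0_star_Bseq[OF \<xi>]
  let ?D = "series_op \<xi> e e"
  have "adj ?D = ?D"
  proof (rule adj_eqI)
    fix x y
    have "cinner x (?D y) = cnj (cinner (?D y) x)" by (rule cinner_commute)
    also have "\<dots> = (\<Sum>k. cnj (of_real (\<xi> k) * cinner y (e k) * cinner (e k) x))"
      unfolding series_op_cinner(1)[OF se se bs]
      by (rule bounded_linear.suminf[OF bounded_linear_cnj series_op_cinner(2)[OF se se bs]])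
    also have "\<dots> = (\<Sum>k. of_real (\<xi> k) * cinner x (e k) * cinner (e k) y)"
      by (intro suminf_cong) (simp add: cinner_commute[of y] cinner_commute[of _ x])
    finally show "cinner (?D x) y = cinner x (?D y)"
      by (simp add: series_op_cinner(1)[OF se se bs])
  qed
  moreover have De: "?D (e n) = \<xi> n *\<^sub>R e n" for n
    using series_op_orthonormal[OF e se bs] by (simp add: scaleC_of_real)
  moreover have "norm (?D x) \<le> \<xi> n * norm x" if x: "\<forall>j<n. cinner x (e j) = 0" for n x
  proof -
    have le: "(cmod (of_real (\<xi> k) * cinner x (e k)))\<^sup>2 \<le> (\<xi> n)\<^sup>2 * (cmod (cinner x (e k)))\<^sup>2" for k
    proof (cases "k < n")
      case False
      then have "(\<xi> k)\<^sup>2 \<le> (\<xi> n)\<^sup>2"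
        using c0_star_ge[OF \<xi>, of n k] c0_star_nonneg[OF \<xi>] by (intro power_mono) auto
      then show ?thesis by (simp add: norm_mult power_mult_distrib mult_right_mono)
    qed (use x in auto)
    note b = bessel_series[OF se, of x]
    have s: "summable (\<lambda>k. (cmod (of_real (\<xi> k) * cinner x (e k)))\<^sup>2)"
      by (rule summable_comparison_test'[where N = 0, OF summable_mult[where c = "(\<xi> n)\<^sup>2", OF b(1)]])
        (use le in auto)
    have "(norm (?D x))\<^sup>2 \<le> (\<Sum>k. (cmod (of_real (\<xi> k) * cinner x (e k)))\<^sup>2)"
      unfolding series_op_apply[OF se se bs] by (rule orthogonal_series(2)[OF se s])
    also have "\<dots> \<le> (\<xi> n)\<^sup>2 * (\<Sum>k. (cmod (cinner x (e k)))\<^sup>2)"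
      unfolding suminf_mult[OF b(1), symmetric] by (rule suminf_le[OF le s summable_mult[OF b(1)]])
    also have "\<dots> \<le> (\<xi> n)\<^sup>2 * (norm x)\<^sup>2" by (rule mult_left_mono[OF b(2)]) simp
    finally show ?thesis
      using c0_star_nonneg[OF \<xi>] by (simp flip: power_mult_distrib)
  qed
  ultimately show ?thesis
    unfolding svd_def using e \<xi> series_op_BH[OF se se bs]
    by (auto simp: blinfun.scaleR_right power2_eq_square)
qed

lemma op_idealD:
  assumes "op_ideal I"
  shows "\<And>X. X \<in> I \<Longrightarrow> X \<in> BH" "0 \<in> I" "\<And>X Y. X \<in> I \<Longrightarrow> Y \<in> I \<Longrightarrow> X + Y \<in> I"
    "\<And>X T. X \<in> I \<Longrightarrow> T \<in> BH \<Longrightarrow> T o\<^sub>L X \<in> I" "\<And>X T. X \<in> I \<Longrightarrow> T \<in> BH \<Longrightarrow> X o\<^sub>L T \<in> I"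
    "\<not> BH \<subseteq> I"
  using assms unfolding op_ideal_def by auto

lemma op_ideal_scaleC: "op_ideal I \<Longrightarrow> X \<in> I \<Longrightarrow> c *\<^sub>C X \<in> I"
proof -
  assume I: "op_ideal I" and X: "X \<in> I"
  have "(c *\<^sub>C id_blinfun) o\<^sub>L X = c *\<^sub>C X"
    by (rule blinfun_eqI) (simp add: blinfun_apply_scaleC)
  then show "c *\<^sub>C X \<in> I" using op_idealD(4)[OF I X BH_scaleC_op[OF BH_id], of c] by simp
qed

lemma op_ideal_sum: "op_ideal I \<Longrightarrow> (\<And>i. i \<in> A \<Longrightarrow> X i \<in> I) \<Longrightarrow> sum X A \<in> I"
  by (induction A rule: infinite_finite_induct) (auto intro: op_idealD)

lemma op_ideal_diff: "op_ideal I \<Longrightarrow> X \<in> I \<Longrightarrow> Y \<in> I \<Longrightarrow> X - Y \<in> I"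
  using op_idealD(3)[of I X "- Y"] op_ideal_scaleC[of I Y "-1"] by simp

context hilbert_basis
begin

text \<open>
  If \<open>X\<close> is not compact, then orthonormal vectors \<open>u n\<close> can be chosen greedily with \<open>\<parallel>X (u n)\<parallel> > \<epsilon>\<close> and
  with orthogonal images: \<open>u n\<close> is taken orthogonal to the vectors \<open>X\<^sup>* X (u j)\<close>, \<open>j < n\<close>, too. Then the
  identity factors as \<open>W X V\<close>, where \<open>V\<close> maps the basis to the vectors \<open>u n\<close> and \<open>W\<close> maps their images back.
\<close>

lemma proper_ideal_compact:
  fixes X :: "'a \<Rightarrow>\<^sub>L 'a"
  assumes I: "op_ideal I" and X: "X \<in> I"
  shows "compact_op X"
proof (rule ccontr)
  assume nc: "\<not> compact_op X"
  note BHX = op_idealD(1)[OF I X]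
  obtain \<epsilon> where \<epsilon>: "\<epsilon> > 0" "\<And>n. \<not> gelfand_bound X n \<epsilon>"
    using nc BHX unfolding compact_op_def by blast
  have far: "\<exists>u. norm u = 1 \<and> (\<forall>s\<in>S. cinner u s = 0) \<and> norm (X u) > \<epsilon>" if S: "finite S" for S
  proof -
    obtain x where x: "\<forall>s\<in>S. cinner x s = 0" "norm (X x) > \<epsilon> * norm x"
      using \<epsilon>(2)[of "card S"] S unfolding gelfand_bound_def by (meson linorder_not_less order.refl)
    have "x \<noteq> 0" using x(2) by auto
    then show ?thesis using x
      by (intro exI[of _ "inverse (norm x) *\<^sub>R x"])
        (auto simp: cinner_lin blinfun.scaleR_right field_simps)
  qed
  define P where "P = (\<lambda>A (n :: nat) u. norm u = 1 \<and>
    (\<forall>s \<in> A \<union> (\<lambda>v. adj X (X v)) ` A. cinner u s = 0) \<and> norm (X u) > \<epsilon>)"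
  have "\<exists>u. \<forall>n. P (u ` {..<n}) n (u n)"
    by (rule greedy_sequence) (unfold P_def, rule far, simp)
  then obtain u where u: "\<And>n. P (u ` {..<n}) n (u n)" by blast
  have ou: "orthonormal UNIV u"
    using u by (intro orthonormalI_less) (auto simp: P_def)
  have less: "cinner (X (u i)) (X (u j)) = 0" if "j < i" for i j
    using u[of i] that by (auto simp: P_def simp flip: cinner_adj_right[OF BHX])
  have Xo: "cinner (X (u i)) (X (u j)) = 0" if "i \<noteq> j" for i j
    using less[of i j] less[of j i] that cinner_eq_0_commute by (metis linorder_neqE_nat)
  have Xu: "norm (X (u n)) > \<epsilon>" for n using u[of n] by (simp add: P_def)
  have Xu0: "norm (X (u n)) > 0" for n using Xu[of n] \<epsilon>(1) by linarith
  define v where "v = (\<lambda>n. inverse (norm (X (u n))) *\<^sub>R X (u n))"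
  have ov: "orthonormal UNIV v"
    unfolding orthonormal_def using Xu0 Xo
    by (auto simp: v_def cinner_lin cinner_self power2_eq_square field_simps)
  note sv = orthonormal_imp_suborthonormal[OF ov] and su = orthonormal_imp_suborthonormal[OF ou]
    and sh = orthonormal_imp_suborthonormal[OF orthonormal_basis]
  have b: "Bseq (\<lambda>n. inverse (norm (X (u n))))"
    using Xu \<epsilon>(1) by (intro BseqI'[where K = "inverse \<epsilon>"]) (simp add: le_imp_inverse_le less_imp_le)
  have b1: "Bseq (\<lambda>n. 1 :: real)" by (intro BseqI'[where K = 1]) simp
  define W where "W = series_op (\<lambda>n. inverse (norm (X (u n)))) h v"
  define V where "V = series_op (\<lambda>n. 1) u h"
  have WV: "W \<in> BH" "V \<in> BH" unfolding W_def V_def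
    by (intro series_op_BH sv sh su b b1)+
  have "X (u n) = norm (X (u n)) *\<^sub>R v n" for n using Xu0[of n] by (simp add: v_def)
  then have "W (X (u n)) = norm (X (u n)) *\<^sub>R W (v n)" for n by (metis blinfun.scaleR_right)
  then have "W (X (V (h n))) = h n" for n
    using series_op_orthonormal[OF ov sh b] series_op_orthonormal[OF orthonormal_basis su b1] Xu0[of n]
    by (simp add: W_def V_def scaleC_of_real flip: of_real_inverse)
  moreover have "(W o\<^sub>L X o\<^sub>L V) x = id_blinfun x" if "\<And>n. cinner x (h n) = 0" for x
    using complete_basis[OF that] by (simp add: blinfun.zero_right)
  ultimately have "W o\<^sub>L X o\<^sub>L V = id_blinfun"
    using BHX WV by (intro op_eqI[OF orthonormal_basis] BH_compose BH_id) auto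
  then have "id_blinfun \<in> I"
    using op_idealD(5)[OF I op_idealD(4)[OF I X WV(1)] WV(2)] by simp
  then have "T \<in> I" if "T \<in> BH" for T
  proof -
    have "T o\<^sub>L id_blinfun = T" by (rule blinfun_eqI) simp
    then show ?thesis using op_idealD(4)[OF I \<open>id_blinfun \<in> I\<close> that] by simp
  qed
  then show False using op_idealD(6)[OF I] by blast
qed

lemma ideal_svd:
  fixes X :: "'a \<Rightarrow>\<^sub>L 'a"
  assumes "op_ideal I" "X \<in> I"
  obtains \<sigma> e where "svd X \<sigma> e"
  using svd_exists[OF proper_ideal_compact[OF assms]] by blast

text \<open>
  The left singular vectors \<open>X (e n) / \<sigma> n\<close>, replaced by \<open>0\<close> where \<open>\<sigma> n = 0\<close>.
\<close>

lemma left_singular_system: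
  assumes X: "svd X \<sigma> (e :: nat \<Rightarrow> 'a)"
  obtains f where "suborthonormal UNIV f" "\<And>n. X (e n) = \<sigma> n *\<^sub>R f n"
    "\<And>n. \<sigma> n \<noteq> 0 \<Longrightarrow> norm (f n) = 1"
proof -
  define f where "f = (\<lambda>n. inverse (\<sigma> n) *\<^sub>R X (e n))"
  have nf: "norm (f n) = (if \<sigma> n = 0 then 0 else 1)" for n
    using svd_norm[OF X, of n] svdD(5)[OF X, of n] by (simp add: f_def)
  have "cinner (f i) (f j) = 0" if "i \<noteq> j" for i j
    using svd_cinner[OF X, of i j] that by (simp add: f_def cinner_lin)
  then have "suborthonormal UNIV f" by (simp add: suborthonormal_def nf)
  moreover have "X (e n) = \<sigma> n *\<^sub>R f n" for n
    using svd_norm[OF X, of n] by (cases "\<sigma> n = 0") (auto simp: f_def)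
  ultimately show ?thesis using that nf by simp
qed

text \<open>
  The operator factors through \<open>X\<close>: first \<open>k n \<mapsto> e n\<close>, then \<open>X\<close>, then the left singular vector \<open>f n\<close> of
  \<open>X\<close> is sent to \<open>\<tau> n / \<sigma> n\<close> times \<open>g n\<close>.
\<close>

lemma ideal_series_op:
  fixes X :: "'a \<Rightarrow>\<^sub>L 'a"
  assumes I: "op_ideal I" and X: "X \<in> I" and svd: "svd X \<sigma> e"
    and g: "suborthonormal UNIV g" and k: "orthonormal UNIV k"
    and \<tau>: "\<And>n. \<bar>\<tau> n\<bar> \<le> c * \<sigma> n"
  shows "series_op \<tau> g k \<in> I"
proof -
  obtain f where f: "suborthonormal UNIV f" "\<And>n. X (e n) = \<sigma> n *\<^sub>R f n" "\<And>n. \<sigma> n \<noteq> 0 \<Longrightarrow> norm (f n) = 1"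
    using left_singular_system[OF svd] by blast
  note \<sigma>0 = svdD(5)[OF svd] and e = svdD(2)[OF svd]
  define a where "a = (\<lambda>n. \<tau> n / \<sigma> n)"
  have ba: "Bseq a"
  proof (rule BseqI'[where K = "\<bar>c\<bar>"])
    fix n
    have "\<bar>\<tau> n\<bar> \<le> \<bar>c\<bar> * \<sigma> n"
      using \<tau>[of n] mult_right_mono[OF abs_ge_self[of c] \<sigma>0[of n]] by linarith
    then show "norm (a n) \<le> \<bar>c\<bar>" using \<sigma>0[of n] by (cases "\<sigma> n = 0") (auto simp: a_def abs_divide divide_le_eq)
  qed
  have b1: "Bseq (\<lambda>n. 1 :: real)" by (intro BseqI'[where K = 1]) simp
  note sk = orthonormal_imp_suborthonormal[OF k] and se = orthonormal_imp_suborthonormal[OF e]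
  have b\<tau>: "Bseq \<tau>"
  proof -
    have "\<bar>\<tau> n\<bar> \<le> \<bar>c\<bar> * \<sigma> 0" for n
      using \<tau>[of n] mult_mono[OF abs_ge_self[of c] c0_star_ge[OF svdD(3)[OF svd], of 0 n]] \<sigma>0[of n] by linarith
    then show ?thesis by (intro BseqI'[where K = "\<bar>c\<bar> * \<sigma> 0"]) simp
  qed
  define A where "A = series_op a g f"
  define B where "B = series_op (\<lambda>n. 1) e k"
  have AB: "A \<in> BH" "B \<in> BH" unfolding A_def B_def by (intro series_op_BH f(1) g se sk ba b1)+
  have "series_op \<tau> g k = A o\<^sub>L X o\<^sub>L B"
  proof (rule op_eqI[OF k])
    show "series_op \<tau> g k \<in> BH" by (intro series_op_BH g sk b\<tau>)
    show "A o\<^sub>L X o\<^sub>L B \<in> BH" by (intro BH_compose AB op_idealD(1)[OF I X])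
    fix n
    have "A (f n) = (of_real (a n) * cinner (f n) (f n)) *\<^sub>C g n"
      unfolding A_def by (rule series_op_single[OF f(1) g ba]) (use f(1) in \<open>simp add: suborthonormal_def\<close>)
    then have "\<sigma> n *\<^sub>R A (f n) = \<tau> n *\<^sub>R g n"
      using f(3)[of n] \<tau>[of n] by (cases "\<sigma> n = 0") (auto simp: a_def cinner_self scaleC_of_real simp flip: of_real_divide)
    moreover have "(A o\<^sub>L X o\<^sub>L B) (k n) = \<sigma> n *\<^sub>R A (f n)"
      using series_op_orthonormal[OF k se b1, of n] by (simp add: B_def f(2) scaleC_one blinfun.scaleR_right)
    ultimately show "series_op \<tau> g k (k n) = (A o\<^sub>L X o\<^sub>L B) (k n)"
      using series_op_orthonormal[OF k g b\<tau>, of n] by (simp add: scaleC_of_real)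
  next
    fix x assume x: "\<And>n. cinner x (k n) = 0"
    show "series_op \<tau> g k x = (A o\<^sub>L X o\<^sub>L B) x"
      using series_op_perp[OF sk g b\<tau>, of x] series_op_perp[OF sk se b1, of x] x
      by (simp add: B_def blinfun.zero_right)
  qed
  then show ?thesis using I X AB by (simp add: op_idealD)
qed

text \<open>
  Splitting the indices of the singular values of \<open>Y\<close> into residue classes modulo \<open>m\<close> writes \<open>Y\<close> as a sum
  of \<open>m\<close> operators, each of which is termwise dominated by \<open>X\<close>.
\<close>

lemma ideal_dominated:
  fixes X Y :: "'a \<Rightarrow>\<^sub>L 'a"
  assumes I: "op_ideal I" and X: "X \<in> I" and svdX: "svd X \<sigma> e" and svdY: "svd Y \<tau> k"
    and m: "m > 0" and dom: "\<And>n. \<tau> n \<le> c * \<sigma> (n div m)"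
  shows "Y \<in> I"
proof -
  obtain g where g: "suborthonormal UNIV g" "\<And>n. Y (k n) = \<tau> n *\<^sub>R g n"
    using left_singular_system[OF svdY] by metis
  note k = svdD(2)[OF svdY]
  define p where "p = (\<lambda>r j. m * j + r)"
  have pinj: "inj (p r)" for r using m by (auto simp: p_def inj_on_def)
  define Z where "Z = (\<lambda>r. series_op (\<lambda>j. \<tau> (p r j)) (\<lambda>j. g (p r j)) (\<lambda>j. k (p r j)))"
  have gr: "suborthonormal UNIV (\<lambda>j. g (p r j))" for r
    by (rule suborthonormal_reindex[OF g(1) pinj]) simp
  have kr: "orthonormal UNIV (\<lambda>j. k (p r j))" for r
    by (rule orthonormal_reindex[OF k pinj]) simp
  note skr = orthonormal_imp_suborthonormal[OF kr]
  have b: "Bseq (\<lambda>j. \<tau> (p r j))" for r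
    using c0_star_Bseq[OF svdD(3)[OF svdY]] unfolding Bseq_def by blast
  have "Z r \<in> I" if "r < m" for r
    unfolding Z_def
  proof (rule ideal_series_op[OF I X svdX gr kr])
    fix n
    have "p r n div m = n" using that by (simp add: p_def)
    then show "\<bar>\<tau> (p r n)\<bar> \<le> c * \<sigma> n" using dom[of "p r n"] svdD(5)[OF svdY] by simp
  qed
  then have ZI: "(\<Sum>r<m. Z r) \<in> I" by (intro op_ideal_sum[OF I]) auto
  have "Y = (\<Sum>r<m. Z r)"
  proof (rule op_eqI[OF k])
    show "Y \<in> BH" by (rule svdD(1)[OF svdY])
    show "(\<Sum>r<m. Z r) \<in> BH" by (rule op_idealD(1)[OF I ZI])
    fix n
    have "Z r (k n) = (if r = n mod m then \<tau> n *\<^sub>R g n else 0)" if r: "r < m" for r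
    proof -
      have "Z r (k n) = (of_real (\<tau> (p r (n div m))) * cinner (k n) (k (p r (n div m)))) *\<^sub>C g (p r (n div m))"
        unfolding Z_def
      proof (rule series_op_single[OF skr gr b])
        fix j assume "j \<noteq> n div m"
        then have "p r j \<noteq> n" using r by (auto simp: p_def)
        then show "cinner (k n) (k (p r j)) = 0" using k by (simp add: orthonormal_def)
      qed
      moreover have "p r (n div m) = n \<longleftrightarrow> r = n mod m"
        unfolding p_def by (metis add_left_cancel mult_div_mod_eq)
      ultimately show ?thesis using k by (auto simp: orthonormal_def scaleC_of_real)
    qed
    then have "(\<Sum>r<m. Z r) (k n) = (\<Sum>r<m. if r = n mod m then \<tau> n *\<^sub>R g n else 0)"
      by (simp add: blinfun.sum_left)
    then show "Y (k n) = (\<Sum>r<m. Z r) (k n)" using m by (simp add: g(2))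
  next
    fix x assume x: "\<And>n. cinner x (k n) = 0"
    have "Z r x = 0" for r unfolding Z_def by (rule series_op_perp[OF skr gr b]) (rule x)
    then show "Y x = (\<Sum>r<m. Z r) x" using svd_perp[OF svdY x] by (simp add: blinfun.sum_left)
  qed
  then show ?thesis using ZI by simp
qed

end

subsection \<open>Characteristic sets\<close>

text \<open>
  The last condition combines solidity, closure under positive multiples, and invariance under the
  ampliations \<open>D\<^sub>m\<close>, which send \<open>\<xi>\<close> to \<open>\<lambda>n. \<xi> (n div m)\<close>.
\<close>

definition char_cone :: "(nat \<Rightarrow> real) set \<Rightarrow> bool"
  where "char_cone S \<longleftrightarrow> S \<subseteq> c0_star \<and> S \<noteq> {} \<and> (\<forall>\<xi>\<in>S. \<forall>\<zeta>\<in>S. (\<lambda>n. \<xi> n + \<zeta> n) \<in> S) \<and>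
    (\<forall>\<xi>\<in>S. \<forall>\<eta>\<in>c0_star. \<forall>m>0. \<forall>c. (\<forall>n. \<eta> n \<le> c * \<xi> (n div m)) \<longrightarrow> \<eta> \<in> S)"

lemma char_coneD:
  assumes "char_cone S"
  shows "\<And>\<xi>. \<xi> \<in> S \<Longrightarrow> \<xi> \<in> c0_star" "\<And>\<xi> \<zeta>. \<xi> \<in> S \<Longrightarrow> \<zeta> \<in> S \<Longrightarrow> (\<lambda>n. \<xi> n + \<zeta> n) \<in> S"
    "\<And>\<xi> \<eta> m c. \<xi> \<in> S \<Longrightarrow> \<eta> \<in> c0_star \<Longrightarrow> m > 0 \<Longrightarrow> (\<And>n. \<eta> n \<le> c * \<xi> (n div m)) \<Longrightarrow> \<eta> \<in> S"
  using assms unfolding char_cone_def by blast+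

lemma c0_star_add: "\<xi> \<in> c0_star \<Longrightarrow> \<zeta> \<in> c0_star \<Longrightarrow> (\<lambda>n. \<xi> n + \<zeta> n) \<in> c0_star"
  using tendsto_add[of \<xi> 0 sequentially \<zeta> 0] by (auto simp: c0_star_def decseq_def intro: add_mono)

lemma c0_star_zero: "(\<lambda>n. 0) \<in> c0_star"
  by (simp add: c0_star_def decseq_def)

lemma char_cone_zero: "char_cone S \<Longrightarrow> (\<lambda>n. 0) \<in> S"
proof -
  assume S: "char_cone S"
  then obtain \<xi> where "\<xi> \<in> S" unfolding char_cone_def by blast
  then show "(\<lambda>n. 0) \<in> S" using char_coneD(3)[OF S _ c0_star_zero, of \<xi> 1 0] by simp
qed

definition calkin_ideal :: "(nat \<Rightarrow> real) set \<Rightarrow> ('a::chilbert_space \<Rightarrow>\<^sub>L 'a) set"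
  where "calkin_ideal S = {X. \<exists>\<sigma>\<in>S. \<exists>e. svd X \<sigma> e}"

context hilbert_basis
begin

lemma char_setE:
  assumes I: "op_ideal (I :: ('a \<Rightarrow>\<^sub>L 'a) set)" and "\<xi> \<in> char_set I"
  obtains X e where "X \<in> I" "svd X \<xi> e"
proof -
  obtain X where X: "X \<in> I" "\<xi> = s_numbers X" using assms(2) by (auto simp: char_set_def)
  obtain \<sigma> e where "svd X \<sigma> e" using ideal_svd[OF I X(1)] .
  then show ?thesis using that X s_numbers_svd by metis
qed

lemma char_setI: "X \<in> I \<Longrightarrow> svd X \<xi> (e :: nat \<Rightarrow> 'a) \<Longrightarrow> \<xi> \<in> char_set I"
  unfolding char_set_def using s_numbers_svd by blast

lemma ideal_mem_iff:
  assumes I: "op_ideal (I :: ('a \<Rightarrow>\<^sub>L 'a) set)" and X: "svd X \<sigma> e"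
  shows "X \<in> I \<longleftrightarrow> \<sigma> \<in> char_set I"
proof
  assume "\<sigma> \<in> char_set I"
  then obtain Y k where "Y \<in> I" "svd Y \<sigma> k" using char_setE[OF I] by metis
  then show "X \<in> I" using ideal_dominated[OF I, of Y \<sigma> k X \<sigma> e 1 1] X by simp
qed (use X char_setI in blast)

text \<open>
  A sequence in \<open>c0_star\<close> belongs to the characteristic set exactly if its diagonal operator in a fixed
  basis belongs to the ideal. This reduces sums of sequences to sums of operators.
\<close>

lemma char_cone_char_set:
  assumes I: "op_ideal (I :: ('a \<Rightarrow>\<^sub>L 'a) set)"
  shows "char_cone (char_set I)"
  unfolding char_cone_def
proof (intro conjI ballI allI impI)
  show "char_set I \<subseteq> c0_star" using char_setE[OF I] svdD(3) by blast
  show "char_set I \<noteq> {}" using op_idealD(2)[OF I] by (auto simp: char_set_def)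
next
  fix \<xi> \<zeta> assume "\<xi> \<in> char_set I" "\<zeta> \<in> char_set I"
  then have c: "\<xi> \<in> c0_star" "\<zeta> \<in> c0_star" using char_setE[OF I] svdD(3) by blast+
  note sh = orthonormal_imp_suborthonormal[OF orthonormal_basis]
  let ?D = "\<lambda>\<xi>. series_op \<xi> h h"
  have "?D \<xi> \<in> I" "?D \<zeta> \<in> I"
    using ideal_mem_iff[OF I svd_diagonal[OF orthonormal_basis]] c \<open>\<xi> \<in> char_set I\<close> \<open>\<zeta> \<in> char_set I\<close> by blast+
  then have sI: "?D \<xi> + ?D \<zeta> \<in> I" by (rule op_idealD(3)[OF I])
  note b = c0_star_Bseq[OF c(1)] c0_star_Bseq[OF c(2)] c0_star_Bseq[OF c0_star_add[OF c]]
  have "?D (\<lambda>n. \<xi> n + \<zeta> n) = ?D \<xi> + ?D \<zeta>"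
  proof (rule op_eqI[OF orthonormal_basis])
    show "?D (\<lambda>n. \<xi> n + \<zeta> n) \<in> BH" "?D \<xi> + ?D \<zeta> \<in> BH"
      by (intro BH_add series_op_BH sh b)+
    show "?D (\<lambda>n. \<xi> n + \<zeta> n) (h n) = (?D \<xi> + ?D \<zeta>) (h n)" for n
      by (simp add: series_op_orthonormal[OF orthonormal_basis sh] b blinfun.add_left scaleC_add_left)
    show "?D (\<lambda>n. \<xi> n + \<zeta> n) x = (?D \<xi> + ?D \<zeta>) x" if "\<And>n. cinner x (h n) = 0" for x
      using complete_basis[OF that] by (simp add: blinfun.zero_right)
  qed
  then show "(\<lambda>n. \<xi> n + \<zeta> n) \<in> char_set I"
    using ideal_mem_iff[OF I svd_diagonal[OF orthonormal_basis c0_star_add[OF c]]] sI by simp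
next
  fix \<xi> \<eta> :: "nat \<Rightarrow> real" and m :: nat and c :: real
  assume a: "\<xi> \<in> char_set I" "\<eta> \<in> c0_star" "m > 0" "\<forall>n. \<eta> n \<le> c * \<xi> (n div m)"
  obtain X e where X: "X \<in> I" "svd X \<xi> e" using char_setE[OF I a(1)] .
  have d: "svd (series_op \<eta> h h) \<eta> h" by (rule svd_diagonal[OF orthonormal_basis a(2)])
  have "series_op \<eta> h h \<in> I"
    by (rule ideal_dominated[OF I X d a(3)]) (use a(4) in blast)
  then show "\<eta> \<in> char_set I" using d by (rule char_setI)
qed

lemma char_cone_svd_mem:
  assumes S: "char_cone S" and X: "svd X \<sigma> (e :: nat \<Rightarrow> 'a)" and \<xi>: "\<xi> \<in> S" and m: "m > 0"
    and g: "\<And>n. gelfand_bound X n (c * \<xi> (n div m))"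
  shows "X \<in> calkin_ideal S"
proof -
  have "\<sigma> \<in> S" by (rule char_coneD(3)[OF S \<xi> svdD(3)[OF X] m]) (rule svd_le_gelfand[OF X g])
  then show ?thesis using X unfolding calkin_ideal_def by blast
qed

lemma gelfand_bound_compactI:
  assumes "X \<in> BH" "\<xi> \<in> c0_star" "m > 0" "\<And>n. gelfand_bound X n (c * \<xi> (n div m))"
  shows "compact_op X"
  unfolding compact_op_def
proof (intro conjI assms allI impI)
  fix \<epsilon> :: real assume "\<epsilon> > 0"
  have "(\<lambda>n. c * \<xi> n) \<longlonglongrightarrow> 0" using assms(2) by (intro tendsto_mult_right_zero) (simp add: c0_star_def)
  then obtain n where n: "c * \<xi> n < \<epsilon>"
    using order_tendstoD(2)[of "\<lambda>n. c * \<xi> n" 0 sequentially \<epsilon>] \<open>\<epsilon> > 0\<close> by (meson eventually_sequentially order.refl)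
  have "gelfand_bound X (m * n) (c * \<xi> n)" using assms(4)[of "m * n"] assms(3) by simp
  then show "\<exists>n. gelfand_bound X n \<epsilon>" using gelfand_bound_mono n less_imp_le by blast
qed

lemma calkin_ideal_gelfandI:
  fixes X :: "'a \<Rightarrow>\<^sub>L 'a"
  assumes S: "char_cone S" and X: "X \<in> BH" and \<xi>: "\<xi> \<in> S" and m: "m > 0"
    and g: "\<And>n. gelfand_bound X n (c * \<xi> (n div m))"
  shows "X \<in> calkin_ideal S"
proof -
  obtain \<sigma> e where "svd X \<sigma> e"
    using svd_exists[OF gelfand_bound_compactI[OF X char_coneD(1)[OF S \<xi>] m g]] by blast
  then show ?thesis by (rule char_cone_svd_mem[OF S _ \<xi> m g])
qed

text \<open>
  Gelfand bounds of sums and products: complements of finite sets are intersected, or pulled back by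
  the adjoint of the right factor. The sum of two operators needs twice as many vectors, which the
  ampliation by \<open>2\<close> allows for.
\<close>

lemma op_ideal_calkin_ideal:
  assumes S: "char_cone S"
  shows "op_ideal (calkin_ideal S :: ('a \<Rightarrow>\<^sub>L 'a) set)"
proof -
  have g0: "gelfand_bound (0 :: 'a \<Rightarrow>\<^sub>L 'a) n 0" for n
    unfolding gelfand_bound_def by (intro exI[of _ "{}"]) simp
  have zero: "0 \<in> (calkin_ideal S :: ('a \<Rightarrow>\<^sub>L 'a) set)"
    by (rule calkin_ideal_gelfandI[OF S BH_zero char_cone_zero[OF S], of 1 1]) (simp_all add: g0)
  have sub: "calkin_ideal S \<subseteq> (BH :: ('a \<Rightarrow>\<^sub>L 'a) set)" by (auto simp: calkin_ideal_def svd_def)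
  have "id_blinfun \<notin> (calkin_ideal S :: ('a \<Rightarrow>\<^sub>L 'a) set)"
  proof
    assume "id_blinfun \<in> (calkin_ideal S :: ('a \<Rightarrow>\<^sub>L 'a) set)"
    then obtain \<sigma> and e :: "nat \<Rightarrow> 'a" where X: "svd id_blinfun \<sigma> e" unfolding calkin_ideal_def by blast
    have "\<sigma> n = 1" for n using svd_norm[OF X, of n] orthonormal_norm[OF svdD(2)[OF X], of n] by simp
    then have "\<sigma> = (\<lambda>n. 1)" by (rule ext)
    then show False using svdD(6)[OF X] LIMSEQ_const_iff[of "1 :: real" 0] by simp
  qed
  then have proper: "calkin_ideal S \<subset> (BH :: ('a \<Rightarrow>\<^sub>L 'a) set)" using sub BH_id by blast
  have add: "X + Y \<in> calkin_ideal S" if "X \<in> calkin_ideal S" "Y \<in> calkin_ideal S" for X Y :: "'a \<Rightarrow>\<^sub>L 'a"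
  proof -
    obtain \<sigma> e \<tau> k where s: "\<sigma> \<in> S" "svd X \<sigma> e" "\<tau> \<in> S" "svd Y \<tau> k"
      using \<open>X \<in> calkin_ideal S\<close> \<open>Y \<in> calkin_ideal S\<close> unfolding calkin_ideal_def by blast
    have "gelfand_bound (X + Y) n (1 * (\<lambda>n. \<sigma> n + \<tau> n) (n div 2))" for n
    proof -
      obtain A where A: "finite A" "card A \<le> n div 2" "\<And>x. (\<forall>s\<in>A. cinner x s = 0) \<Longrightarrow> norm (X x) \<le> \<sigma> (n div 2) * norm x"
        using svd_gelfand_bound[OF s(2), of "n div 2"] unfolding gelfand_bound_def by blast
      obtain B where B: "finite B" "card B \<le> n div 2" "\<And>x. (\<forall>s\<in>B. cinner x s = 0) \<Longrightarrow> norm (Y x) \<le> \<tau> (n div 2) * norm x"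
        using svd_gelfand_bound[OF s(4), of "n div 2"] unfolding gelfand_bound_def by blast
      have "card (A \<union> B) \<le> n" using card_Un_le[of A B] A(2) B(2) by linarith
      moreover have "norm ((X + Y) x) \<le> (1 * (\<lambda>n. \<sigma> n + \<tau> n) (n div 2)) * norm x"
        if "\<forall>s\<in>A \<union> B. cinner x s = 0" for x
        using A(3)[of x] B(3)[of x] that norm_triangle_ineq[of "X x" "Y x"]
        by (simp add: blinfun.add_left distrib_right)
      ultimately show ?thesis unfolding gelfand_bound_def using A(1) B(1) by blast
    qed
    moreover have "X + Y \<in> BH" by (rule BH_add[OF svdD(1)[OF s(2)] svdD(1)[OF s(4)]])
    ultimately show ?thesis
      by (intro calkin_ideal_gelfandI[OF S _ char_coneD(2)[OF S s(1,3)], of _ 2 1]) auto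
  qed
  have mult: "T o\<^sub>L X \<in> calkin_ideal S \<and> X o\<^sub>L T \<in> calkin_ideal S"
    if "X \<in> calkin_ideal S" "T \<in> BH" for X T :: "'a \<Rightarrow>\<^sub>L 'a"
  proof -
    obtain \<sigma> e where s: "\<sigma> \<in> S" "svd X \<sigma> e"
      using \<open>X \<in> calkin_ideal S\<close> unfolding calkin_ideal_def by blast
    have A: "\<exists>A. finite A \<and> card A \<le> n \<and> (\<forall>x. (\<forall>s\<in>A. cinner x s = 0) \<longrightarrow> norm (X x) \<le> \<sigma> n * norm x)" for n
      using svd_gelfand_bound[OF s(2), of n] unfolding gelfand_bound_def by blast
    have "gelfand_bound (T o\<^sub>L X) n (norm T * \<sigma> (n div 1))" for n
    proof -
      obtain A where A: "finite A" "card A \<le> n" "\<And>x. (\<forall>s\<in>A. cinner x s = 0) \<Longrightarrow> norm (X x) \<le> \<sigma> n * norm x"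
        using A by blast
      have "norm ((T o\<^sub>L X) x) \<le> norm T * \<sigma> (n div 1) * norm x" if "\<forall>s\<in>A. cinner x s = 0" for x
        using norm_blinfun[of T "X x"] mult_left_mono[OF A(3)[OF that] norm_ge_zero[of T]] by (simp add: mult.assoc)
      then show ?thesis unfolding gelfand_bound_def using A(1,2) by blast
    qed
    then have 1: "T o\<^sub>L X \<in> calkin_ideal S"
      by (intro calkin_ideal_gelfandI[OF S BH_compose[OF that(2) svdD(1)[OF s(2)]] s(1), of 1]) auto
    have "gelfand_bound (X o\<^sub>L T) n (norm T * \<sigma> (n div 1))" for n
    proof -
      obtain A where A: "finite A" "card A \<le> n" "\<And>x. (\<forall>s\<in>A. cinner x s = 0) \<Longrightarrow> norm (X x) \<le> \<sigma> n * norm x"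
        using A by blast
      have "norm ((X o\<^sub>L T) x) \<le> norm T * \<sigma> (n div 1) * norm x" if "\<forall>s\<in>adj T ` A. cinner x s = 0" for x
      proof -
        have "norm (X (T x)) \<le> \<sigma> n * norm (T x)"
          by (rule A(3)) (use that cinner_adj_right[OF \<open>T \<in> BH\<close>] in auto)
        also have "\<dots> \<le> \<sigma> n * (norm T * norm x)"
          by (rule mult_left_mono[OF norm_blinfun svdD(5)[OF s(2)]])
        finally show ?thesis by (simp add: mult_ac)
      qed
      moreover have "card (adj T ` A) \<le> n" using card_image_le[OF A(1)] A(2) by (rule order.trans)
      ultimately show ?thesis unfolding gelfand_bound_def using A(1) by blast
    qed
    then have "X o\<^sub>L T \<in> calkin_ideal S"
      by (intro calkin_ideal_gelfandI[OF S BH_compose[OF svdD(1)[OF s(2)] that(2)] s(1), of 1]) auto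
    then show ?thesis using 1 by blast
  qed
  show ?thesis unfolding op_ideal_def using proper zero add mult by blast
qed

lemma char_set_calkin_ideal:
  assumes S: "char_cone S"
  shows "char_set (calkin_ideal S :: ('a \<Rightarrow>\<^sub>L 'a) set) = S"
proof
  show "char_set (calkin_ideal S :: ('a \<Rightarrow>\<^sub>L 'a) set) \<subseteq> S"
    using s_numbers_svd by (auto simp: char_set_def calkin_ideal_def)
  show "S \<subseteq> char_set (calkin_ideal S :: ('a \<Rightarrow>\<^sub>L 'a) set)"
  proof
    fix \<xi> assume \<xi>: "\<xi> \<in> S"
    have d: "svd (series_op \<xi> h h) \<xi> h"
      by (rule svd_diagonal[OF orthonormal_basis char_coneD(1)[OF S \<xi>]])
    then have "series_op \<xi> h h \<in> calkin_ideal S" using \<xi> unfolding calkin_ideal_def by blast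
    then show "\<xi> \<in> char_set (calkin_ideal S :: ('a \<Rightarrow>\<^sub>L 'a) set)" using d by (rule char_setI)
  qed
qed

text \<open>
  The uniqueness part of Calkin's correspondence: by domination in both directions, membership in an
  ideal depends only on the singular values.
\<close>

lemma ideal_of_char_set_eq:
  assumes S: "char_cone S"
  shows "ideal_of_char_set S = (calkin_ideal S :: ('a \<Rightarrow>\<^sub>L 'a) set)"
  unfolding ideal_of_char_set_def
proof (rule the_equality)
  show "op_ideal (calkin_ideal S :: ('a \<Rightarrow>\<^sub>L 'a) set) \<and> char_set (calkin_ideal S :: ('a \<Rightarrow>\<^sub>L 'a) set) = S"
    using op_ideal_calkin_ideal[OF S] char_set_calkin_ideal[OF S] by blast
  fix J :: "('a \<Rightarrow>\<^sub>L 'a) set" assume J: "op_ideal J \<and> char_set J = S"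
  have "X \<in> J \<longleftrightarrow> X \<in> calkin_ideal S" for X
  proof
    assume X: "X \<in> J"
    then obtain \<sigma> e where "svd X \<sigma> e" using ideal_svd J by blast
    then show "X \<in> calkin_ideal S" using J X char_setI unfolding calkin_ideal_def by blast
  next
    assume "X \<in> calkin_ideal S"
    then show "X \<in> J" using ideal_mem_iff J unfolding calkin_ideal_def by blast
  qed
  then show "J = calkin_ideal S" by blast
qed

end

subsection \<open>Characteristic sets of arithmetic means\<close>

lemma c0_star_dominated:
  assumes "decseq \<beta>" "\<And>n. 0 \<le> \<beta> n" "\<alpha> \<in> c0_star" "m > 0" "\<And>n. \<beta> n \<le> c * \<alpha> (n div m)"
  shows "\<beta> \<in> c0_star"
proof -
  have "(\<lambda>n. c * \<alpha> n) \<longlonglongrightarrow> 0" using assms(3) by (intro tendsto_mult_right_zero) (simp add: c0_star_def)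
  moreover have "filterlim (\<lambda>n. n div m) at_top sequentially"
    unfolding filterlim_at_top eventually_sequentially using assms(4)
    by (metis div_le_mono nonzero_mult_div_cancel_left less_numeral_extra(3))
  ultimately have lim: "(\<lambda>n. c * \<alpha> (n div m)) \<longlonglongrightarrow> 0" by (rule filterlim_compose)
  have "\<beta> \<longlonglongrightarrow> 0"
    by (rule tendsto_sandwich[OF _ _ tendsto_const lim]) (use assms in auto)
  then show ?thesis using assms by (simp add: c0_star_def)
qed

lemma char_cone_dominated:
  assumes S: "char_cone S" and \<alpha>: "\<alpha> \<in> S" and "decseq \<beta>" "\<And>n. 0 \<le> \<beta> n" "m > 0" "\<And>n. \<beta> n \<le> c * \<alpha> (n div m)"
  shows "\<beta> \<in> S"
  by (rule char_coneD(3)[OF S \<alpha> c0_star_dominated[OF assms(3,4) char_coneD(1)[OF S \<alpha>] assms(5,6)] assms(5,6)])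

text \<open>
  Finitely many exceptional indices are mapped to \<open>0\<close> by an ampliation, and are then controlled by a
  sequence with a positive first entry.
\<close>

lemma char_cone_eventually_dominated:
  assumes S: "char_cone S" and pos: "\<zeta> \<in> S" "0 < \<zeta> 0" and \<xi>: "\<xi> \<in> S"
    and \<eta>: "decseq \<eta>" "\<And>n. 0 \<le> \<eta> n" and m: "m > 0"
    and le: "\<And>n. n \<ge> N \<Longrightarrow> \<eta> n \<le> c * \<xi> (n div m)"
  shows "\<eta> \<in> S"
proof -
  note c\<xi> = char_coneD(1)[OF S \<xi>] and c\<zeta> = char_coneD(1)[OF S pos(1)]
  define \<alpha> where "\<alpha> = (\<lambda>n. \<xi> n + \<zeta> n)"
  have \<alpha>: "\<alpha> \<in> S" unfolding \<alpha>_def by (rule char_coneD(2)[OF S \<xi> pos(1)])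
  define M where "M = max m N"
  define C where "C = max \<bar>c\<bar> (\<eta> 0 / \<alpha> 0)"
  have \<alpha>0: "\<alpha> 0 > 0" using pos(2) c0_star_nonneg[OF c\<xi>, of 0] by (simp add: \<alpha>_def)
  have "\<eta> n \<le> C * \<alpha> (n div M)" for n
  proof (cases "n < M")
    case True
    have "\<eta> n \<le> \<eta> 0" using \<eta>(1) by (simp add: decseq_def)
    also have "\<dots> = (\<eta> 0 / \<alpha> 0) * \<alpha> 0" using \<alpha>0 by simp
    also have "\<dots> \<le> C * \<alpha> 0" using \<alpha>0 by (intro mult_right_mono) (auto simp: C_def)
    finally show ?thesis using True by simp
  next
    case False
    have "\<eta> n \<le> c * \<xi> (n div m)" using False by (intro le) (simp add: M_def)
    also have "\<dots> \<le> C * \<alpha> (n div M)"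
    proof (rule mult_mono)
    show "c \<le> C" by (simp add: C_def)
    have "\<xi> (n div m) \<le> \<xi> (n div M)"
      using m by (intro c0_star_ge[OF c\<xi>] div_le_mono2) (auto simp: M_def)
    then show "\<xi> (n div m) \<le> \<alpha> (n div M)" using c0_star_nonneg[OF c\<zeta>, of "n div M"] by (simp add: \<alpha>_def)
    show "0 \<le> \<xi> (n div m)" by (rule c0_star_nonneg[OF c\<xi>])
    show "0 \<le> C" by (simp add: C_def le_max_iff_disj)
    qed
    finally show ?thesis .
  qed
  then show ?thesis using m by (intro char_cone_dominated[OF S \<alpha> \<eta>, of M C]) (auto simp: M_def)
qed

lemma sum_div_blocks: "(\<Sum>j<m * k. f (j div m)) = real m * (\<Sum>i<k. f i)" if "m > 0" for f :: "nat \<Rightarrow> real"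
proof (induction k)
  case (Suc k)
  have "(\<Sum>j<m * Suc k. f (j div m)) = (\<Sum>j<m * k. f (j div m)) + (\<Sum>j\<in>{m * k..<m * k + m}. f (j div m))"
    by (subst sum.union_disjoint[symmetric]) (auto intro: sum.cong)
  also have "(\<Sum>j\<in>{m * k..<m * k + m}. f (j div m)) = (\<Sum>j\<in>{m * k..<m * k + m}. f k)"
  proof (rule sum.cong)
    fix j assume "j \<in> {m * k..<m * k + m}"
    then have "j div m = k" using that by (intro div_nat_eqI) (auto simp: mult.commute)
    then show "f (j div m) = f k" by simp
  qed simp
  finally show ?case using Suc by (simp add: distrib_left)
qed simp

lemma decseq_arith_mean:
  assumes "decseq \<xi>" "\<And>n. 0 \<le> \<xi> n"
  shows "decseq (arith_mean \<xi>)"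
proof (rule decseq_SucI)
  fix n
  have "real (Suc n) * \<xi> (Suc n) = (\<Sum>j\<le>n. \<xi> (Suc n))" by simp
  also have "\<dots> \<le> (\<Sum>j\<le>n. \<xi> j)" using assms(1) by (intro sum_mono) (simp add: decseq_def)
  finally show "arith_mean \<xi> (Suc n) \<le> arith_mean \<xi> n"
    by (simp add: arith_mean_def divide_simps) (simp add: algebra_simps)
qed

lemma arith_mean_nonneg: "(\<And>n. 0 \<le> \<xi> n) \<Longrightarrow> 0 \<le> arith_mean \<xi> n"
  by (simp add: arith_mean_def sum_nonneg)

lemma arith_mean_dominated:
  assumes \<xi>: "\<And>n. 0 \<le> \<xi> n" and m: "m > 0" and le: "\<And>n. \<eta> n \<le> c * \<xi> (n div m)"
  shows "arith_mean \<eta> n \<le> (\<bar>c\<bar> * real m) * arith_mean \<xi> (n div m)"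
proof -
  define k where "k = Suc (n div m)"
  have k: "n < m * k" unfolding k_def by (rule dividend_less_times_div[OF m, of n, THEN order.strict_trans2]) simp
  have "(\<Sum>j\<le>n. \<eta> j) \<le> (\<Sum>j\<le>n. \<bar>c\<bar> * \<xi> (j div m))"
    by (intro sum_mono order.trans[OF le] mult_right_mono \<xi>) simp
  also have "\<dots> \<le> (\<Sum>j<m * k. \<bar>c\<bar> * \<xi> (j div m))"
    using k \<xi> by (intro sum_mono2) auto
  also have "\<dots> = \<bar>c\<bar> * real m * (\<Sum>i<k. \<xi> i)"
    by (simp add: sum_div_blocks[OF m] mult.assoc flip: sum_distrib_left)
  also have "(\<Sum>i<k. \<xi> i) = real k * arith_mean \<xi> (n div m)"
    by (simp add: k_def arith_mean_def lessThan_Suc_atMost)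
  also have "\<dots> \<le> real (Suc n) * arith_mean \<xi> (n div m)"
    by (intro mult_right_mono arith_mean_nonneg \<xi>) (simp add: k_def)
  finally have "(\<Sum>j\<le>n. \<eta> j) \<le> \<bar>c\<bar> * real m * (real (Suc n) * arith_mean \<xi> (n div m))"
    by (simp add: mult_left_mono)
  then show ?thesis by (simp add: arith_mean_def[of \<eta>] divide_le_eq mult_ac)
qed

lemma char_cone_pre_am:
  assumes S: "char_cone S"
  shows "char_cone {\<xi> \<in> c0_star. arith_mean \<xi> \<in> S}"
  unfolding char_cone_def
proof (intro conjI ballI allI impI)
  have "(\<lambda>n. 0) \<in> {\<xi> \<in> c0_star. arith_mean \<xi> \<in> S}"
    using char_cone_zero[OF S] c0_star_zero by (simp add: arith_mean_def[abs_def])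
  then show "{\<xi> \<in> c0_star. arith_mean \<xi> \<in> S} \<noteq> {}" by blast
next
  fix \<xi> \<zeta> assume "\<xi> \<in> {\<xi> \<in> c0_star. arith_mean \<xi> \<in> S}" "\<zeta> \<in> {\<xi> \<in> c0_star. arith_mean \<xi> \<in> S}"
  moreover have "arith_mean (\<lambda>n. \<xi> n + \<zeta> n) = (\<lambda>n. arith_mean \<xi> n + arith_mean \<zeta> n)"
    by (simp add: arith_mean_def fun_eq_iff sum.distrib add_divide_distrib)
  ultimately show "(\<lambda>n. \<xi> n + \<zeta> n) \<in> {\<xi> \<in> c0_star. arith_mean \<xi> \<in> S}"
    using char_coneD(2)[OF S] c0_star_add by simp
next
  fix \<xi> \<eta> :: "nat \<Rightarrow> real" and m :: nat and c :: real
  assume a: "\<xi> \<in> {\<xi> \<in> c0_star. arith_mean \<xi> \<in> S}" "\<eta> \<in> c0_star" "m > 0" "\<forall>n. \<eta> n \<le> c * \<xi> (n div m)"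
  have "arith_mean \<eta> \<in> S"
  proof (rule char_cone_dominated[OF S _ _ _ a(3)])
    show "arith_mean \<xi> \<in> S" using a(1) by simp
    show "decseq (arith_mean \<eta>)" using a(2) by (intro decseq_arith_mean) (auto simp: c0_star_def)
    show "0 \<le> arith_mean \<eta> n" for n using a(2) by (intro arith_mean_nonneg) (auto simp: c0_star_def)
    show "arith_mean \<eta> n \<le> (\<bar>c\<bar> * real m) * arith_mean \<xi> (n div m)" for n
      by (rule arith_mean_dominated) (use a in \<open>auto simp: c0_star_def\<close>)
  qed
  then show "\<eta> \<in> {\<xi> \<in> c0_star. arith_mean \<xi> \<in> S}" using a(2) by simp
qed auto

lemma ampliated_sum:
  assumes \<xi>: "\<And>n. 0 \<le> \<xi> n" "summable \<xi>" and m: "m > 0"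
    and \<eta>: "\<And>n. 0 \<le> \<eta> n" "\<And>n. \<eta> n \<le> c * \<xi> (n div m)"
  shows "summable \<eta>" and "suminf \<eta> \<le> \<bar>c\<bar> * real m * suminf \<xi>"
proof -
  have b: "(\<Sum>j<N. \<eta> j) \<le> \<bar>c\<bar> * real m * suminf \<xi>" for N
  proof -
    have "(\<Sum>j<N. \<eta> j) \<le> (\<Sum>j<N. \<bar>c\<bar> * \<xi> (j div m))"
      by (intro sum_mono order.trans[OF \<eta>(2)] mult_right_mono \<xi>) simp
    also have "\<dots> \<le> (\<Sum>j<m * N. \<bar>c\<bar> * \<xi> (j div m))"
      using m \<xi> by (intro sum_mono2) (auto intro: order.strict_trans2)
    also have "\<dots> = \<bar>c\<bar> * real m * (\<Sum>i<N. \<xi> i)"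
      by (simp add: sum_div_blocks[OF m] mult.assoc flip: sum_distrib_left)
    also have "\<dots> \<le> \<bar>c\<bar> * real m * suminf \<xi>"
      by (intro mult_left_mono sum_le_suminf \<xi>) (auto simp: \<xi>)
    finally show ?thesis .
  qed
  show s: "summable \<eta>" by (rule summableI_nonneg_bounded[OF \<eta>(1) b])
  show "suminf \<eta> \<le> \<bar>c\<bar> * real m * suminf \<xi>" by (rule suminf_le_const[OF s b])
qed

lemma suminf_shift_le:
  assumes "\<And>n. 0 \<le> \<xi> n" "summable (\<xi> :: nat \<Rightarrow> real)" "k \<le> l"
  shows "(\<Sum>j. \<xi> (j + l)) \<le> (\<Sum>j. \<xi> (j + k))"
proof -
  have "(\<Sum>j<k. \<xi> j) \<le> (\<Sum>j<l. \<xi> j)" using assms by (intro sum_mono2) auto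
  then show ?thesis
    using suminf_split_initial_segment[OF assms(2), of k] suminf_split_initial_segment[OF assms(2), of l] by simp
qed

lemma suminf_shift_nonneg: "(\<And>n. 0 \<le> \<xi> n) \<Longrightarrow> summable (\<xi> :: nat \<Rightarrow> real) \<Longrightarrow> 0 \<le> (\<Sum>j. \<xi> (j + k))"
  by (intro suminf_nonneg) (simp_all add: summable_iff_shift)

lemma arith_mean_inf_nonneg: "(\<And>n. 0 \<le> \<xi> n) \<Longrightarrow> summable \<xi> \<Longrightarrow> 0 \<le> arith_mean_inf \<xi> n"
  unfolding arith_mean_inf_def by (intro divide_nonneg_nonneg suminf_shift_nonneg) auto

lemma decseq_arith_mean_inf:
  assumes "\<And>n. 0 \<le> \<xi> n" "summable \<xi>"
  shows "decseq (arith_mean_inf \<xi>)"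
  unfolding arith_mean_inf_def
  by (intro decseq_SucI frac_le suminf_shift_nonneg suminf_shift_le assms) auto

text \<open>
  Let \<open>k = (n + 1) div m\<close>. The tail of \<open>\<eta>\<close> from \<open>n + 1\<close> is bounded by a multiple of the tail of \<open>\<xi>\<close> from \<open>k\<close>,
  which is the one in the entry \<open>k - 1\<close> of the mean; halving absorbs the shift by one, as
  \<open>n div (2 m) \<le> k - 1\<close>.
\<close>

lemma arith_mean_inf_dominated:
  assumes \<xi>: "\<xi> \<in> l1_star" and m: "m > 0" and \<eta>: "\<And>n. 0 \<le> \<eta> n" and le: "\<And>n. \<eta> n \<le> c * \<xi> (n div m)"
    and n: "m \<le> Suc n"
  shows "arith_mean_inf \<eta> n \<le> (\<bar>c\<bar> * real m) * arith_mean_inf \<xi> (n div (2 * m))"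
proof -
  have \<xi>': "\<And>n. 0 \<le> \<xi> n" "summable \<xi>" using \<xi> by (auto simp: l1_star_def c0_star_def)
  have s\<eta>: "summable \<eta>" by (rule ampliated_sum(1)[OF \<xi>' m \<eta> le])
  define k where "k = Suc n div m"
  have k: "k \<ge> 1" "m * k \<le> Suc n" "k \<le> Suc n" "n div (2 * m) \<le> k - 1"
  proof -
    show "k \<ge> 1" "m * k \<le> Suc n" "k \<le> Suc n" using n m by (auto simp: k_def Suc_le_eq div_greater_zero_iff)
    have "n div (2 * m) = (n div m) div 2" by (simp add: div_mult2_eq[symmetric] mult.commute)
    moreover have "n div m \<le> k" unfolding k_def by (intro div_le_mono) simp
    ultimately show "n div (2 * m) \<le> k - 1" using \<open>k \<ge> 1\<close> by linarith
  qed
  have "(\<Sum>j. \<eta> (j + Suc n)) \<le> (\<Sum>j. \<eta> (j + m * k))"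
    by (rule suminf_shift_le[OF \<eta> s\<eta> k(2)])
  also have "\<dots> \<le> \<bar>c\<bar> * real m * (\<Sum>j. \<xi> (j + k))"
  proof (rule ampliated_sum(2)[OF _ _ m])
    show "\<eta> (j + m * k) \<le> c * \<xi> (j div m + k)" for j using le[of "j + m * k"] m by (simp add: add.commute)
  qed (use \<xi>' \<eta> in \<open>auto simp: summable_iff_shift\<close>)
  also have "(\<Sum>j. \<xi> (j + k)) = real k * arith_mean_inf \<xi> (k - 1)"
    using k(1) by (simp add: arith_mean_inf_def)
  also have "\<dots> \<le> real (Suc n) * arith_mean_inf \<xi> (n div (2 * m))"
    using k decseq_arith_mean_inf[OF \<xi>'] arith_mean_inf_nonneg[OF \<xi>']
    by (intro mult_mono) (auto simp: decseq_def)
  finally have "(\<Sum>j. \<eta> (j + Suc n)) \<le> \<bar>c\<bar> * real m * (real (Suc n) * arith_mean_inf \<xi> (n div (2 * m)))"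
    by (simp add: mult_left_mono)
  then show ?thesis by (simp add: arith_mean_inf_def[of \<eta>] divide_le_eq mult_ac)
qed

lemma char_cone_pre_am_inf:
  assumes S: "char_cone S" and pos: "\<zeta>0 \<in> S" "0 < \<zeta>0 0"
  shows "char_cone {\<xi> \<in> l1_star. arith_mean_inf \<xi> \<in> S}"
  unfolding char_cone_def
proof (intro conjI ballI allI impI)
  have "(\<lambda>n. 0) \<in> {\<xi> \<in> l1_star. arith_mean_inf \<xi> \<in> S}"
    using char_cone_zero[OF S] c0_star_zero by (simp add: arith_mean_inf_def[abs_def] l1_star_def)
  then show "{\<xi> \<in> l1_star. arith_mean_inf \<xi> \<in> S} \<noteq> {}" by blast
next
  fix \<xi> \<zeta> assume a: "\<xi> \<in> {\<xi> \<in> l1_star. arith_mean_inf \<xi> \<in> S}" "\<zeta> \<in> {\<xi> \<in> l1_star. arith_mean_inf \<xi> \<in> S}"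
  then have "arith_mean_inf (\<lambda>n. \<xi> n + \<zeta> n) = (\<lambda>n. arith_mean_inf \<xi> n + arith_mean_inf \<zeta> n)"
    unfolding arith_mean_inf_def fun_eq_iff add_divide_distrib[symmetric]
    by (subst suminf_add) (auto simp: l1_star_def simp del: add_Suc_right intro!: summable_ignore_initial_segment)
  then show "(\<lambda>n. \<xi> n + \<zeta> n) \<in> {\<xi> \<in> l1_star. arith_mean_inf \<xi> \<in> S}"
    using a char_coneD(2)[OF S] c0_star_add by (simp add: l1_star_def summable_add)
next
  fix \<xi> \<eta> :: "nat \<Rightarrow> real" and m :: nat and c :: real
  assume a: "\<xi> \<in> {\<xi> \<in> l1_star. arith_mean_inf \<xi> \<in> S}" "\<eta> \<in> c0_star" "m > 0" "\<forall>n. \<eta> n \<le> c * \<xi> (n div m)"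
  have \<xi>: "\<And>n. 0 \<le> \<xi> n" "summable \<xi>" using a(1) by (auto simp: l1_star_def c0_star_def)
  have \<eta>: "\<And>n. 0 \<le> \<eta> n" using a(2) by (auto simp: c0_star_def)
  have s: "summable \<eta>" by (rule ampliated_sum(1)[OF \<xi> a(3) \<eta>]) (use a(4) in blast)
  have "arith_mean_inf \<eta> \<in> S"
  proof (rule char_cone_eventually_dominated[OF S pos, of "arith_mean_inf \<xi>"])
    show "arith_mean_inf \<xi> \<in> S" using a(1) by simp
    show "decseq (arith_mean_inf \<eta>)" by (rule decseq_arith_mean_inf[OF \<eta> s])
    show "0 \<le> arith_mean_inf \<eta> n" for n by (rule arith_mean_inf_nonneg[OF \<eta> s])
    show "arith_mean_inf \<eta> n \<le> (\<bar>c\<bar> * real m) * arith_mean_inf \<xi> (n div (2 * m))" if "n \<ge> m" for n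
      by (rule arith_mean_inf_dominated[OF _ a(3) \<eta>]) (use a that in auto)
  qed (use a(3) in simp)
  then show "\<eta> \<in> {\<xi> \<in> l1_star. arith_mean_inf \<xi> \<in> S}" using a(2) s by (simp add: l1_star_def)
qed (auto simp: l1_star_def)

lemma (in hilbert_basis) nonzero_ideal_char_set:
  assumes I: "op_ideal (I :: ('a \<Rightarrow>\<^sub>L 'a) set)" and "I \<noteq> {0}"
  obtains \<zeta> where "\<zeta> \<in> char_set I" "0 < \<zeta> 0"
proof -
  obtain X where X: "X \<in> I" "X \<noteq> 0" using assms op_idealD(2)[OF I] by blast
  obtain \<sigma> e where s: "svd X \<sigma> e" using ideal_svd[OF I X(1)] .
  have "\<sigma> 0 \<noteq> 0"
  proof
    assume "\<sigma> 0 = 0"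
    then have "X x = 0" for x using svdD(8)[OF s, of 0 x] by simp
    then have "X = 0" by (intro blinfun_eqI) simp
    then show False using X(2) by simp
  qed
  then show ?thesis using that char_setI[OF X(1) s] svdD(5)[OF s, of 0] by force
qed

section \<open>Traces over finite-dimensional subspaces\<close>

text \<open>
  \<open>Q\<close> is an orthonormal basis of a finite-dimensional subspace that contains \<open>A\<close>.
\<close>

definition frame :: "'a::chilbert_space set \<Rightarrow> 'a set \<Rightarrow> bool"
  where "frame Q A \<longleftrightarrow> finite Q \<and> orthonormal Q (\<lambda>q. q) \<and> (\<forall>a\<in>A. a = (\<Sum>q\<in>Q. cinner a q *\<^sub>C q))"

lemma frame_subset: "frame Q A \<Longrightarrow> B \<subseteq> A \<Longrightarrow> frame Q B"
  unfolding frame_def by blast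

lemma frame_exists: "finite A \<Longrightarrow> \<exists>Q. frame Q A \<and> card Q \<le> card A"
  using gram_schmidt[of A] unfolding frame_def by blast

definition trace_on :: "'a::chilbert_space set \<Rightarrow> ('a \<Rightarrow>\<^sub>L 'a) \<Rightarrow> complex"
  where "trace_on Q T = (\<Sum>q\<in>Q. cinner (blinfun_apply T q) q)"

lemma trace_on_add: "trace_on Q (S + T) = trace_on Q S + trace_on Q T"
  by (simp add: trace_on_def blinfun.add_left cinner_lin sum.distrib)

lemma trace_on_scaleC: "trace_on Q (c *\<^sub>C T) = c * trace_on Q T"
  by (simp add: trace_on_def blinfun_apply_scaleC cinner_lin sum_distrib_left)

lemma frame_trace_left:
  assumes Q: "frame Q {f}" and Y: "Y \<in> BH"
  shows "(\<Sum>q\<in>Q. cinner (blinfun_apply Y q) e * cinner f q) = cinner (Y f) e"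
proof -
  have "f = (\<Sum>q\<in>Q. cinner f q *\<^sub>C q)" using Q by (simp add: frame_def)
  then have "cinner (Y f) e = cinner (Y (\<Sum>q\<in>Q. cinner f q *\<^sub>C q)) e" by simp
  then show ?thesis
    by (simp add: blinfun.sum_right BH_scaleC[OF Y] cinner_sum_left cinner_lin mult.commute)
qed

lemma frame_trace_right:
  assumes Q: "frame Q {e}"
  shows "(\<Sum>q\<in>Q. cinner q e * cinner y q) = cinner y e"
proof -
  have "e = (\<Sum>q\<in>Q. cinner e q *\<^sub>C q)" using Q by (simp add: frame_def)
  then have "cinner y e = cinner y (\<Sum>q\<in>Q. cinner e q *\<^sub>C q)" by simp
  also have "\<dots> = (\<Sum>q\<in>Q. cnj (cinner e q) * cinner y q)" by (simp add: cinner_sum_right cinner_lin)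
  also have "\<dots> = (\<Sum>q\<in>Q. cinner q e * cinner y q)" by (simp flip: cinner_commute)
  finally show ?thesis by simp
qed

context hilbert_basis
begin

text \<open>
  On the vectors \<open>e j\<close>, \<open>f j\<close> with \<open>j < n\<close>, the contributions \<open>\<sigma> j \<langle>\<cdot>, e j\<rangle> f j\<close> of \<open>X\<close> have the same trace
  \<open>\<sigma> j \<langle>Y (f j), e j\<rangle>\<close> in \<open>X Y\<close> and in \<open>Y X\<close>, because the subspace contains both vectors. The rest \<open>R\<close> of
  \<open>X\<close> has norm at most \<open>\<sigma> n\<close>.
\<close>

lemma commutator_trace:
  fixes X Y :: "'a \<Rightarrow>\<^sub>L 'a"
  assumes X: "svd X \<sigma> e" and Y: "Y \<in> BH"
  shows "\<exists>A. finite A \<and> card A \<le> 2 * n \<and>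
    (\<forall>Q. frame Q A \<longrightarrow> cmod (trace_on Q ((X o\<^sub>L Y) - (Y o\<^sub>L X))) \<le> real (card Q) * (2 * norm Y * \<sigma> n))"
proof -
  obtain f where f: "suborthonormal UNIV f" "\<And>n. X (e n) = \<sigma> n *\<^sub>R f n"
    using left_singular_system[OF X] by metis
  note BX = svdD(1)[OF X] and o = orthonormal_subset[OF svdD(2)[OF X] subset_UNIV]
  define R where "R = (\<lambda>x. X (x - (\<Sum>j<n. cinner x (e j) *\<^sub>C e j)))"
  have XR: "X x = (\<Sum>j<n. (of_real (\<sigma> j) * cinner x (e j)) *\<^sub>C f j) + R x" for x
    by (simp add: R_def blinfun.diff_right blinfun.sum_right BH_scaleC[OF BX] f(2) scaleC_scaleC mult.commute
        flip: scaleC_of_real)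
  have Rn: "norm (R x) \<le> \<sigma> n * norm x" for x
  proof -
    have "norm (R x) \<le> \<sigma> n * norm (x - (\<Sum>j<n. cinner x (e j) *\<^sub>C e j))"
      unfolding R_def by (intro svdD(8)[OF X] residual_orthogonal[OF o]) auto
    also have "norm (x - (\<Sum>j<n. cinner x (e j) *\<^sub>C e j)) \<le> norm x"
      by (rule power2_le_imp_le) (simp_all add: residual_norm_sq[OF o] sum_nonneg)
    finally show ?thesis using svdD(5)[OF X] by (simp add: mult_left_mono)
  qed
  define A where "A = e ` {..<n} \<union> f ` {..<n}"
  have "card A \<le> card (e ` {..<n}) + card (f ` {..<n})" unfolding A_def by (rule card_Un_le)
  also have "\<dots> \<le> n + n" using card_image_le[of "{..<n}" e] card_image_le[of "{..<n}" f] by simp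
  finally have card: "card A \<le> 2 * n" by simp
  have "cmod (trace_on Q ((X o\<^sub>L Y) - (Y o\<^sub>L X))) \<le> real (card Q) * (2 * norm Y * \<sigma> n)" if Q: "frame Q A" for Q
  proof -
    have diag: "cinner (((X o\<^sub>L Y) - (Y o\<^sub>L X)) q) q =
        (\<Sum>j<n. of_real (\<sigma> j) * (cinner (Y q) (e j) * cinner (f j) q - cinner q (e j) * cinner (Y (f j)) q))
        + (cinner (R (Y q)) q - cinner (Y (R q)) q)" for q
    proof -
      have "cinner (X (Y q)) q = (\<Sum>j<n. of_real (\<sigma> j) * (cinner (Y q) (e j) * cinner (f j) q)) + cinner (R (Y q)) q"
        by (subst XR) (simp add: cinner_lin cinner_sum_left mult.assoc)
      moreover have "cinner (Y (X q)) q = (\<Sum>j<n. of_real (\<sigma> j) * (cinner q (e j) * cinner (Y (f j)) q)) + cinner (Y (R q)) q"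
        by (subst XR) (simp add: blinfun.add_right blinfun.sum_right BH_scaleC[OF Y] cinner_lin cinner_sum_left mult.assoc)
      moreover have "cinner (((X o\<^sub>L Y) - (Y o\<^sub>L X)) q) q = cinner (X (Y q)) q - cinner (Y (X q)) q"
        by (simp add: blinfun.diff_left cinner_lin)
      ultimately show ?thesis
        by (simp only: right_diff_distrib sum_subtractf add_diff_add)
    qed
    have main: "(\<Sum>q\<in>Q. \<Sum>j<n. of_real (\<sigma> j) * (cinner (Y q) (e j) * cinner (f j) q - cinner q (e j) * cinner (Y (f j)) q)) = 0"
    proof (subst sum.swap, rule sum.neutral, rule ballI)
      fix j assume "j \<in> {..<n}"
      then have fr: "frame Q {f j}" "frame Q {e j}"
        by (auto intro!: frame_subset[OF Q] simp: A_def)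
      have "(\<Sum>q\<in>Q. cinner (Y q) (e j) * cinner (f j) q - cinner q (e j) * cinner (Y (f j)) q) = 0"
        unfolding sum_subtractf frame_trace_left[OF fr(1) Y] frame_trace_right[OF fr(2)] by simp
      then show "(\<Sum>q\<in>Q. of_real (\<sigma> j) * (cinner (Y q) (e j) * cinner (f j) q - cinner q (e j) * cinner (Y (f j)) q)) = 0"
        by (simp flip: sum_distrib_left)
    qed
    have small: "cmod (cinner (R (Y q)) q - cinner (Y (R q)) q) \<le> 2 * norm Y * \<sigma> n" if "q \<in> Q" for q
    proof -
      have nq: "norm q = 1" using Q orthonormal_norm[of Q "\<lambda>q. q" q] that by (simp add: frame_def)
      have "cmod (cinner (R (Y q)) q) \<le> norm (R (Y q))" using cauchy_schwarz[of "R (Y q)" q] nq by simp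
      also have "\<dots> \<le> \<sigma> n * norm (Y q)" by (rule Rn)
      also have "\<dots> \<le> \<sigma> n * norm Y" using norm_blinfun[of Y q] nq svdD(5)[OF X] by (intro mult_left_mono) auto
      finally have 1: "cmod (cinner (R (Y q)) q) \<le> \<sigma> n * norm Y" .
      have "cmod (cinner (Y (R q)) q) \<le> norm (Y (R q))" using cauchy_schwarz[of "Y (R q)" q] nq by simp
      also have "\<dots> \<le> norm Y * norm (R q)" by (rule norm_blinfun)
      also have "\<dots> \<le> norm Y * \<sigma> n" using Rn[of q] nq by (intro mult_left_mono) auto
      finally have 2: "cmod (cinner (Y (R q)) q) \<le> norm Y * \<sigma> n" .
      show ?thesis using 1 2 norm_triangle_ineq4[of "cinner (R (Y q)) q" "cinner (Y (R q)) q"]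
        by (simp add: mult.commute[of "\<sigma> n"] mult.assoc)
    qed
    have "trace_on Q ((X o\<^sub>L Y) - (Y o\<^sub>L X)) = (\<Sum>q\<in>Q. cinner (R (Y q)) q - cinner (Y (R q)) q)"
      unfolding trace_on_def diag sum.distrib main by simp
    then show ?thesis using sum_norm_le[of Q, OF small] by simp
  qed
  then show ?thesis using card by (intro exI[of _ A]) (auto simp: A_def)
qed

text \<open>
  For \<open>S = \<Sigma>(I)\<close> this property holds for the commutators that span \<open>[I,B(H)]\<close>, with \<open>\<tau> = 0\<close>, and for finite
  rank operators, with their trace as \<open>\<tau>\<close>. It is stable under linear combinations: the sets \<open>A\<close> are
  united and the errors added.
\<close>

definition near_trace :: "(nat \<Rightarrow> real) set \<Rightarrow> complex \<Rightarrow> ('a \<Rightarrow>\<^sub>L 'a) \<Rightarrow> bool"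
  where "near_trace S \<tau> T \<longleftrightarrow> (\<exists>\<eta>\<in>S. \<exists>m. \<forall>n. \<exists>A. finite A \<and> card A \<le> m * Suc n \<and>
    (\<forall>Q. frame Q A \<longrightarrow> cmod (trace_on Q T - \<tau>) \<le> real (card Q) * \<eta> n))"

lemma near_trace_add:
  assumes S: "char_cone S" and T: "near_trace S \<tau> T" "near_trace S \<tau>' T'"
  shows "near_trace S (\<tau> + \<tau>') (T + T')"
proof -
  obtain \<eta> m where 1: "\<eta> \<in> S" "\<forall>n. \<exists>A. finite A \<and> card A \<le> m * Suc n \<and>
    (\<forall>Q. frame Q A \<longrightarrow> cmod (trace_on Q T - \<tau>) \<le> real (card Q) * \<eta> n)"
    using T(1) unfolding near_trace_def by blast
  obtain \<eta>' m' where 2: "\<eta>' \<in> S" "\<forall>n. \<exists>A. finite A \<and> card A \<le> m' * Suc n \<and>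
    (\<forall>Q. frame Q A \<longrightarrow> cmod (trace_on Q T' - \<tau>') \<le> real (card Q) * \<eta>' n)"
    using T(2) unfolding near_trace_def by blast
  have "\<exists>A. finite A \<and> card A \<le> (m + m') * Suc n \<and>
    (\<forall>Q. frame Q A \<longrightarrow> cmod (trace_on Q (T + T') - (\<tau> + \<tau>')) \<le> real (card Q) * (\<eta> n + \<eta>' n))" for n
  proof -
    obtain A where A: "finite A" "card A \<le> m * Suc n"
      "\<And>Q. frame Q A \<Longrightarrow> cmod (trace_on Q T - \<tau>) \<le> real (card Q) * \<eta> n" using 1(2) by blast
    obtain B where B: "finite B" "card B \<le> m' * Suc n"
      "\<And>Q. frame Q B \<Longrightarrow> cmod (trace_on Q T' - \<tau>') \<le> real (card Q) * \<eta>' n" using 2(2) by blast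
    have "cmod (trace_on Q (T + T') - (\<tau> + \<tau>')) \<le> real (card Q) * (\<eta> n + \<eta>' n)" if Q: "frame Q (A \<union> B)" for Q
    proof -
      have "trace_on Q (T + T') - (\<tau> + \<tau>') = (trace_on Q T - \<tau>) + (trace_on Q T' - \<tau>')"
        by (simp add: trace_on_add)
      show ?thesis
        unfolding \<open>trace_on Q (T + T') - (\<tau> + \<tau>') = _\<close>
        using A(3)[OF frame_subset[OF Q]] B(3)[OF frame_subset[OF Q]]
          norm_triangle_ineq[of "trace_on Q T - \<tau>" "trace_on Q T' - \<tau>'"]
        by (simp add: distrib_left)
    qed
    moreover have "card (A \<union> B) \<le> (m + m') * Suc n"
      using card_Un_le[of A B] A(2) B(2) by (simp add: distrib_right)
    ultimately show ?thesis using A(1) B(1) by (intro exI[of _ "A \<union> B"]) auto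
  qed
  then show ?thesis unfolding near_trace_def
    using char_coneD(2)[OF S 1(1) 2(1)] by (intro bexI[of _ "\<lambda>n. \<eta> n + \<eta>' n"] exI[of _ "m + m'"]) auto
qed

lemma char_cone_scale:
  assumes S: "char_cone S" and \<xi>: "\<xi> \<in> S" and c: "0 \<le> c"
  shows "(\<lambda>n. c * \<xi> n) \<in> S"
proof (rule char_cone_dominated[OF S \<xi>, of _ 1 c])
  show "decseq (\<lambda>n. c * \<xi> n)" using char_coneD(1)[OF S \<xi>] c
    by (auto simp: c0_star_def decseq_def intro: mult_left_mono)
qed (use c c0_star_nonneg[OF char_coneD(1)[OF S \<xi>]] in auto)

lemma near_trace_scaleC:
  assumes S: "char_cone S" and T: "near_trace S \<tau> T"
  shows "near_trace S (c * \<tau>) (c *\<^sub>C T)"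
proof -
  obtain \<eta> m where 1: "\<eta> \<in> S" "\<forall>n. \<exists>A. finite A \<and> card A \<le> m * Suc n \<and>
    (\<forall>Q. frame Q A \<longrightarrow> cmod (trace_on Q T - \<tau>) \<le> real (card Q) * \<eta> n)"
    using T unfolding near_trace_def by blast
  have "cmod (trace_on Q (c *\<^sub>C T) - c * \<tau>) \<le> real (card Q) * (cmod c * \<eta> n)"
    if "cmod (trace_on Q T - \<tau>) \<le> real (card Q) * \<eta> n" for Q n
  proof -
    have "cmod (trace_on Q (c *\<^sub>C T) - c * \<tau>) = cmod c * cmod (trace_on Q T - \<tau>)"
      by (simp add: trace_on_scaleC norm_mult flip: right_diff_distrib)
    also have "\<dots> \<le> cmod c * (real (card Q) * \<eta> n)" using that by (intro mult_left_mono) auto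
    finally show ?thesis by (simp add: mult_ac)
  qed
  then show ?thesis unfolding near_trace_def
    using char_cone_scale[OF S 1(1), of "cmod c"] 1(2)
    by (intro bexI[of _ "\<lambda>n. cmod c * \<eta> n"] exI[of _ m]) (metis norm_ge_zero)+
qed

lemma near_trace_zero: "char_cone S \<Longrightarrow> near_trace S 0 0"
  unfolding near_trace_def using char_cone_zero
  by (intro bexI[of _ "\<lambda>n. 0"] exI[of _ 0]) (auto simp: trace_on_def)

lemma near_trace_commutator_space:
  assumes I: "op_ideal (I :: ('a \<Rightarrow>\<^sub>L 'a) set)" and C: "C \<in> commutator_space I"
  shows "near_trace (char_set I) 0 C"
  using C unfolding commutator_space_def
proof (induction rule: complex_vector.span_induct_alt)
  case base
  show ?case by (rule near_trace_zero[OF char_cone_char_set[OF I]])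
next
  case (step c x y)
  then obtain X Y where XY: "x = (X o\<^sub>L Y) - (Y o\<^sub>L X)" "X \<in> I" "Y \<in> BH" by blast
  obtain \<sigma> e where s: "svd X \<sigma> e" using ideal_svd[OF I XY(2)] .
  have "near_trace (char_set I) 0 x"
    unfolding near_trace_def
  proof (intro bexI[of _ "\<lambda>n. 2 * norm Y * \<sigma> n"] exI[of _ 2] allI)
    show "(\<lambda>n. 2 * norm Y * \<sigma> n) \<in> char_set I"
      by (intro char_cone_scale[OF char_cone_char_set[OF I] char_setI[OF XY(2) s]]) simp
    show "\<exists>A. finite A \<and> card A \<le> 2 * Suc n \<and>
      (\<forall>Q. frame Q A \<longrightarrow> cmod (trace_on Q x - 0) \<le> real (card Q) * (2 * norm Y * \<sigma> n))" for n
    proof -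
      obtain A where "finite A" "card A \<le> 2 * n"
        "\<forall>Q. frame Q A \<longrightarrow> cmod (trace_on Q x) \<le> real (card Q) * (2 * norm Y * \<sigma> n)"
        using commutator_trace[OF s XY(3), of n] unfolding XY(1)[symmetric] by blast
      then show ?thesis by (intro exI[of _ A]) auto
    qed
  qed
  then have "near_trace (char_set I) (c * 0) (c *\<^sub>C x)"
    by (rule near_trace_scaleC[OF char_cone_char_set[OF I]])
  then have "near_trace (char_set I) (c * 0 + 0) (c *\<^sub>C x + y)"
    by (rule near_trace_add[OF char_cone_char_set[OF I] _ step(2)])
  then show ?case by simp
qed

lemma finite_rank_basis:
  assumes "A \<in> (finite_rank :: ('a \<Rightarrow>\<^sub>L 'a) set)"
  obtains B where "finite B" "orthonormal B (\<lambda>q. q)" "\<And>x. A x = (\<Sum>b\<in>B. cinner (A x) b *\<^sub>C b)"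
proof -
  obtain B0 where B0: "finite B0" "complex_vector.span B0 = range (blinfun_apply A)"
    using assms unfolding finite_rank_def has_cdim_def by blast
  obtain B where B: "finite B" "orthonormal B (\<lambda>q. q)" "\<And>s. s \<in> B0 \<Longrightarrow> s = (\<Sum>b\<in>B. cinner s b *\<^sub>C b)"
    using gram_schmidt[OF B0(1)] by blast
  define R where "R = (\<lambda>y. \<Sum>b\<in>B. cinner y b *\<^sub>C b)"
  have "R 0 = 0" "\<And>x y. R (x + y) = R x + R y" "\<And>c x. R (c *\<^sub>C x) = c *\<^sub>C R x"
    by (simp_all add: R_def cinner_lin scaleC_add_left sum.distrib complex_vector.scale_sum_right scaleC_scaleC)
  then have "complex_vector.subspace {y. R y = y}"
    unfolding complex_vector.subspace_def by simp
  moreover have "B0 \<subseteq> {y. R y = y}" using B(3) by (auto simp: R_def)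
  ultimately have "complex_vector.span B0 \<subseteq> {y. R y = y}" by (intro complex_vector.span_minimal)
  then have "R (A x) = A x" for x unfolding B0(2) by blast
  then have "A x = (\<Sum>b\<in>B. cinner (A x) b *\<^sub>C b)" for x unfolding R_def by (rule sym)
  then show ?thesis using that B(1,2) by blast
qed

text \<open>
  The trace over any subspace containing the range equals the trace over the range.
\<close>

lemma near_trace_finite_rank:
  assumes S: "char_cone S" and A: "A \<in> (finite_rank :: ('a \<Rightarrow>\<^sub>L 'a) set)"
  shows "\<exists>\<tau>. near_trace S \<tau> A"
proof -
  have BA: "A \<in> BH" using A by (simp add: finite_rank_def)
  obtain B where B: "finite B" "\<And>x. A x = (\<Sum>b\<in>B. cinner (A x) b *\<^sub>C b)"
    using finite_rank_basis[OF A] by metis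
  define \<tau> where "\<tau> = (\<Sum>b\<in>B. cinner (A b) b)"
  have "trace_on Q A = \<tau>" if Q: "frame Q B" for Q
  proof -
    have "cinner (A q) q = (\<Sum>b\<in>B. cinner (A q) b * cinner b q)" for q
      by (subst B(2)) (simp add: cinner_sum_left cinner_lin)
    then have "trace_on Q A = (\<Sum>b\<in>B. \<Sum>q\<in>Q. cinner (A q) b * cinner b q)"
      unfolding trace_on_def by (simp add: sum.swap[of _ B Q])
    also have "\<dots> = \<tau>"
      unfolding \<tau>_def by (intro sum.cong refl frame_trace_left[OF frame_subset[OF Q] BA]) simp
    finally show ?thesis .
  qed
  then have "near_trace S \<tau> A"
    unfolding near_trace_def using B(1) char_cone_zero[OF S]
    by (intro bexI[of _ "\<lambda>n. 0"] exI[of _ "card B"] allI exI[of _ B]) auto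
  then show ?thesis by blast
qed

lemma near_trace_F_plus_comm:
  assumes I: "op_ideal (I :: ('a \<Rightarrow>\<^sub>L 'a) set)" and T: "T \<in> F_plus_comm I"
  shows "\<exists>\<tau>. near_trace (char_set I) \<tau> T"
proof -
  obtain A C where AC: "T = A + C" "A \<in> finite_rank" "C \<in> commutator_space I"
    using T unfolding F_plus_comm_def by blast
  obtain \<tau> where "near_trace (char_set I) \<tau> A"
    using near_trace_finite_rank[OF char_cone_char_set[OF I] AC(2)] by blast
  then show ?thesis
    using near_trace_add[OF char_cone_char_set[OF I] _ near_trace_commutator_space[OF I AC(3)]] AC(1) by blast
qed

text \<open>
  Both bounds come from splitting off the components of \<open>x\<close> along the first \<open>n\<close> eigenvectors; on the
  remainder the form is between \<open>0\<close> and \<open>\<sigma> n\<close> times the squared norm.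
\<close>

lemma positive_form_split:
  fixes X :: "'a \<Rightarrow>\<^sub>L 'a"
  assumes pos: "positive_op X" and X: "svd X \<sigma> e" and eig: "\<And>n. X (e n) = \<sigma> n *\<^sub>R e n"
  shows "(\<Sum>j<n. \<sigma> j * (cmod (cinner x (e j)))\<^sup>2) \<le> Re (cinner (X x) x)"
    and "Re (cinner (X x) x) \<le> (\<Sum>j<n. (\<sigma> j - \<sigma> n) * (cmod (cinner x (e j)))\<^sup>2) + \<sigma> n * (norm x)\<^sup>2"
proof -
  note BX = svdD(1)[OF X] and o = orthonormal_subset[OF svdD(2)[OF X] subset_UNIV]
  define p where "p = (\<Sum>j<n. cinner x (e j) *\<^sub>C e j)"
  define y where "y = x - p"
  have x: "x = p + y" by (simp add: y_def)
  have ye: "cinner y (e j) = 0" if "j < n" for j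
    using residual_orthogonal[OF o, of "{..<n}" j x] that by (simp add: y_def p_def)
  have Xye: "cinner (X y) (e j) = 0" if "j < n" for j
    using ye[OF that] by (simp add: positive_selfadjoint[OF pos] eig cinner_lin)
  have "cinner (X y) p = 0" using Xye by (simp add: p_def cinner_sum_right cinner_lin)
  moreover have "cinner (X p) y = 0"
    using ye cinner_eq_0_commute[of y] by (simp add: p_def blinfun.sum_right BH_scaleC[OF BX] eig cinner_sum_left cinner_lin)
  moreover have "cinner (X p) p = (\<Sum>j<n. of_real (\<sigma> j * (cmod (cinner x (e j)))\<^sup>2))"
  proof -
    have "cinner (e j) p = cnj (cinner x (e j))" if "j < n" for j
      using orthonormal_comb_cinner[OF o, of "{..<n}" j "\<lambda>j. cinner x (e j)"] that
      by (subst cinner_commute) (simp add: p_def)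
    then have "cinner (X p) p = (\<Sum>j<n. cinner x (e j) * (of_real (\<sigma> j) * cnj (cinner x (e j))))"
      by (subst (1) p_def) (simp add: blinfun.sum_right BH_scaleC[OF BX] eig cinner_sum_left cinner_lin)
    also have "\<dots> = (\<Sum>j<n. of_real (\<sigma> j) * (cinner x (e j) * cnj (cinner x (e j))))"
      by (simp add: mult_ac)
    finally show ?thesis by (simp flip: complex_norm_square)
  qed
  ultimately have split: "Re (cinner (X x) x) = (\<Sum>j<n. \<sigma> j * (cmod (cinner x (e j)))\<^sup>2) + Re (cinner (X y) y)"
    unfolding x by (simp add: blinfun.add_right cinner_lin)
  show "(\<Sum>j<n. \<sigma> j * (cmod (cinner x (e j)))\<^sup>2) \<le> Re (cinner (X x) x)"
    using split positive_opD(2)[OF pos, of y] by simp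
  have "Re (cinner (X y) y) \<le> norm (X y) * norm y"
    using complex_Re_le_cmod cauchy_schwarz order.trans by blast
  also have "\<dots> \<le> (\<sigma> n * norm y) * norm y" using ye by (intro mult_right_mono svdD(8)[OF X]) auto
  also have "\<dots> = \<sigma> n * ((norm x)\<^sup>2 - (\<Sum>j<n. (cmod (cinner x (e j)))\<^sup>2))"
    using residual_norm_sq[OF o, of "{..<n}" x] by (simp add: y_def p_def power2_eq_square)
  finally show "Re (cinner (X x) x) \<le> (\<Sum>j<n. (\<sigma> j - \<sigma> n) * (cmod (cinner x (e j)))\<^sup>2) + \<sigma> n * (norm x)\<^sup>2"
    unfolding split by (simp add: left_diff_distrib right_diff_distrib sum_subtractf sum_distrib_left)
qed

lemma trace_on_lower:
  fixes X :: "'a \<Rightarrow>\<^sub>L 'a"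
  assumes pos: "positive_op X" and X: "svd X \<sigma> e" and eig: "\<And>n. X (e n) = \<sigma> n *\<^sub>R e n"
    and Q: "frame Q (e ` {..<n})"
  shows "(\<Sum>j<n. \<sigma> j) \<le> Re (trace_on Q X)"
proof -
  have w: "(\<Sum>q\<in>Q. (cmod (cinner q (e j)))\<^sup>2) = 1" if "j < n" for j
  proof -
    have "(\<Sum>q\<in>Q. (cmod (cinner (e j) q))\<^sup>2) = (norm (e j))\<^sup>2"
      by (rule parseval_finite) (use Q that in \<open>auto simp: frame_def\<close>)
    then show ?thesis using orthonormal_norm[OF svdD(2)[OF X], of j]
      by (metis (no_types, lifting) UNIV_I cinner_commute complex_mod_cnj one_power2 sum.cong)
  qed
  have "(\<Sum>j<n. \<sigma> j) = (\<Sum>j<n. \<sigma> j * (\<Sum>q\<in>Q. (cmod (cinner q (e j)))\<^sup>2))"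
    by (intro sum.cong) (auto simp: w)
  also have "\<dots> = (\<Sum>q\<in>Q. \<Sum>j<n. \<sigma> j * (cmod (cinner q (e j)))\<^sup>2)"
    by (simp add: sum_distrib_left sum.swap[of _ Q])
  also have "\<dots> \<le> (\<Sum>q\<in>Q. Re (cinner (X q) q))"
    by (intro sum_mono positive_form_split(1)[OF pos X eig])
  finally show ?thesis by (simp add: trace_on_def)
qed

text \<open>
  Ky Fan's inequality: the weights \<open>\<Sum>q\<in>Q. \<bar>\<langle>q, e j\<rangle>\<bar>\<^sup>2\<close> are at most \<open>1\<close>, and the mass they leave is
  counted with the smaller factor \<open>\<sigma> r\<close>.
\<close>

lemma trace_on_upper:
  fixes X :: "'a \<Rightarrow>\<^sub>L 'a"
  assumes pos: "positive_op X" and X: "svd X \<sigma> e" and eig: "\<And>n. X (e n) = \<sigma> n *\<^sub>R e n"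
    and Q: "frame Q {}"
  shows "Re (trace_on Q X) \<le> (\<Sum>j<card Q. \<sigma> j)"
proof -
  define r where "r = card Q"
  have oQ: "finite Q" "orthonormal Q (\<lambda>q. q)" using Q by (auto simp: frame_def)
  have w: "(\<Sum>q\<in>Q. (cmod (cinner q (e j)))\<^sup>2) \<le> 1" for j
  proof -
    have "(\<Sum>q\<in>Q. (cmod (cinner (e j) q))\<^sup>2) \<le> (norm (e j))\<^sup>2"
      by (rule bessel[OF orthonormal_imp_suborthonormal[OF oQ(2)] oQ(1)])
    then show ?thesis using orthonormal_norm[OF svdD(2)[OF X], of j]
      by (metis (no_types, lifting) UNIV_I cinner_commute complex_mod_cnj one_power2 sum.cong)
  qed
  have "Re (trace_on Q X) = (\<Sum>q\<in>Q. Re (cinner (X q) q))" by (simp add: trace_on_def)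
  also have "\<dots> \<le> (\<Sum>q\<in>Q. (\<Sum>j<r. (\<sigma> j - \<sigma> r) * (cmod (cinner q (e j)))\<^sup>2) + \<sigma> r * (norm q)\<^sup>2)"
    by (intro sum_mono positive_form_split(2)[OF pos X eig])
  also have "\<dots> = (\<Sum>j<r. (\<sigma> j - \<sigma> r) * (\<Sum>q\<in>Q. (cmod (cinner q (e j)))\<^sup>2)) + (\<Sum>q\<in>Q. \<sigma> r * (norm q)\<^sup>2)"
    by (simp add: sum.distrib sum_distrib_left sum.swap[of _ Q])
  also have "(\<Sum>q\<in>Q. \<sigma> r * (norm q)\<^sup>2) = real r * \<sigma> r"
    using orthonormal_norm[OF oQ(2)] by (simp add: r_def)
  also have "(\<Sum>j<r. (\<sigma> j - \<sigma> r) * (\<Sum>q\<in>Q. (cmod (cinner q (e j)))\<^sup>2)) \<le> (\<Sum>j<r. \<sigma> j - \<sigma> r)"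
    using w svdD(4)[OF X] by (intro sum_mono mult_left_le) (auto simp: decseq_def)
  also have "(\<Sum>j<r. \<sigma> j - \<sigma> r) + real r * \<sigma> r = (\<Sum>j<r. \<sigma> j)" by (simp add: sum_subtractf)
  finally show ?thesis by (simp add: r_def)
qed

text \<open>
  The subspace is spanned by the set from \<open>near_trace\<close> together with the first \<open>n + 1\<close> eigenvectors, so
  that its dimension is at most \<open>M (n + 1)\<close>.
\<close>

lemma trace_sandwich:
  fixes X :: "'a \<Rightarrow>\<^sub>L 'a"
  assumes S: "char_cone S" and pos: "positive_op X" and X: "svd X \<sigma> e" and eig: "\<And>n. X (e n) = \<sigma> n *\<^sub>R e n"
    and near: "near_trace S \<tau> X"
  obtains \<eta> M where "\<eta> \<in> S" "M > 0"
    "\<And>n. (\<Sum>j\<le>n. \<sigma> j) \<le> Re \<tau> + real (Suc n) * \<eta> n"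
    "\<And>n. Re \<tau> \<le> (\<Sum>j<M * Suc n. \<sigma> j) + real (Suc n) * \<eta> n"
proof -
  obtain \<eta> m where 1: "\<eta> \<in> S" "\<forall>n. \<exists>A. finite A \<and> card A \<le> m * Suc n \<and>
    (\<forall>Q. frame Q A \<longrightarrow> cmod (trace_on Q X - \<tau>) \<le> real (card Q) * \<eta> n)"
    using near unfolding near_trace_def by blast
  define M where "M = Suc m"
  have \<eta>0: "0 \<le> \<eta> n" for n by (rule c0_star_nonneg[OF char_coneD(1)[OF S 1(1)]])
  have key: "\<exists>t. (\<Sum>j\<le>n. \<sigma> j) \<le> t \<and> t \<le> (\<Sum>j<M * Suc n. \<sigma> j) \<and> \<bar>t - Re \<tau>\<bar> \<le> real (Suc n) * (real M * \<eta> n)" for n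
  proof -
    obtain A where A: "finite A" "card A \<le> m * Suc n"
      "\<And>Q. frame Q A \<Longrightarrow> cmod (trace_on Q X - \<tau>) \<le> real (card Q) * \<eta> n" using 1(2) by blast
    obtain Q where Q: "frame Q (A \<union> e ` {..<Suc n})" "card Q \<le> card (A \<union> e ` {..<Suc n})"
      using frame_exists[of "A \<union> e ` {..<Suc n}"] A(1) by auto
    have "card Q \<le> card A + card (e ` {..<Suc n})" using Q(2) card_Un_le order.trans by blast
    also have "\<dots> \<le> M * Suc n" using A(2) card_image_le[of "{..<Suc n}" e] by (simp add: M_def)
    finally have cQ: "card Q \<le> M * Suc n" .
    have "\<bar>Re (trace_on Q X) - Re \<tau>\<bar> \<le> cmod (trace_on Q X - \<tau>)" using abs_Re_le_cmod[of "trace_on Q X - \<tau>"] by simp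
    also have "\<dots> \<le> real (card Q) * \<eta> n" by (rule A(3)[OF frame_subset[OF Q(1)]]) simp
    also have "\<dots> \<le> real (M * Suc n) * \<eta> n" using cQ \<eta>0 by (intro mult_right_mono) (simp_all only: of_nat_le_iff)
    also have "\<dots> = real (Suc n) * (real M * \<eta> n)" by (simp only: of_nat_mult mult_ac)
    finally have "\<bar>Re (trace_on Q X) - Re \<tau>\<bar> \<le> real (Suc n) * (real M * \<eta> n)" .
    moreover have "(\<Sum>j<Suc n. \<sigma> j) \<le> Re (trace_on Q X)"
      by (rule trace_on_lower[OF pos X eig frame_subset[OF Q(1)]]) simp
    moreover have "Re (trace_on Q X) \<le> (\<Sum>j<M * Suc n. \<sigma> j)"
    proof -
      have "Re (trace_on Q X) \<le> (\<Sum>j<card Q. \<sigma> j)" by (rule trace_on_upper[OF pos X eig frame_subset[OF Q(1)]]) simp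
      also have "\<dots> \<le> (\<Sum>j<M * Suc n. \<sigma> j)" using cQ svdD(5)[OF X] by (intro sum_mono2) auto
      finally show ?thesis .
    qed
    ultimately show ?thesis by (auto simp: lessThan_Suc_atMost)
  qed
  show ?thesis
  proof (rule that[of "\<lambda>n. real M * \<eta> n" M])
    show "(\<lambda>n. real M * \<eta> n) \<in> S" by (rule char_cone_scale[OF S 1(1)]) simp
    show "(\<Sum>j\<le>n. \<sigma> j) \<le> Re \<tau> + real (Suc n) * (real M * \<eta> n)" for n using key[of n] by auto
    show "Re \<tau> \<le> (\<Sum>j<M * Suc n. \<sigma> j) + real (Suc n) * (real M * \<eta> n)" for n using key[of n] by auto
  qed (simp add: M_def)
qed

end

section \<open>Diagonal operators as sums of two commutators\<close>

lemma commutator_in_space: "X \<in> I \<Longrightarrow> Y \<in> BH \<Longrightarrow> (X o\<^sub>L Y) - (Y o\<^sub>L X) \<in> commutator_space I"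
  unfolding commutator_space_def by (intro complex_vector.span_base) blast

context hilbert_basis
begin

text \<open>
  \<open>A\<close> is the shift along the edges from \<open>n\<close> to \<open>p n\<close> with weights \<open>v\<close>, and \<open>B\<close> is the adjoint of the
  unweighted one. The bound on \<open>v\<close> puts \<open>A\<close> into the ideal.
\<close>

lemma edge_commutator:
  fixes e :: "nat \<Rightarrow> 'a"
  assumes I: "op_ideal (I :: ('a \<Rightarrow>\<^sub>L 'a) set)" and \<alpha>: "\<alpha> \<in> char_set I" and e: "orthonormal UNIV e"
    and p: "inj p" and v: "\<And>n. \<bar>v n\<bar> \<le> c * \<alpha> n"
  obtains C where "C \<in> commutator_space I" "C \<in> BH" "\<And>x. (\<And>n. cinner x (e n) = 0) \<Longrightarrow> blinfun_apply C x = 0"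
    "\<And>m. blinfun_apply C (e m) = ((if m \<in> range p then v (inv p m) else 0) - v m) *\<^sub>R e m"
proof -
  have c\<alpha>: "\<alpha> \<in> c0_star" using char_coneD(1)[OF char_cone_char_set[OF I] \<alpha>] .
  note d = svd_diagonal[OF e c\<alpha>]
  have DI: "series_op \<alpha> e e \<in> I" using ideal_mem_iff[OF I d] \<alpha> by blast
  have ep: "orthonormal UNIV (\<lambda>n. e (p n))" by (rule orthonormal_reindex[OF e p]) simp
  note se = orthonormal_imp_suborthonormal[OF e] and sep = orthonormal_imp_suborthonormal[OF ep]
  define A where "A = series_op v (\<lambda>n. e (p n)) e"
  define B where "B = series_op (\<lambda>n. 1) e (\<lambda>n. e (p n))"
  have b1: "Bseq (\<lambda>n. 1 :: real)" by (intro BseqI'[where K = 1]) simp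
  have bv: "Bseq v"
  proof (rule BseqI'[where K = "\<bar>c\<bar> * \<alpha> 0"])
    show "norm (v n) \<le> \<bar>c\<bar> * \<alpha> 0" for n
      using v[of n] mult_mono[OF abs_ge_self[of c] c0_star_ge[OF c\<alpha>, of 0 n]] c0_star_nonneg[OF c\<alpha>] by fastforce
  qed
  have A: "A \<in> I" unfolding A_def by (rule ideal_series_op[OF I DI d sep e v])
  have B: "B \<in> BH" unfolding B_def by (rule series_op_BH[OF sep se b1])
  define C where "C = (A o\<^sub>L B) - (B o\<^sub>L A)"
  have Ae: "A (e n) = v n *\<^sub>R e (p n)" for n
    using series_op_orthonormal[OF e sep bv, of n] by (simp add: A_def scaleC_of_real)
  have Be: "B (e (p n)) = e n" for n
    using series_op_orthonormal[OF ep se b1, of n] by (simp add: B_def scaleC_one)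
  have B0: "B x = 0" if "\<And>n. cinner x (e (p n)) = 0" for x
    unfolding B_def by (rule series_op_perp[OF sep se b1 that])
  have A0: "A x = 0" if "\<And>n. cinner x (e n) = 0" for x
    unfolding A_def by (rule series_op_perp[OF se sep bv that])
  have BA: "B (A (e m)) = v m *\<^sub>R e m" for m by (simp add: Ae Be blinfun.scaleR_right)
  have AB: "A (B (e m)) = (if m \<in> range p then v (inv p m) else 0) *\<^sub>R e m" for m
  proof (cases "m \<in> range p")
    case True
    then obtain n where n: "m = p n" by blast
    then show ?thesis by (simp add: Be Ae inv_f_f[OF p])
  next
    case False
    then have "B (e m) = 0" using e by (intro B0) (auto simp: orthonormal_def)
    then show ?thesis using False by (simp add: blinfun.zero_right)
  qed
  show ?thesis
  proof (rule that[of C])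
    show "C \<in> commutator_space I" unfolding C_def by (rule commutator_in_space[OF A B])
    show "C \<in> BH" unfolding C_def by (intro BH_diff BH_compose B op_idealD(1)[OF I A])
    show "C x = 0" if "\<And>n. cinner x (e n) = 0" for x
      using A0[OF that] B0[of x] that by (simp add: C_def blinfun.diff_left blinfun.zero_right)
    show "C (e m) = ((if m \<in> range p then v (inv p m) else 0) - v m) *\<^sub>R e m" for m
      unfolding C_def by (simp only: blinfun.diff_left blinfun_apply_blinfun_compose AB BA scaleR_diff_left)
  qed
qed

text \<open>
  The weight of the edge from the parent of \<open>n\<close> to \<open>n\<close> is \<open>w n\<close>; the root has no parent, hence \<open>w 0 = 0\<close>.
\<close>

lemma tree_commutators:
  fixes e :: "nat \<Rightarrow> 'a"
  assumes I: "op_ideal (I :: ('a \<Rightarrow>\<^sub>L 'a) set)" and \<alpha>: "\<alpha> \<in> char_set I" and e: "orthonormal UNIV e"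
    and w0: "w 0 = 0" and w: "\<And>n. \<bar>w (2 * n + 1)\<bar> \<le> c * \<alpha> n" "\<And>n. \<bar>w (2 * n + 2)\<bar> \<le> c * \<alpha> n"
    and T: "T \<in> BH" "\<And>n. T (e n) = (w (2 * n + 1) + w (2 * n + 2) - w n) *\<^sub>R e n"
      "\<And>x. (\<And>n. cinner x (e n) = 0) \<Longrightarrow> blinfun_apply T x = 0"
  shows "T \<in> commutator_space I"
proof -
  let ?l = "\<lambda>n::nat. 2 * n + 1" and ?r = "\<lambda>n::nat. 2 * n + 2"
  have inj: "inj ?l" "inj ?r" by (auto simp: inj_on_def)
  obtain C where C: "C \<in> commutator_space I" "C \<in> BH" "\<And>x. (\<And>n. cinner x (e n) = 0) \<Longrightarrow> blinfun_apply C x = 0"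
    "\<And>m. blinfun_apply C (e m) = ((if m \<in> range ?l then w (?l (inv ?l m)) else 0) - w (?l m)) *\<^sub>R e m"
    using edge_commutator[OF I \<alpha> e inj(1), of "\<lambda>n. w (?l n)" c] w(1) by blast
  obtain D where D: "D \<in> commutator_space I" "D \<in> BH" "\<And>x. (\<And>n. cinner x (e n) = 0) \<Longrightarrow> blinfun_apply D x = 0"
    "\<And>m. blinfun_apply D (e m) = ((if m \<in> range ?r then w (?r (inv ?r m)) else 0) - w (?r m)) *\<^sub>R e m"
    using edge_commutator[OF I \<alpha> e inj(2), of "\<lambda>n. w (?r n)" c] w(2) by blast
  have key: "(if m \<in> range ?l then w (?l (inv ?l m)) else 0) + (if m \<in> range ?r then w (?r (inv ?r m)) else 0) = w m" for m
  proof -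
    have l: "m \<in> range ?l \<longleftrightarrow> odd m" by (auto simp: image_iff elim: oddE)
    have r: "m \<in> range ?r \<longleftrightarrow> even m \<and> m \<noteq> 0"
    proof
      assume "even m \<and> m \<noteq> 0"
      then have "m = ?r (m div 2 - 1)" by (auto elim!: evenE)
      then show "m \<in> range ?r" by blast
    qed auto
    show ?thesis
      using f_inv_into_f[of m ?l UNIV] f_inv_into_f[of m ?r UNIV] w0 unfolding l r by auto
  qed
  have "T = (-1) *\<^sub>C (C + D)"
  proof (rule op_eqI[OF e T(1)])
    show "(-1) *\<^sub>C (C + D) \<in> BH" by (intro BH_scaleC_op BH_add C D)
    fix m
    have "(C + D) (e m) = ((if m \<in> range ?l then w (?l (inv ?l m)) else 0)
        + (if m \<in> range ?r then w (?r (inv ?r m)) else 0) - w (?l m) - w (?r m)) *\<^sub>R e m"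
      unfolding blinfun.add_left C(4) D(4) by (simp add: scaleR_add_left scaleR_diff_left algebra_simps)
    then have "(C + D) (e m) = (w m - w (?l m) - w (?r m)) *\<^sub>R e m" unfolding key .
    then show "T (e m) = ((-1) *\<^sub>C (C + D)) (e m)"
      unfolding blinfun_apply_scaleC T(2) by (simp add: scaleR_add_left scaleR_diff_left)
  next
    show "T x = ((-1) *\<^sub>C (C + D)) x" if "\<And>n. cinner x (e n) = 0" for x
      unfolding blinfun_apply_scaleC blinfun.add_left using C(3)[OF that] D(3)[OF that] T(3)[OF that] by simp
  qed
  moreover have "(-1) *\<^sub>C (C + D) \<in> commutator_space I"
    using C(1) D(1) unfolding commutator_space_def
    by (intro complex_vector.span_scale complex_vector.span_add)
  ultimately show ?thesis by simp
qed

end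

subsection \<open>Flow from the root\<close>

text \<open>
  Every node passes on its own value together with the inflow from its parent, in equal shares to both
  children.
\<close>

fun down_flow :: "(nat \<Rightarrow> real) \<Rightarrow> nat \<Rightarrow> real" where
  "down_flow x 0 = 0"
| "down_flow x (Suc n) = (x (n div 2) + down_flow x (n div 2)) / 2"

lemma down_flow_nonneg: "(\<And>n. 0 \<le> x n) \<Longrightarrow> 0 \<le> down_flow x n"
proof (induction n rule: less_induct)
  case (less n)
  then show ?case by (cases n) auto
qed

text \<open>
  The nodes \<open>n\<close> with \<open>2 ^ K \<le> n + 1 < 2 ^ (K + 1)\<close> form the level \<open>K\<close>, on which \<open>x\<close> is at most
  \<open>x (2 ^ K - 1)\<close>. This bound for what a node adds to the flow is carried along in the induction. In the
  step from \<open>K\<close> to \<open>K + 1\<close>, the \<open>2 ^ K\<close> entries that are added to the sum pay for its value on the next level.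
\<close>

lemma down_flow_level:
  assumes "decseq x" "\<And>n. 0 \<le> x n" "2 ^ K \<le> Suc n" "Suc n < 2 ^ Suc K"
  shows "2 ^ K * (down_flow x n + x (2 ^ K - 1)) \<le> 2 * (\<Sum>j<2 ^ K. x j)"
  using assms(3,4)
proof (induction K arbitrary: n)
  case 0
  then show ?case using assms(2)[of 0] by simp
next
  case (Suc K)
  have ge2: "Suc n \<ge> 2" using Suc.prems(1) one_le_power[of "2::nat" K] by (simp, linarith)
  then obtain n' where n': "n = Suc n'" by (cases n) auto
  define m where "m = n' div 2"
  have m: "2 ^ K \<le> Suc m" "Suc m < 2 ^ Suc K"
    using Suc.prems unfolding n' m_def by auto
  have "x m \<le> x (2 ^ K - 1)" using assms(1) m(1) by (simp add: decseq_def le_diff_conv)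
  then have 1: "2 ^ Suc K * down_flow x n \<le> 2 ^ K * (down_flow x m + x (2 ^ K - 1))"
    by (simp add: n' m_def field_simps)
  have "2 ^ K * x (2 ^ Suc K - 1) = (\<Sum>j\<in>{2 ^ K..<2 ^ Suc K :: nat}. x (2 ^ Suc K - 1))" by simp
  also have "\<dots> \<le> (\<Sum>j\<in>{2 ^ K..<2 ^ Suc K}. x j)"
    using assms(1) by (intro sum_mono) (auto simp: decseq_def)
  finally have 2: "2 ^ K * x (2 ^ Suc K - 1) \<le> (\<Sum>j\<in>{2 ^ K..<2 ^ Suc K}. x j)" .
  have 3: "(\<Sum>j<2 ^ Suc K. x j) = (\<Sum>j<2 ^ K. x j) + (\<Sum>j\<in>{2 ^ K..<2 ^ Suc K}. x j)"
    using sum.atLeastLessThan_concat[of 0 "2 ^ K" "2 ^ Suc K" x] by (simp add: atLeast0LessThan)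
  have "2 ^ Suc K * (down_flow x n + x (2 ^ Suc K - 1)) = 2 ^ Suc K * down_flow x n + 2 * (2 ^ K * x (2 ^ Suc K - 1))"
    by (simp add: distrib_left)
  also have "\<dots> \<le> 2 * (\<Sum>j<2 ^ K. x j) + 2 * (\<Sum>j\<in>{2 ^ K..<2 ^ Suc K}. x j)"
    using 1 2 Suc.IH[OF m] by linarith
  finally show ?case unfolding 3 by simp
qed

lemma down_flow_le:
  assumes "decseq x" "\<And>n. 0 \<le> x n"
  shows "down_flow x n \<le> 4 * arith_mean x n"
proof -
  obtain K where K: "2 ^ K \<le> Suc n" "Suc n < 2 ^ Suc K"
    using ex_power_ivl1[of 2 "Suc n"] by auto
  have "2 ^ K * down_flow x n \<le> 2 ^ K * (down_flow x n + x (2 ^ K - 1))"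
    using assms(2) by (intro mult_left_mono) auto
  also have "\<dots> \<le> 2 * (\<Sum>j<2 ^ K. x j)" by (rule down_flow_level[OF assms K])
  also have "\<dots> \<le> 2 * (\<Sum>j\<le>n. x j)"
    using K(1) assms(2) by (intro mult_left_mono sum_mono2) auto
  finally have 1: "2 ^ K * down_flow x n \<le> 2 * (\<Sum>j\<le>n. x j)" .
  have "real (Suc n) \<le> 2 * 2 ^ K" using K(2) by (metis less_imp_le of_nat_le_iff of_nat_numeral of_nat_power power_Suc)
  then have "real (Suc n) * down_flow x n \<le> 2 * (2 ^ K * down_flow x n)"
    using mult_right_mono[OF _ down_flow_nonneg[of x n], of "real (Suc n)" "2 * 2 ^ K"] assms(2) by simp
  then have "real (Suc n) * down_flow x n \<le> 4 * (\<Sum>j\<le>n. x j)" using 1 by linarith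
  then show ?thesis by (simp add: arith_mean_def field_simps)
qed

lemma arith_mean_ge:
  assumes "decseq x"
  shows "x n \<le> arith_mean x n"
proof -
  have "real (Suc n) * x n = (\<Sum>j\<le>n. x n)" by simp
  also have "\<dots> \<le> (\<Sum>j\<le>n. x j)" using assms by (intro sum_mono) (simp add: decseq_def)
  finally show ?thesis by (simp add: arith_mean_def field_simps)
qed

subsection \<open>Flow towards the root\<close>

text \<open>
  The sum of \<open>x\<close> over the descendants of \<open>n\<close> that are \<open>k\<close> generations below it.
\<close>

fun descendant_sum :: "(nat \<Rightarrow> real) \<Rightarrow> nat \<Rightarrow> nat \<Rightarrow> real" where
  "descendant_sum x 0 n = x n"
| "descendant_sum x (Suc k) n = descendant_sum x k (2 * n + 1) + descendant_sum x k (2 * n + 2)"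

lemma descendant_sum_nonneg: "(\<And>n. 0 \<le> x n) \<Longrightarrow> 0 \<le> descendant_sum x k n"
  by (induction k arbitrary: n) auto

text \<open>
  The \<open>k\<close>th generation below \<open>n\<close> consists of \<open>2\<^sup>k\<close> nodes, the first of which is \<open>2\<^sup>k (n + 1) - 1\<close>.
\<close>

lemma descendant_sum_le:
  assumes "decseq x"
  shows "descendant_sum x k n \<le> 2 ^ k * x (2 ^ k * Suc n - 1)"
proof (induction k arbitrary: n)
  case (Suc k)
  have "x (2 ^ k * Suc (2 * n + 2) - 1) \<le> x (2 ^ k * Suc (2 * n + 1) - 1)"
    using assms by (simp add: decseq_def diff_le_mono)
  moreover have "(2::nat) ^ k * Suc (2 * n + 1) = 2 ^ Suc k * Suc n" by simp
  ultimately have "2 ^ k * x (2 ^ k * Suc (2 * n + 2) - 1) \<le> 2 ^ k * x (2 ^ Suc k * Suc n - 1)"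
    by (metis mult_left_mono zero_le_numeral zero_le_power)
  moreover have "descendant_sum x k (2 * n + 1) \<le> 2 ^ k * x (2 ^ Suc k * Suc n - 1)"
    using Suc[of "2 * n + 1"] \<open>(2::nat) ^ k * Suc (2 * n + 1) = 2 ^ Suc k * Suc n\<close> by metis
  moreover have "2 ^ Suc k * x (2 ^ Suc k * Suc n - 1) = 2 * (2 ^ k * x (2 ^ Suc k * Suc n - 1))" by simp
  ultimately show ?case using Suc[of "2 * n + 2"] unfolding descendant_sum.simps by linarith
qed simp

text \<open>
  The mass of the whole subtree with root \<open>n\<close>.
\<close>

definition up_flow :: "(nat \<Rightarrow> real) \<Rightarrow> nat \<Rightarrow> real"
  where "up_flow x n = (\<Sum>k. descendant_sum x k n)"

lemma
  assumes x: "decseq x" "\<And>n. 0 \<le> x n" "summable x"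
  shows descendant_sum_summable: "summable (\<lambda>k. descendant_sum x k n)"
    and up_flow_le: "up_flow x n \<le> x n + 2 * arith_mean_inf x n"
proof -
  have step: "real (Suc n) * descendant_sum x (Suc k) n \<le> 2 * (\<Sum>j\<in>{2 ^ k * Suc n..<2 ^ Suc k * Suc n}. x j)" for k
  proof -
    have "real (Suc n) * descendant_sum x (Suc k) n \<le> real (Suc n) * (2 ^ Suc k * x (2 ^ Suc k * Suc n - 1))"
      by (intro mult_left_mono descendant_sum_le x) simp
    also have "\<dots> = 2 * (\<Sum>j\<in>{2 ^ k * Suc n..<2 ^ Suc k * Suc n}. x (2 ^ Suc k * Suc n - 1))"
      by (simp add: algebra_simps)
    also have "\<dots> \<le> 2 * (\<Sum>j\<in>{2 ^ k * Suc n..<2 ^ Suc k * Suc n}. x j)"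
      using x(1) by (intro mult_left_mono sum_mono) (auto simp: decseq_def)
    finally show ?thesis .
  qed
  have part: "real (Suc n) * (\<Sum>k<K. descendant_sum x (Suc k) n) \<le> 2 * (\<Sum>j\<in>{Suc n..<2 ^ K * Suc n}. x j)" for K
  proof (induction K)
    case (Suc K)
    have le: "Suc n \<le> 2 ^ K * Suc n" "2 ^ K * Suc n \<le> 2 ^ Suc K * Suc n"
      using mult_right_mono[OF one_le_power[of "2::nat" K], of "Suc n"] by simp_all
    have "(\<Sum>j\<in>{Suc n..<2 ^ Suc K * Suc n}. x j)
        = (\<Sum>j\<in>{Suc n..<2 ^ K * Suc n}. x j) + (\<Sum>j\<in>{2 ^ K * Suc n..<2 ^ Suc K * Suc n}. x j)"
      by (rule sum.atLeastLessThan_concat[OF le, symmetric])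
    then show ?case using Suc step[of K] by (simp only: sum.lessThan_Suc distrib_left)
  qed simp
  have tail: "(\<Sum>j\<in>{Suc n..<N}. x j) \<le> (\<Sum>j. x (j + Suc n))" for N
  proof (cases "Suc n \<le> N")
    case True
    have "(\<Sum>j\<in>{Suc n..<N}. x j) = (\<Sum>j<N - Suc n. x (j + Suc n))"
      using sum.shift_bounds_nat_ivl[of x 0 "Suc n" "N - Suc n"] True by (simp add: atLeast0LessThan)
    also have "\<dots> \<le> (\<Sum>j. x (j + Suc n))"
      by (intro sum_le_suminf summable_ignore_initial_segment x) (simp_all add: x)
    finally show ?thesis .
  next
    case False
    then show ?thesis using suminf_shift_nonneg[OF x(2,3)] by (simp del: add_Suc_right)
  qed
  have bound: "(\<Sum>k<K. descendant_sum x (Suc k) n) \<le> 2 * arith_mean_inf x n" for K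
  proof -
    have "real (Suc n) * (\<Sum>k<K. descendant_sum x (Suc k) n) \<le> 2 * (\<Sum>j. x (j + Suc n))"
      using part[of K] tail[of "2 ^ K * Suc n"] by linarith
    then show ?thesis unfolding arith_mean_inf_def by (simp add: field_simps del: add_Suc_right)
  qed
  have s: "summable (\<lambda>k. descendant_sum x (Suc k) n)"
    by (rule summableI_nonneg_bounded[OF descendant_sum_nonneg[OF x(2)] bound])
  show s0: "summable (\<lambda>k. descendant_sum x k n)"
    using s by (rule iffD1[OF summable_Suc_iff[of "\<lambda>k. descendant_sum x k n"]])
  have "(\<Sum>k. descendant_sum x (Suc k) n) \<le> 2 * arith_mean_inf x n"
    by (rule suminf_le_const[OF s bound])
  then show "up_flow x n \<le> x n + 2 * arith_mean_inf x n"
    using suminf_split_head[OF s0] by (simp add: up_flow_def)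
qed

lemma up_flow_step:
  assumes x: "decseq x" "\<And>n. 0 \<le> x n" "summable x"
  shows "up_flow x n = x n + up_flow x (2 * n + 1) + up_flow x (2 * n + 2)"
proof -
  note s = descendant_sum_summable[OF x]
  have "up_flow x n = x n + (\<Sum>k. descendant_sum x (Suc k) n)"
    using suminf_split_head[OF s, of n] by (simp add: up_flow_def)
  also have "(\<Sum>k. descendant_sum x (Suc k) n) = up_flow x (2 * n + 1) + up_flow x (2 * n + 2)"
    unfolding up_flow_def descendant_sum.simps by (rule suminf_add[OF s s, symmetric])
  finally show ?thesis by simp
qed

lemma up_flow_nonneg:
  assumes x: "decseq x" "\<And>n. 0 \<le> x n" "summable x"
  shows "0 \<le> up_flow x n"
  unfolding up_flow_def by (intro suminf_nonneg descendant_sum_summable descendant_sum_nonneg x)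

text \<open>
  The term \<open>x c\<close> in the bound for \<open>up_flow x c\<close> is at most the mean, because \<open>x c\<close> is at most each of the
  \<open>n + 1\<close> entries with the indices \<open>n + 1, \<dots>, 2 n + 1\<close>.
\<close>

lemma up_flow_child_le:
  assumes x: "decseq x" "\<And>n. 0 \<le> x n" "summable x" and c: "c \<ge> 2 * n + 1"
  shows "up_flow x c \<le> 3 * arith_mean_inf x n"
proof -
  have "real (Suc n) * x c = (\<Sum>j<Suc n. x c)" by simp
  also have "\<dots> \<le> (\<Sum>j<Suc n. x (j + Suc n))" using x(1) c by (intro sum_mono) (auto simp: decseq_def)
  also have "\<dots> \<le> (\<Sum>j. x (j + Suc n))"
    by (intro sum_le_suminf summable_ignore_initial_segment x) (simp_all add: x)
  finally have "x c \<le> arith_mean_inf x n"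
    unfolding arith_mean_inf_def by (simp add: field_simps del: add_Suc_right)
  moreover have "arith_mean_inf x c \<le> arith_mean_inf x n"
    using decseq_arith_mean_inf[OF x(2,3)] c by (simp add: decseq_def)
  ultimately show ?thesis using up_flow_le[OF x, of c] by linarith
qed

section \<open>Positive operators in the commutator space\<close>

lemma has_cdim_0: "has_cdim {0 :: 'a::complex_vector} 0"
  unfolding has_cdim_def
  by (intro exI[of _ "{}"]) (simp add: complex_vector.independent_empty)

context hilbert_basis
begin

lemma zero_finite_rank: "0 \<in> (finite_rank :: ('a \<Rightarrow>\<^sub>L 'a) set)"
proof -
  have "range (blinfun_apply (0 :: 'a \<Rightarrow>\<^sub>L 'a)) = {0}" by auto
  then show ?thesis unfolding finite_rank_def using BH_zero has_cdim_0 by auto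
qed

lemma rank_one_diagonal:
  assumes e: "orthonormal UNIV (e :: nat \<Rightarrow> 'a)"
  shows "series_op (\<lambda>k. if k = 0 then t else 0) e e \<in> finite_rank"
    and "blinfun_apply (series_op (\<lambda>k. if k = 0 then t else 0) e e) x = (of_real t * cinner x (e 0)) *\<^sub>C e 0"
proof -
  let ?a = "\<lambda>k::nat. if k = 0 then t else 0"
  note se = orthonormal_imp_suborthonormal[OF e]
  have b: "Bseq ?a" by (intro BseqI'[where K = "\<bar>t\<bar>"]) simp
  show ap: "series_op ?a e e x = (of_real t * cinner x (e 0)) *\<^sub>C e 0" for x
  proof -
    have "(\<Sum>k. (of_real (?a k) * cinner x (e k)) *\<^sub>C e k) = (\<Sum>k\<in>{0}. (of_real (?a k) * cinner x (e k)) *\<^sub>C e k)"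
      by (rule suminf_finite) auto
    then show ?thesis by (simp add: series_op_apply[OF se se b])
  qed
  have "\<exists>k. has_cdim (range (blinfun_apply (series_op ?a e e))) k"
  proof (cases "t = 0")
    case True
    then have "range (blinfun_apply (series_op ?a e e)) = {0}" by (auto simp: ap)
    then show ?thesis using has_cdim_0 by auto
  next
    case False
    have "range (blinfun_apply (series_op ?a e e)) = complex_vector.span {e 0}"
    proof
      show "range (blinfun_apply (series_op ?a e e)) \<subseteq> complex_vector.span {e 0}"
        by (auto simp: ap complex_vector.span_singleton)
      show "complex_vector.span {e 0} \<subseteq> range (blinfun_apply (series_op ?a e e))"
      proof
        fix y assume "y \<in> complex_vector.span {e 0}"
        then obtain c where y: "y = c *\<^sub>C e 0" by (auto simp: complex_vector.span_singleton)
        have "cinner (e 0) (e 0) = 1" using e by (simp add: orthonormal_def)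
        then have "series_op ?a e e ((c / of_real t) *\<^sub>C e 0) = y"
          using False by (simp add: ap y cinner_lin)
        then show "y \<in> range (blinfun_apply (series_op ?a e e))" by (metis rangeI)
      qed
    qed
    moreover have "complex_vector.independent {e 0}"
      by (rule orthonormal_independent) (use e in \<open>auto simp: orthonormal_def\<close>)
    ultimately have "has_cdim (range (blinfun_apply (series_op ?a e e))) 1"
      unfolding has_cdim_def by (intro exI[of _ "{e 0}"]) simp
    then show ?thesis by blast
  qed
  then show "series_op ?a e e \<in> finite_rank"
    unfolding finite_rank_def using series_op_BH[OF se se b] by blast
qed

text \<open>
  The singular values of a finite rank operator vanish from some index on, and \<open>I\<close> contains an operator
  with nonzero first singular value.
\<close>

lemma finite_rank_in_ideal:
  assumes I: "op_ideal (I :: ('a \<Rightarrow>\<^sub>L 'a) set)" and nz: "I \<noteq> {0}" and A: "A \<in> finite_rank"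
  shows "A \<in> I"
proof -
  have BA: "A \<in> BH" using A by (simp add: finite_rank_def)
  obtain B where B: "finite B" "\<And>x. A x = (\<Sum>b\<in>B. cinner (A x) b *\<^sub>C b)"
    using finite_rank_basis[OF A] by metis
  define N where "N = card B"
  have g: "gelfand_bound A n 0" if "n \<ge> N" for n
  proof -
    have "A x = 0" if x: "\<forall>s\<in>adj A ` B. cinner x s = 0" for x
    proof -
      have "cinner (A x) b = 0" if "b \<in> B" for b
        using x that cinner_adj_right[OF BA, of x b] by simp
      then show ?thesis by (subst B(2)) simp
    qed
    moreover have "card (adj A ` B) \<le> n" using card_image_le[OF B(1), of "adj A"] that by (simp add: N_def)
    ultimately show ?thesis unfolding gelfand_bound_def using B(1)
      by (intro exI[of _ "adj A ` B"]) auto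
  qed
  have "gelfand_bound A N \<epsilon>" if "\<epsilon> > 0" for \<epsilon>
    by (rule gelfand_bound_mono[OF g]) (use that in simp_all)
  then have "compact_op A" unfolding compact_op_def using BA by blast
  then obtain \<tau> k where s: "svd A \<tau> k" using svd_exists by blast
  obtain \<zeta> where \<zeta>: "\<zeta> \<in> char_set I" "0 < \<zeta> 0" using nonzero_ideal_char_set[OF I nz] .
  note S = char_cone_char_set[OF I]
  have "\<tau> \<in> char_set I"
    by (rule char_cone_eventually_dominated[OF S \<zeta> \<zeta>(1) svdD(4,5)[OF s], of 1 N 0])
      (use svd_le_gelfand[OF s g] in auto)
  then show ?thesis using ideal_mem_iff[OF I s] by blast
qed

lemma commutator_space_subset:
  assumes I: "op_ideal (I :: ('a \<Rightarrow>\<^sub>L 'a) set)"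
  shows "commutator_space I \<subseteq> I"
  unfolding commutator_space_def
proof (rule complex_vector.span_minimal)
  show "complex_vector.subspace I"
    unfolding complex_vector.subspace_def
    using op_idealD(2,3)[OF I] op_ideal_scaleC[OF I] by blast
  show "{(X o\<^sub>L Y) - (Y o\<^sub>L X) | X Y. X \<in> I \<and> Y \<in> BH} \<subseteq> I"
    using op_ideal_diff[OF I op_idealD(5)[OF I] op_idealD(4)[OF I]] by blast
qed

lemma F_plus_comm_subset:
  assumes I: "op_ideal (I :: ('a \<Rightarrow>\<^sub>L 'a) set)" and nz: "I \<noteq> {0}"
  shows "F_plus_comm I \<subseteq> I"
  unfolding F_plus_comm_def
  using finite_rank_in_ideal[OF I nz] commutator_space_subset[OF I] op_idealD(3)[OF I] by blast

lemma commutator_of_arith_mean: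
  fixes X :: "'a \<Rightarrow>\<^sub>L 'a"
  assumes I: "op_ideal I" and X: "svd X \<sigma> e" and eig: "\<And>n. X (e n) = \<sigma> n *\<^sub>R e n"
    and mean: "arith_mean \<sigma> \<in> char_set I"
  shows "X \<in> commutator_space I"
proof (rule tree_commutators[OF I mean svdD(2)[OF X], of "down_flow \<sigma>" 3])
  note d = svdD(4,5)[OF X]
  have "\<bar>(\<sigma> n + down_flow \<sigma> n) / 2\<bar> \<le> 3 * arith_mean \<sigma> n" for n
    using down_flow_le[OF d, of n] arith_mean_ge[OF d(1), of n] down_flow_nonneg[of \<sigma> n, OF d(2)] d(2)[of n]
    by simp
  then show "\<bar>down_flow \<sigma> (2 * n + 1)\<bar> \<le> 3 * arith_mean \<sigma> n" "\<bar>down_flow \<sigma> (2 * n + 2)\<bar> \<le> 3 * arith_mean \<sigma> n" for n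
    by simp_all
  show "X (e n) = (down_flow \<sigma> (2 * n + 1) + down_flow \<sigma> (2 * n + 2) - down_flow \<sigma> n) *\<^sub>R e n" for n
    by (simp add: eig)
qed (use svdD(1)[OF X] svd_perp[OF X] in auto)

text \<open>
  The flow towards the root is a flow away from it with negative weights. At the root it leaves the
  deficit \<open>up_flow \<sigma> 0\<close>, the trace of \<open>X\<close>, which \<open>R\<close> compensates.
\<close>

lemma F_plus_comm_of_arith_mean_inf:
  fixes X :: "'a \<Rightarrow>\<^sub>L 'a"
  assumes I: "op_ideal I" and X: "svd X \<sigma> e" and eig: "\<And>n. X (e n) = \<sigma> n *\<^sub>R e n"
    and sum: "summable \<sigma>" and mean: "arith_mean_inf \<sigma> \<in> char_set I"
  shows "X \<in> F_plus_comm I"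
proof -
  note d = svdD(4,5)[OF X] sum
  define R where "R = series_op (\<lambda>k. if k = 0 then up_flow \<sigma> 0 else 0) e e"
  have R: "R \<in> finite_rank" unfolding R_def by (rule rank_one_diagonal(1)[OF svdD(2)[OF X]])
  have Rx: "R x = (of_real (up_flow \<sigma> 0) * cinner x (e 0)) *\<^sub>C e 0" for x
    unfolding R_def by (rule rank_one_diagonal(2)[OF svdD(2)[OF X]])
  define w where "w = (\<lambda>n. if n = 0 then 0 else - up_flow \<sigma> n)"
  have "X - R \<in> commutator_space I"
  proof (rule tree_commutators[OF I mean svdD(2)[OF X], of w 3])
    show "\<bar>w (2 * n + 1)\<bar> \<le> 3 * arith_mean_inf \<sigma> n" "\<bar>w (2 * n + 2)\<bar> \<le> 3 * arith_mean_inf \<sigma> n" for n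
      using up_flow_child_le[OF d, of n] up_flow_nonneg[OF d] by (simp_all add: w_def)
    have "cinner (e n) (e 0) = (if n = 0 then 1 else 0)" for n
      using svdD(2)[OF X] by (simp add: orthonormal_def)
    then have "R (e n) = (if n = 0 then up_flow \<sigma> 0 else 0) *\<^sub>R e n" for n
      by (simp add: Rx scaleC_of_real)
    then show "(X - R) (e n) = (w (2 * n + 1) + w (2 * n + 2) - w n) *\<^sub>R e n" for n
      using up_flow_step[OF d, of n] by (cases "n = 0") (simp_all add: blinfun.diff_left eig w_def flip: scaleR_diff_left)
    show "X - R \<in> BH" using svdD(1)[OF X] R by (intro BH_diff) (auto simp: finite_rank_def)
    show "(X - R) x = 0" if "\<And>n. cinner x (e n) = 0" for x
      using svd_perp[OF X that] that by (simp add: blinfun.diff_left Rx)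
  qed (simp add: w_def)
  then show ?thesis unfolding F_plus_comm_def using R by (intro CollectI exI[of _ R] exI[of _ "X - R"]) simp
qed

lemma positive_F_plus_comm_omega:
  fixes X :: "'a \<Rightarrow>\<^sub>L 'a"
  assumes I: "op_ideal I" and \<omega>: "omega \<in> char_set I" and pos: "positive_op X"
    and X: "svd X \<sigma> e" and eig: "\<And>n. X (e n) = \<sigma> n *\<^sub>R e n"
  shows "X \<in> F_plus_comm I \<longleftrightarrow> arith_mean \<sigma> \<in> char_set I"
proof
  note S = char_cone_char_set[OF I]
  assume "X \<in> F_plus_comm I"
  then obtain \<tau> where "near_trace (char_set I) \<tau> X" using near_trace_F_plus_comm[OF I] by blast
  then obtain \<eta> M where \<eta>: "\<eta> \<in> char_set I" "\<And>n. (\<Sum>j\<le>n. \<sigma> j) \<le> Re \<tau> + real (Suc n) * \<eta> n"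
    using trace_sandwich[OF S pos X eig] by metis
  have "(\<lambda>n. \<bar>Re \<tau>\<bar> * omega n + \<eta> n) \<in> char_set I"
    by (intro char_coneD(2)[OF S] char_cone_scale[OF S \<omega>] \<eta>(1)) simp
  then show "arith_mean \<sigma> \<in> char_set I"
  proof (rule char_cone_dominated[OF S])
    show "decseq (arith_mean \<sigma>)" by (rule decseq_arith_mean[OF svdD(4,5)[OF X]])
    show "0 \<le> arith_mean \<sigma> n" for n by (rule arith_mean_nonneg[OF svdD(5)[OF X]])
    show "arith_mean \<sigma> n \<le> 1 * (\<bar>Re \<tau>\<bar> * omega (n div 1) + \<eta> (n div 1))" for n
    proof -
      have "(\<Sum>j\<le>n. \<sigma> j) \<le> \<bar>Re \<tau>\<bar> + real (Suc n) * \<eta> n" using \<eta>(2)[of n] abs_ge_self[of "Re \<tau>"] by linarith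
      then have "arith_mean \<sigma> n \<le> (\<bar>Re \<tau>\<bar> + real (Suc n) * \<eta> n) / real (Suc n)"
        unfolding arith_mean_def by (rule divide_right_mono) simp
      then show ?thesis by (simp add: omega_def add_divide_distrib)
    qed
  qed simp
next
  assume "arith_mean \<sigma> \<in> char_set I"
  then have "X \<in> commutator_space I" by (rule commutator_of_arith_mean[OF I X eig])
  then show "X \<in> F_plus_comm I"
    unfolding F_plus_comm_def using zero_finite_rank by (intro CollectI exI[of _ 0] exI[of _ X]) simp
qed

text \<open>
  Otherwise \<open>\<eta>\<close> would eventually dominate a multiple of \<open>\<omega>\<close>.
\<close>

lemma liminf_not_omega:
  assumes S: "char_cone S" and \<omega>: "omega \<notin> S" and \<eta>: "\<eta> \<in> S" and \<epsilon>: "\<epsilon> > 0"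
    and pos: "\<zeta> \<in> S" "0 < \<zeta> 0"
  shows "\<exists>n\<ge>N. real (Suc n) * \<eta> n < \<epsilon>"
proof (rule ccontr)
  assume "\<not> ?thesis"
  then have ge: "\<epsilon> \<le> real (Suc n) * \<eta> n" if "n \<ge> N" for n using that by (simp add: not_less)
  have "omega \<in> S"
  proof (rule char_cone_eventually_dominated[OF S pos \<eta>])
    show "decseq omega" by (rule decseq_SucI) (simp add: omega_def frac_le)
    show "0 \<le> omega n" for n by (simp add: omega_def)
    show "omega n \<le> (1 / \<epsilon>) * \<eta> (n div 1)" if "n \<ge> N" for n
      using ge[OF that] \<epsilon> by (simp add: omega_def field_simps)
  qed simp
  then show False using \<omega> by blast
qed

text \<open>
  By \<open>liminf_not_omega\<close> the upper bound \<open>\<tau> + (n + 1) \<eta> n\<close> for the partial sums comes arbitrarily close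
  to \<open>\<tau>\<close>. So \<open>\<sigma>\<close> has a sum of at most \<open>\<tau>\<close>, and the lower bound turns into a bound for the tails.
\<close>

lemma positive_F_plus_comm_not_omega:
  fixes X :: "'a \<Rightarrow>\<^sub>L 'a"
  assumes I: "op_ideal I" and nz: "I \<noteq> {0}" and \<omega>: "omega \<notin> char_set I" and pos: "positive_op X"
    and X: "svd X \<sigma> e" and eig: "\<And>n. X (e n) = \<sigma> n *\<^sub>R e n"
  shows "X \<in> F_plus_comm I \<longleftrightarrow> summable \<sigma> \<and> arith_mean_inf \<sigma> \<in> char_set I"
proof
  note S = char_cone_char_set[OF I] and \<sigma>0 = svdD(5)[OF X]
  obtain \<zeta> where \<zeta>: "\<zeta> \<in> char_set I" "0 < \<zeta> 0" using nonzero_ideal_char_set[OF I nz] .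
  assume "X \<in> F_plus_comm I"
  then obtain \<tau> where "near_trace (char_set I) \<tau> X" using near_trace_F_plus_comm[OF I] by blast
  then obtain \<eta> M where \<eta>: "\<eta> \<in> char_set I" "M > 0"
    "\<And>n. (\<Sum>j\<le>n. \<sigma> j) \<le> Re \<tau> + real (Suc n) * \<eta> n"
    "\<And>n. Re \<tau> \<le> (\<Sum>j<M * Suc n. \<sigma> j) + real (Suc n) * \<eta> n"
    using trace_sandwich[OF S pos X eig] by metis
  have part: "(\<Sum>j<n. \<sigma> j) \<le> Re \<tau>" for n
  proof (rule field_le_epsilon)
    fix \<epsilon> :: real assume "\<epsilon> > 0"
    then obtain k where k: "k \<ge> n" "real (Suc k) * \<eta> k < \<epsilon>" using liminf_not_omega[OF S \<omega> \<eta>(1) _ \<zeta>] by blast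
    have "(\<Sum>j<n. \<sigma> j) \<le> (\<Sum>j\<le>k. \<sigma> j)" using k(1) \<sigma>0 by (intro sum_mono2) auto
    then show "(\<Sum>j<n. \<sigma> j) \<le> Re \<tau> + \<epsilon>" using \<eta>(3)[of k] k(2) by linarith
  qed
  have sum: "summable \<sigma>" by (rule summableI_nonneg_bounded[OF \<sigma>0 part])
  have le: "suminf \<sigma> \<le> Re \<tau>" by (rule suminf_le_const[OF sum part])
  have tail: "(\<Sum>j. \<sigma> (j + M * Suc n)) \<le> real (Suc n) * \<eta> n" for n
    using suminf_split_initial_segment[OF sum, of "M * Suc n"] \<eta>(4)[of n] le by simp
  have "arith_mean_inf \<sigma> \<in> char_set I"
  proof (rule char_cone_eventually_dominated[OF S \<zeta> \<eta>(1)])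
    show "decseq (arith_mean_inf \<sigma>)" by (rule decseq_arith_mean_inf[OF \<sigma>0 sum])
    show "0 \<le> arith_mean_inf \<sigma> n" for n by (rule arith_mean_inf_nonneg[OF \<sigma>0 sum])
    show "2 * M > 0" using \<eta>(2) by simp
    show "arith_mean_inf \<sigma> N \<le> 1 * \<eta> (N div (2 * M))" if N: "N \<ge> M" for N
    proof -
      \<comment> \<open>the largest \<open>n\<close> for which \<open>tail\<close> still bounds the tail of \<open>\<sigma>\<close> beyond \<open>N\<close>\<close>
      define n where "n = Suc N div M - 1"
      have k1: "Suc N div M \<ge> 1" using N \<eta>(2) by (simp add: Suc_le_eq div_greater_zero_iff)
      have n: "M * Suc n \<le> Suc N" "Suc n \<le> Suc N" "N div (2 * M) \<le> n"
      proof -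
        have Sn: "Suc n = Suc N div M" using k1 by (simp add: n_def)
        show "M * Suc n \<le> Suc N" "Suc n \<le> Suc N" unfolding Sn by simp_all
        have "N div (2 * M) = (N div M) div 2" by (simp add: div_mult2_eq[symmetric] mult.commute)
        moreover have "N div M \<le> Suc N div M" by (intro div_le_mono) simp
        ultimately show "N div (2 * M) \<le> n" using k1 unfolding n_def by linarith
      qed
      have "(\<Sum>j. \<sigma> (j + Suc N)) \<le> (\<Sum>j. \<sigma> (j + M * Suc n))" by (rule suminf_shift_le[OF \<sigma>0 sum n(1)])
      also have "\<dots> \<le> real (Suc n) * \<eta> n" by (rule tail)
      also have "\<dots> \<le> real (Suc N) * \<eta> (N div (2 * M))"
        using n(2,3) c0_star_ge[OF char_coneD(1)[OF S \<eta>(1)]] c0_star_nonneg[OF char_coneD(1)[OF S \<eta>(1)]]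
        by (intro mult_mono) auto
      finally show ?thesis unfolding arith_mean_inf_def by (simp add: field_simps del: add_Suc_right)
    qed
  qed
  then show "summable \<sigma> \<and> arith_mean_inf \<sigma> \<in> char_set I" using sum by blast
next
  assume "summable \<sigma> \<and> arith_mean_inf \<sigma> \<in> char_set I"
  then show "X \<in> F_plus_comm I" using F_plus_comm_of_arith_mean_inf[OF I X eig] by blast
qed

lemma calkin_ideal_iff:
  fixes X :: "'a \<Rightarrow>\<^sub>L 'a"
  assumes "svd X \<sigma> e"
  shows "X \<in> calkin_ideal S \<longleftrightarrow> \<sigma> \<in> S"
  using assms s_numbers_svd unfolding calkin_ideal_def by blast

lemma pos_part_eq_calkin:
  assumes I: "op_ideal (I :: ('a \<Rightarrow>\<^sub>L 'a) set)" and nz: "I \<noteq> {0}"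
    and iff: "\<And>X \<sigma> e. positive_op X \<Longrightarrow> svd X \<sigma> e \<Longrightarrow> (\<And>n. X (e n) = \<sigma> n *\<^sub>R (e n :: 'a)) \<Longrightarrow>
      X \<in> F_plus_comm I \<longleftrightarrow> \<sigma> \<in> S"
  shows "pos_part_set (F_plus_comm I) = pos_part_set (calkin_ideal S)"
proof -
  have "X \<in> F_plus_comm I \<longleftrightarrow> X \<in> calkin_ideal S" if pos: "positive_op X" for X
  proof -
    have "X \<in> F_plus_comm I \<longleftrightarrow> X \<in> calkin_ideal S" if comp: "compact_op X"
    proof -
      obtain \<sigma> e where s: "svd X \<sigma> e" "\<And>n. X (e n) = \<sigma> n *\<^sub>R e n"
        using svd_exists_positive[OF comp pos] by blast
      show ?thesis unfolding calkin_ideal_iff[OF s(1)] by (rule iff[OF pos s])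
    qed
    moreover have "compact_op X" if "X \<in> F_plus_comm I"
      using F_plus_comm_subset[OF I nz] proper_ideal_compact[OF I] that by blast
    moreover have "compact_op X" if "X \<in> calkin_ideal S"
      using that svd_compact unfolding calkin_ideal_def by blast
    ultimately show ?thesis by blast
  qed
  then show ?thesis unfolding pos_part_set_def by blast
qed

text \<open>
  Compactness of \<open>Y\<close> follows from \<open>\<parallel>Y x\<parallel>\<^sup>2 \<le> M \<langle>Y x, x\<rangle> \<le> M \<langle>X x, x\<rangle>\<close>. This only gives the square root of the
  expected bound; the sharp one comes from the quadratic form on the span of the eigenvectors of \<open>Y\<close>.
\<close>

lemma singular_values_mono:
  fixes X Y :: "'a \<Rightarrow>\<^sub>L 'a"
  assumes Y: "positive_op Y" and XY: "positive_op (X - Y)"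
    and sX: "svd X \<sigma> e"
  obtains \<tau> k where "svd Y \<tau> k" "\<And>n. \<tau> n \<le> \<sigma> n"
proof -
  have form: "Re (cinner (Y x) x) \<le> \<sigma> n * (norm x)\<^sup>2" if x: "\<And>j. j < n \<Longrightarrow> cinner x (e j) = 0" for n x
  proof -
    have "Re (cinner (Y x) x) \<le> Re (cinner (X x) x)"
      using positive_opD(2)[OF XY, of x] by (simp add: blinfun.diff_left cinner_lin)
    also have "\<dots> \<le> norm (X x) * norm x" using complex_Re_le_cmod cauchy_schwarz order.trans by blast
    also have "\<dots> \<le> (\<sigma> n * norm x) * norm x" by (intro mult_right_mono svdD(8)[OF sX] x) auto
    finally show ?thesis by (simp add: power2_eq_square mult.assoc)
  qed
  define M where "M = norm Y + 1"
  have M: "M > 0" by (simp add: M_def add_nonneg_pos)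
  have sq: "(norm (Y x))\<^sup>2 \<le> M * Re (cinner (Y x) x)" for x
  proof (rule positive_form_bound[OF Y M])
    have "Re (cinner (Y (Y x)) (Y x)) \<le> norm (Y (Y x)) * norm (Y x)"
      using complex_Re_le_cmod cauchy_schwarz order.trans by blast
    also have "\<dots> \<le> (norm Y * norm (Y x)) * norm (Y x)" by (intro mult_right_mono norm_blinfun) auto
    also have "\<dots> \<le> M * (norm (Y x))\<^sup>2" by (simp add: M_def power2_eq_square mult.assoc mult_right_mono)
    finally show "Re (cinner (Y (Y x)) (Y x)) \<le> M * (norm (Y x))\<^sup>2" .
  qed
  have g: "gelfand_bound Y n (sqrt (M * \<sigma> n))" for n
  proof -
    have "norm (Y x) \<le> sqrt (M * \<sigma> n) * norm x" if "\<forall>s\<in>e ` {..<n}. cinner x s = 0" for x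
    proof (rule power2_le_imp_le)
      have "(norm (Y x))\<^sup>2 \<le> M * (\<sigma> n * (norm x)\<^sup>2)"
        by (rule order.trans[OF sq mult_left_mono[OF form]]) (use that M in auto)
      then show "(norm (Y x))\<^sup>2 \<le> (sqrt (M * \<sigma> n) * norm x)\<^sup>2"
        using M svdD(5)[OF sX, of n] by (simp add: power_mult_distrib mult.assoc)
    qed (use M svdD(5)[OF sX, of n] in simp)
    moreover have "card (e ` {..<n}) \<le> n" using card_image_le[of "{..<n}" e] by simp
    ultimately show ?thesis unfolding gelfand_bound_def by blast
  qed
  have "(\<lambda>n. sqrt (M * \<sigma> n)) \<longlonglongrightarrow> sqrt (M * 0)"
    by (intro tendsto_real_sqrt tendsto_mult_left svdD(6)[OF sX])
  moreover have "decseq (\<lambda>n. sqrt (M * \<sigma> n))"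
    using svdD(4)[OF sX] M by (auto simp: decseq_def)
  ultimately have "(\<lambda>n. sqrt (M * \<sigma> n)) \<in> c0_star"
    using M svdD(5)[OF sX] by (simp add: c0_star_def)
  then have "compact_op Y"
    by (rule gelfand_bound_compactI[OF positive_opD(1)[OF Y], of _ 1 1]) (simp_all add: g)
  then obtain \<tau> k where s: "svd Y \<tau> k" "\<And>n. Y (k n) = \<tau> n *\<^sub>R k n"
    using svd_exists_positive[OF _ Y] by blast
  have "\<tau> n \<le> \<sigma> n" for n
  proof -
    have o: "orthonormal {..n} k" by (rule orthonormal_subset[OF svdD(2)[OF s(1)]]) simp
    have "card (e ` {..<n}) < card {..n}" using card_image_le[of "{..<n}" e] by simp
    then obtain c where c: "(\<Sum>i\<le>n. (cmod (c i))\<^sup>2) = 1"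
      "\<And>s. s \<in> e ` {..<n} \<Longrightarrow> cinner (\<Sum>i\<le>n. c i *\<^sub>C k i) s = 0"
      using orthogonal_combination[OF o] by blast
    define z where "z = (\<Sum>i\<le>n. c i *\<^sub>C k i)"
    have nz: "(norm z)\<^sup>2 = 1" unfolding z_def using orthonormal_norm_sum[OF o] c(1) by simp
    have zk: "cinner z (k j) = c j" if "j \<le> n" for j
      unfolding z_def by (rule orthonormal_comb_cinner[OF o]) (use that in auto)
    have "\<tau> n = (\<Sum>j\<le>n. \<tau> n * (cmod (c j))\<^sup>2)" using c(1) by (simp flip: sum_distrib_left)
    also have "\<dots> \<le> (\<Sum>j\<le>n. \<tau> j * (cmod (c j))\<^sup>2)"
      using svdD(4)[OF s(1)] by (intro sum_mono mult_right_mono) (auto simp: decseq_def)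
    also have "\<dots> = (\<Sum>j<Suc n. \<tau> j * (cmod (cinner z (k j)))\<^sup>2)"
      by (intro sum.cong) (auto simp: zk)
    also have "\<dots> \<le> Re (cinner (Y z) z)" by (rule positive_form_split(1)[OF Y s])
    also have "\<dots> \<le> \<sigma> n * (norm z)\<^sup>2" by (rule form) (use c(2) in \<open>auto simp: z_def\<close>)
    finally show ?thesis using nz by simp
  qed
  then show ?thesis using that s(1) by blast
qed

lemma pos_part_calkin_hereditary:
  fixes X Y :: "'a \<Rightarrow>\<^sub>L 'a"
  assumes S: "char_cone S" and Y: "positive_op Y" and XY: "positive_op (X - Y)"
    and X: "X \<in> pos_part_set (calkin_ideal S)"
  shows "Y \<in> pos_part_set (calkin_ideal S)"
proof -
  obtain \<sigma> e where s: "svd X \<sigma> e" "\<sigma> \<in> S" using X unfolding pos_part_set_def calkin_ideal_def by blast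
  obtain \<tau> k where t: "svd Y \<tau> k" "\<And>n. \<tau> n \<le> \<sigma> n"
    using singular_values_mono[OF Y XY s(1)] by blast
  have "\<tau> \<in> S" by (rule char_coneD(3)[OF S s(2) svdD(3)[OF t(1)], of 1 1]) (use t(2) in auto)
  then show ?thesis using t(1) Y unfolding pos_part_set_def calkin_ideal_def by blast
qed

end

theorem corollary6p2:
  fixes I :: "('a::chilbert_space \<Rightarrow>\<^sub>L 'a) set"
  assumes separable: "separable_space (euclidean :: 'a topology)"
    and infinite_dim: "\<nexists>k. has_cdim (UNIV :: 'a set) k"
    and ideal: "op_ideal I"
    and nonzero: "I \<noteq> {0}"
  shows "(omega \<notin> char_set I \<longrightarrow>
      pos_part_set (F_plus_comm I) = pos_part_set (pre_am_inf_ideal I)) \<and>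
    (omega \<in> char_set I \<longrightarrow>
      pos_part_set (F_plus_comm I) = pos_part_set (pre_am_ideal I)) \<and>
    (\<forall>X Y. positive_op Y \<and> positive_op (X - Y) \<and> X \<in> pos_part_set (F_plus_comm I) \<longrightarrow>
      Y \<in> pos_part_set (F_plus_comm I))"
proof -
  obtain h :: "nat \<Rightarrow> 'a" where "hilbert_basis h"
    using hilbert_basis_exists[OF separable infinite_dim] by blast
  then interpret hilbert_basis h .
  note S = char_cone_char_set[OF ideal]
  obtain \<zeta> where \<zeta>: "\<zeta> \<in> char_set I" "0 < \<zeta> 0" using nonzero_ideal_char_set[OF ideal nonzero] .
  define P where "P = {\<xi> \<in> c0_star. arith_mean \<xi> \<in> char_set I}"
  define Q where "Q = {\<xi> \<in> l1_star. arith_mean_inf \<xi> \<in> char_set I}"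
  have P: "char_cone P" unfolding P_def by (rule char_cone_pre_am[OF S])
  have Q: "char_cone Q" unfolding Q_def by (rule char_cone_pre_am_inf[OF S \<zeta>])
  have i: "pos_part_set (F_plus_comm I) = pos_part_set (calkin_ideal Q)" if "omega \<notin> char_set I"
  proof (rule pos_part_eq_calkin[OF ideal nonzero])
    fix X \<sigma> and e :: "nat \<Rightarrow> 'a"
    assume X: "positive_op X" "svd X \<sigma> e" "\<And>n. X (e n) = \<sigma> n *\<^sub>R e n"
    show "X \<in> F_plus_comm I \<longleftrightarrow> \<sigma> \<in> Q"
      using positive_F_plus_comm_not_omega[OF ideal nonzero that X] svdD(3)[OF X(2)] by (simp add: Q_def l1_star_def)
  qed
  have ii: "pos_part_set (F_plus_comm I) = pos_part_set (calkin_ideal P)" if "omega \<in> char_set I"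
  proof (rule pos_part_eq_calkin[OF ideal nonzero])
    fix X \<sigma> and e :: "nat \<Rightarrow> 'a"
    assume X: "positive_op X" "svd X \<sigma> e" "\<And>n. X (e n) = \<sigma> n *\<^sub>R e n"
    show "X \<in> F_plus_comm I \<longleftrightarrow> \<sigma> \<in> P"
      using positive_F_plus_comm_omega[OF ideal that X] svdD(3)[OF X(2)] by (simp add: P_def)
  qed
  have iii: "Y \<in> pos_part_set (F_plus_comm I)"
    if "positive_op Y" "positive_op (X - Y)" "X \<in> pos_part_set (F_plus_comm I)" for X Y
    using pos_part_calkin_hereditary[OF P that(1,2)] pos_part_calkin_hereditary[OF Q that(1,2)] that(3) i ii
    by (cases "omega \<in> char_set I") auto
  have "pre_am_ideal I = calkin_ideal P" "pre_am_inf_ideal I = calkin_ideal Q"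
    unfolding pre_am_ideal_def pre_am_inf_ideal_def P_def[symmetric] Q_def[symmetric]
    by (rule ideal_of_char_set_eq[OF P], rule ideal_of_char_set_eq[OF Q])
  then show ?thesis using i ii iii by auto
qed

end
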